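(* For $n\ge 0$, let $\mathfrak{g}(4+2n)$ be the 3-step nilpotent $(4+2n)$-dimensional real Lie algebra obtained as central product of a 4-dimensional filiform Lie algebra and a $(2n+1)$-dimensional Heisenberg Lie algebra, and let $G(4+2n)$ be the corresponding simply connected nilpotent Lie group. Then, for every fixed $n$, the systolic growth of $G(4+2n)$, as a function of $r$, is $\simeq r^{D+n}$, where $D=2n+7$ is the homogeneous dimension.
   Context: Lie algebra notions. Explicitly, $\mathfrak{g}(4+2n)$ has basis $(U,V,W,Z,X_1,Y_1,\dots,X_n,Y_n)$ and nonzero brackets (up to antisymmetry) $[U,V]=W$, $[U,W]=Z$, and $[X_i,Y_i]=Z$ for all $1\le i\le n$. For a finite-dimensional nilpotent Lie algebra $\mathfrak{g}$, the lower central series is $\mathfrak{g}^1=\mathfrak{g}$, $\mathfrak{g}^{i+1}=[\mathfrak{g},\mathfrak{g}^i]$, and the homogeneous dimension is $D=\sum_{i\ge 1}\dim(\mathfrak{g}^i)$. Systolic growth. Let $H$ be a compactly generated locally compact group, $|\cdot|$ the word length relative to some compact generating subset. For $X\subset H$, the systole is $\mathrm{sys}(X)=\inf\{|x|:x\in X\smallsetminus\{1\}\}\in\mathbf{R}_+\cup\{+\infty\}$. Fix a left-invariant Haar measure on $H$. The systolic growth of $H$ is the function mapping $r\ge 0$ to the infimum $\sigma(r)\in\mathbf{R}_+\cup\{+\infty\}$ of covolumes of cocompact lattices of $H$ with systole $\ge r$. All lattices in nilpotent locally compact groups are cocompact, and the asymptotic type of $\sigma$ does not depend on the choices. Asymptotics.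 For functions $f,g$ of a positive real variable $r$, $f\preceq g$ means that there are constants $C,C',C''>0$ with $f(r)\le Cg(C'r)+C''$ for all $r$; $f\simeq g$ means $f\preceq g\preceq f$. *)

theory Defs
  imports "HOL-Analysis.Analysis" "HOL-Algebra.Generated_Groups"
begin

section \<open>Lie algebras on a Euclidean space\<close>

definition lie_bracket :: "('g::real_vector \<Rightarrow> 'g \<Rightarrow> 'g) \<Rightarrow> bool" where
  "lie_bracket br \<longleftrightarrow>
     bilinear br \<and> (\<forall>x. br x x = 0) \<and>
     (\<forall>x y z. br x (br y z) + br y (br z x) + br z (br x y) = 0)"

text \<open>The index is shifted by one: the value at \<open>i\<close> is the term usually written
  with superscript \<open>i + 1\<close>, so the value at \<open>0\<close> is the whole Lie algebra.\<close>

primrec lower_central :: "('g::real_vector \<Rightarrow> 'g \<Rightarrow> 'g) \<Rightarrow> nat \<Rightarrow> 'g set" where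
  "lower_central br 0 = UNIV"
| "lower_central br (Suc i) = span {br x y | x y. y \<in> lower_central br i}"

definition homogeneous_dimension :: "('g::real_vector \<Rightarrow> 'g \<Rightarrow> 'g) \<Rightarrow> nat" where
  "homogeneous_dimension br = (\<Sum>i. dim (lower_central br i))"

datatype gen = GenU | GenV | GenW | GenZ | GenX nat | GenY nat

definition gens :: "nat \<Rightarrow> gen set" where
  "gens n = {GenU, GenV, GenW, GenZ} \<union> GenX ` {1..n} \<union> GenY ` {1..n}"

definition bracket_pairs :: "nat \<Rightarrow> (gen \<times> gen) set" where
  "bracket_pairs n = {(GenU, GenV), (GenU, GenW)} \<union> {(GenX i, GenY i) | i. i \<in> {1..n}}"

text \<open>\<open>is_g4_2n n br b\<close>: the bracket \<open>br\<close> makes the space \<open>'g\<close> into the Lie algebra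
  \<open>g(4+2n)\<close>, with distinguished basis \<open>(b s)\<close> for \<open>s \<in> gens n\<close>; in particular
  \<open>DIM('g) = 4 + 2 * n\<close>. This determines the Lie algebra up to isomorphism.\<close>

definition is_g4_2n :: "nat \<Rightarrow> ('g::real_vector \<Rightarrow> 'g \<Rightarrow> 'g) \<Rightarrow> (gen \<Rightarrow> 'g) \<Rightarrow> bool" where
  "is_g4_2n n br b \<longleftrightarrow>
     lie_bracket br \<and>
     inj_on b (gens n) \<and> independent (b ` gens n) \<and> span (b ` gens n) = UNIV \<and>
     br (b GenU) (b GenV) = b GenW \<and>
     br (b GenU) (b GenW) = b GenZ \<and>
     (\<forall>i\<in>{1..n}. br (b (GenX i)) (b (GenY i)) = b GenZ) \<and>
     (\<forall>s\<in>gens n. \<forall>t\<in>gens n.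
        (s, t) \<notin> bracket_pairs n \<and> (t, s) \<notin> bracket_pairs n \<longrightarrow> br (b s) (b t) = 0)"

text \<open>The simply connected Lie group of a nilpotent Lie algebra of class at most 3, in
  exponential coordinates: the underlying manifold is the Lie algebra, and the product is
  given by the Baker-Campbell-Hausdorff series, whose terms of order at least 4 vanish.\<close>

definition bch_group :: "('g::real_vector \<Rightarrow> 'g \<Rightarrow> 'g) \<Rightarrow> 'g monoid" where
  "bch_group br =
     \<lparr>carrier = UNIV,
      mult = (\<lambda>x y. x + y + (1/2) *\<^sub>R br x y
                + (1/12) *\<^sub>R (br x (br x y) + br y (br y x))),
      one = 0\<rparr>"


section \<open>Systolic growth\<close>

text \<open>Throughout, \<open>G\<close> is a group and \<open>T\<close> a topology on its carrier.\<close>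

definition compact_generating :: "('a, 'm) monoid_scheme \<Rightarrow> 'a topology \<Rightarrow> 'a set \<Rightarrow> bool" where
  "compact_generating G T S \<longleftrightarrow> compactin T S \<and> generate G S = carrier G"

definition word_length :: "('a, 'm) monoid_scheme \<Rightarrow> 'a set \<Rightarrow> 'a \<Rightarrow> nat" where
  "word_length G S x =
     (LEAST k. \<exists>ws. length ws = k \<and> set ws \<subseteq> S \<union> m_inv G ` S \<and>
                    x = foldr (mult G) ws (one G))"

definition systole :: "('a, 'm) monoid_scheme \<Rightarrow> 'a set \<Rightarrow> 'a set \<Rightarrow> ennreal" where
  "systole G S A = (INF x\<in>A - {one G}. of_nat (word_length G S x))"

text \<open>For second countable locally compact groups, regularity is automatic for Borel
  measures that are finite on compact sets, so it is not required.\<close>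

definition left_haar_measure :: "('a, 'm) monoid_scheme \<Rightarrow> 'a topology \<Rightarrow> 'a measure \<Rightarrow> bool" where
  "left_haar_measure G T \<mu> \<longleftrightarrow>
     space \<mu> = carrier G \<and> sets \<mu> = sigma_sets (topspace T) {A. openin T A} \<and>
     (\<forall>g\<in>carrier G. \<forall>A\<in>sets \<mu>. emeasure \<mu> (l_coset G g A) = emeasure \<mu> A) \<and>
     (\<forall>K\<in>sets \<mu>. compactin T K \<longrightarrow> emeasure \<mu> K < \<infinity>) \<and>
     emeasure \<mu> (space \<mu>) \<noteq> 0"

definition fundamental_domain ::
    "('a, 'm) monoid_scheme \<Rightarrow> 'a measure \<Rightarrow> 'a set \<Rightarrow> 'a set \<Rightarrow> bool" where
  "fundamental_domain G \<mu> \<Gamma> F \<longleftrightarrow>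
     F \<in> sets \<mu> \<and> (\<forall>C \<in> RCOSETS G \<Gamma>. \<exists>!x. x \<in> F \<inter> C)"

text \<open>The total mass of the measure induced on the space of cosets \<open>\<Gamma>x\<close>. For a countable
  subgroup \<open>\<Gamma>\<close> and a left-invariant measure all Borel fundamental domains have
  the same measure; the infimum only serves to select this common value.\<close>

definition covolume :: "('a, 'm) monoid_scheme \<Rightarrow> 'a measure \<Rightarrow> 'a set \<Rightarrow> ennreal" where
  "covolume G \<mu> \<Gamma> = (INF F\<in>{F. fundamental_domain G \<mu> \<Gamma> F}. emeasure \<mu> F)"

definition cocompact_lattice ::
    "('a, 'm) monoid_scheme \<Rightarrow> 'a topology \<Rightarrow> 'a measure \<Rightarrow> 'a set \<Rightarrow> bool" where
  "cocompact_lattice G T \<mu> \<Gamma> \<longleftrightarrow>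
     subgroup \<Gamma> G \<and> subtopology T \<Gamma> = discrete_topology \<Gamma> \<and> covolume G \<mu> \<Gamma> < \<infinity> \<and>
     (\<exists>K. compactin T K \<and> set_mult G \<Gamma> K = carrier G)"

definition systolic_growth ::
    "('a, 'm) monoid_scheme \<Rightarrow> 'a topology \<Rightarrow> 'a set \<Rightarrow> 'a measure \<Rightarrow> real \<Rightarrow> ennreal" where
  "systolic_growth G T S \<mu> r =
     (INF \<Gamma>\<in>{\<Gamma>. cocompact_lattice G T \<mu> \<Gamma> \<and> ennreal r \<le> systole G S \<Gamma>}. covolume G \<mu> \<Gamma>)"


section \<open>Asymptotic comparison\<close>

definition growth_le :: "(real \<Rightarrow> ennreal) \<Rightarrow> (real \<Rightarrow> ennreal) \<Rightarrow> bool" where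
  "growth_le f g \<longleftrightarrow>
     (\<exists>C>0. \<exists>C'>0. \<exists>C''>0. \<forall>r>0. f r \<le> ennreal C * g (C' * r) + ennreal C'')"

definition growth_equiv :: "(real \<Rightarrow> ennreal) \<Rightarrow> (real \<Rightarrow> ennreal) \<Rightarrow> bool" where
  "growth_equiv f g \<longleftrightarrow> growth_le f g \<and> growth_le g f"

end

(*
  The exponential coordinates give a bi-invariant Lebesgue measure, and every Haar measure is a
  multiple of it. An element with coordinates u, v, x_i, y_i = O(r), w = O(r^2), z = O(r^3) has
  word length O(r), and conversely.

  Upper bound: the lattice with steps of order r in the U-, V- and X_i-directions, r^2 in the
  W- and Y_i-directions and r^3 in the Z-direction has systole at least a multiple of r, and
  covolume of order r^(3n+7); the Y_i-step is r^2 and not r because [X_i, Y_i] has to land in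
  the central lattice.

  Lower bound: let a lattice have systole at least r. Commutators show that its intersection with
  the centre is generated by some zeta >= r^3, up to constants, and that its image in the
  U-direction is generated by some u0 > 0. The elements with u = 0 project to a lattice of the
  2n-dimensional symplectic space spanned by the X_i and Y_i, on which the symplectic form takes
  values in zeta Z; reducing this form to elementary divisors, by transvections, shows that its
  covolume is at least zeta^n >= r^(3n). The remaining four directions contribute at least r^7:
  if u0 >= r because V, W, Z contain no short elements, and if u0 < r because commutators with an
  element over u0 give the spacings zeta/u0^2, zeta/u0, zeta in the directions V, W, Z.
*)
theory Submission
  imports Defs
begin

text \<open>The lower bound neither multiplies covolumes along an extension nor looks for a
  fundamental domain of the given lattice. It exhibits a Borel set \<open>B\<close> of large measure
  whose translates under the lattice are disjoint; every fundamental domain then has at least the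
  measure of \<open>B\<close>. To find \<open>B\<close>, the lattice must be seen in coordinates
  where it acts almost by translations: coordinates of the second kind remove the U-dependent twist
  of the elements with u = 0, and symplectic maps straighten the X, Y directions. All these changes
  of variables are composed of translations and shears \<open>x + f x *\<^sub>R v\<close> with
  \<open>f\<close> constant along \<open>v\<close>, so one Fubini argument stands in for every
  Jacobian. The lattice is arbitrary and comes with no adapted basis. In the lower bound
  cocompactness enters through a single fact: a linear homomorphism to the reals that vanishes on
  the lattice is zero. This supplies elements with nonzero U-coordinate, nontrivial commutators and
  the nondegeneracy of the symplectic form on the projected lattice.\<close>

section \<open>Measure-preserving shears, uniqueness of Haar measure, discrete subgroups of the
  line\<close>

text \<open>Averaging along \<open>v\<close> replaces a splitting of the space: a weight
  \<open>\<psi>\<close> of integral 1 in an extra variable t is inserted and x is translated by t v.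
  For fixed x the shear then becomes a translation in t.\<close>

lemma distr_shear:
  fixes M :: "'a::euclidean_space measure"
  assumes sets_M[measurable_cong]: "sets M = sets borel" and "sigma_finite_measure M"
    and transl: "\<And>a. distr M borel (\<lambda>x. x + a) = M"
    and f[measurable]: "f \<in> borel_measurable borel"
    and f_inv: "\<And>x t. f (x + t *\<^sub>R v) = f x"
  shows "distr M borel (\<lambda>x. x + f x *\<^sub>R v) = M"
proof (rule measure_eqI)
  interpret M: sigma_finite_measure M by fact
  interpret pair_sigma_finite M "lborel :: real measure" ..
  have [measurable]: "f \<in> borel_measurable M"
    using f by simp
  fix A assume "A \<in> sets (distr M borel (\<lambda>x. x + f x *\<^sub>R v))"
  then have A[measurable]: "A \<in> sets borel" by simp
  have space_M: "space M = UNIV"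
    using sets_eq_imp_space_eq[OF sets_M] by simp
  have tr: "(\<integral>\<^sup>+x. h (x + a) \<partial>M) = (\<integral>\<^sup>+x. h x \<partial>M)" if [measurable]: "h \<in> borel_measurable borel" for h a
  proof -
    have "(\<integral>\<^sup>+x. h x \<partial>M) = (\<integral>\<^sup>+x. h x \<partial>distr M borel (\<lambda>x. x + a))"
      by (simp add: transl)
    also have "\<dots> = (\<integral>\<^sup>+x. h (x + a) \<partial>M)"
      by (rule nn_integral_distr) measurable
    finally show ?thesis ..
  qed
  define \<phi> :: "'a \<Rightarrow> ennreal" where "\<phi> = indicator A"
  define \<psi> :: "real \<Rightarrow> ennreal" where "\<psi> = indicator {0..1}"
  have [measurable]: "\<phi> \<in> borel_measurable borel" "\<psi> \<in> borel_measurable borel"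
    unfolding \<phi>_def \<psi>_def by measurable
  have psi: "(\<integral>\<^sup>+t. \<psi> (t - a) \<partial>lborel) = 1" for a :: real
  proof -
    have "(\<integral>\<^sup>+t. \<psi> (t - a) \<partial>lborel) = (\<integral>\<^sup>+t. indicator {a..a+1} t \<partial>lborel)"
      by (intro nn_integral_cong) (auto simp: \<psi>_def indicator_def)
    then show ?thesis by simp
  qed
  have "emeasure (distr M borel (\<lambda>x. x + f x *\<^sub>R v)) A = (\<integral>\<^sup>+x. \<phi> x \<partial>distr M borel (\<lambda>x. x + f x *\<^sub>R v))"
    by (simp add: \<phi>_def)
  also have "\<dots> = (\<integral>\<^sup>+x. \<phi> (x + f x *\<^sub>R v) \<partial>M)"
    by (rule nn_integral_distr) measurable
  also have "\<dots> = (\<integral>\<^sup>+t. \<psi> t * (\<integral>\<^sup>+x. \<phi> (x + f x *\<^sub>R v) \<partial>M) \<partial>lborel)"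
    using psi[of 0] by (simp add: nn_integral_multc)
  also have "\<dots> = (\<integral>\<^sup>+t. (\<integral>\<^sup>+x. \<psi> t * \<phi> (x + (t + f x) *\<^sub>R v) \<partial>M) \<partial>lborel)"
  proof (rule nn_integral_cong)
    fix t :: real
    have "(\<integral>\<^sup>+x. \<phi> (x + f x *\<^sub>R v) \<partial>M) = (\<integral>\<^sup>+x. \<phi> ((x + t *\<^sub>R v) + f (x + t *\<^sub>R v) *\<^sub>R v) \<partial>M)"
      by (rule tr[symmetric]) measurable
    also have "\<dots> = (\<integral>\<^sup>+x. \<phi> (x + (t + f x) *\<^sub>R v) \<partial>M)"
      by (simp add: f_inv algebra_simps)
    finally show "\<psi> t * (\<integral>\<^sup>+x. \<phi> (x + f x *\<^sub>R v) \<partial>M) = (\<integral>\<^sup>+x. \<psi> t * \<phi> (x + (t + f x) *\<^sub>R v) \<partial>M)"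
      by (simp add: nn_integral_cmult)
  qed
  also have "\<dots> = (\<integral>\<^sup>+x. (\<integral>\<^sup>+t. \<psi> t * \<phi> (x + (t + f x) *\<^sub>R v) \<partial>lborel) \<partial>M)"
    by (rule Fubini') measurable
  \<comment> \<open>After the substitution t -> t - f x, \<open>f\<close> has left the argument of
    \<open>\<phi>\<close> and survives only as a shift of \<open>\<psi>\<close>, whose integral does
    not depend on the shift.\<close>
  also have "\<dots> = (\<integral>\<^sup>+x. (\<integral>\<^sup>+t. \<psi> (t - f x) * \<phi> (x + t *\<^sub>R v) \<partial>lborel) \<partial>M)"
  proof (rule nn_integral_cong)
    fix x
    have "(\<integral>\<^sup>+t. \<psi> (t - f x) * \<phi> (x + t *\<^sub>R v) \<partial>lborel) =
       (\<integral>\<^sup>+t. \<psi> ((f x + 1 * t) - f x) * \<phi> (x + (f x + 1 * t) *\<^sub>R v) \<partial>lborel)"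
      by (subst nn_integral_real_affine[where c=1 and t="f x"]) simp_all
    then show "(\<integral>\<^sup>+t. \<psi> t * \<phi> (x + (t + f x) *\<^sub>R v) \<partial>lborel) = (\<integral>\<^sup>+t. \<psi> (t - f x) * \<phi> (x + t *\<^sub>R v) \<partial>lborel)"
      by (simp add: add.commute)
  qed
  also have "\<dots> = (\<integral>\<^sup>+t. (\<integral>\<^sup>+x. \<psi> (t - f x) * \<phi> (x + t *\<^sub>R v) \<partial>M) \<partial>lborel)"
    by (rule Fubini'[symmetric]) measurable
  also have "\<dots> = (\<integral>\<^sup>+t. (\<integral>\<^sup>+x. \<psi> (t - f x) * \<phi> x \<partial>M) \<partial>lborel)"
  proof (rule nn_integral_cong)
    fix t :: real
    have "(\<integral>\<^sup>+x. \<psi> (t - f x) * \<phi> (x + t *\<^sub>R v) \<partial>M) =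
      (\<integral>\<^sup>+x. \<psi> (t - f (x + t *\<^sub>R v)) * \<phi> (x + t *\<^sub>R v) \<partial>M)"
      by (simp add: f_inv)
    also have "\<dots> = (\<integral>\<^sup>+x. \<psi> (t - f x) * \<phi> x \<partial>M)"
      by (rule tr) measurable
    finally show "(\<integral>\<^sup>+x. \<psi> (t - f x) * \<phi> (x + t *\<^sub>R v) \<partial>M) = \<dots>" .
  qed
  also have "\<dots> = (\<integral>\<^sup>+x. (\<integral>\<^sup>+t. \<psi> (t - f x) * \<phi> x \<partial>lborel) \<partial>M)"
    by (rule Fubini') measurable
  also have "\<dots> = (\<integral>\<^sup>+x. \<phi> x \<partial>M)"
    by (simp add: nn_integral_multc psi)
  also have "\<dots> = emeasure M A"
    by (simp add: \<phi>_def sets_M)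
  finally show "emeasure (distr M borel (\<lambda>x. x + f x *\<^sub>R v)) A = emeasure M A" .
qed (simp add: sets_M)

text \<open>Substitute \<open>y \<mapsto> yx\<close> and then \<open>x \<mapsto> y\<^sup>-\<^sup>1x\<close> in the double integral of \<open>1\<^sub>A(x) 1\<^sub>B(y)\<close>.\<close>

lemma haar_exchange:
  fixes \<mu> \<nu> :: "'a::second_countable_topology measure" and m :: "'a \<Rightarrow> 'a \<Rightarrow> 'a" and iv :: "'a \<Rightarrow> 'a"
  assumes sets_mu[measurable_cong]: "sets \<mu> = sets borel" and sets_nu[measurable_cong]: "sets \<nu> = sets borel"
    and "sigma_finite_measure \<mu>" "sigma_finite_measure \<nu>"
    and m[measurable]: "case_prod m \<in> borel_measurable (borel \<Otimes>\<^sub>M borel)"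
    and iv[measurable]: "iv \<in> borel_measurable borel"
    and left: "\<And>a. distr \<mu> borel (m a) = \<mu>"
    and right: "\<And>a. distr \<nu> borel (\<lambda>x. m x a) = \<nu>"
    and inv_nu: "distr \<nu> borel iv = \<nu>"
    and cancel: "\<And>x y. m (iv y) (m y x) = x"
    and inv_mul: "\<And>x y. iv (m y x) = m (iv x) (iv y)"
    and inv_inv: "\<And>x. iv (iv x) = x"
    and A[measurable]: "A \<in> sets borel" and B[measurable]: "B \<in> sets borel"
  shows "emeasure \<mu> A * emeasure \<nu> B = emeasure \<mu> B * emeasure \<nu> A"
proof -
  interpret mu: sigma_finite_measure \<mu> by fact
  interpret nu: sigma_finite_measure \<nu> by fact
  interpret pair_sigma_finite \<mu> \<nu> ..
  have m1[measurable]: "m a \<in> borel_measurable borel" for a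
    using measurable_compose[OF measurable_Pair1' m, of a] by simp
  have m2[measurable]: "(\<lambda>x. m x a) \<in> borel_measurable borel" for a
    using measurable_compose[OF measurable_Pair2' m, of a] by simp
  have [measurable]: "case_prod m \<in> borel_measurable (\<mu> \<Otimes>\<^sub>M \<nu>)" "(\<lambda>(x,y). m y x) \<in> borel_measurable (\<mu> \<Otimes>\<^sub>M \<nu>)"
    "(\<lambda>(x,y). m (iv y) x) \<in> borel_measurable (\<mu> \<Otimes>\<^sub>M \<nu>)"
    by measurable
  define f g :: "'a \<Rightarrow> ennreal" where "f = indicator A" and "g = indicator B"
  have [measurable]: "f \<in> borel_measurable borel" "g \<in> borel_measurable borel"
    unfolding f_def g_def by measurable
  have trm: "(\<integral>\<^sup>+x. h (m a x) \<partial>\<mu>) = (\<integral>\<^sup>+x. h x \<partial>\<mu>)" if [measurable]: "h \<in> borel_measurable borel" for h a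
    by (subst (2) left[of a, symmetric]) (simp add: nn_integral_distr)
  have trn: "(\<integral>\<^sup>+x. h (m x a) \<partial>\<nu>) = (\<integral>\<^sup>+x. h x \<partial>\<nu>)" if [measurable]: "h \<in> borel_measurable borel" for h a
    by (subst (2) right[of a, symmetric]) (simp add: nn_integral_distr)
  have invn: "(\<integral>\<^sup>+x. h (iv x) \<partial>\<nu>) = (\<integral>\<^sup>+x. h x \<partial>\<nu>)" if [measurable]: "h \<in> borel_measurable borel" for h
    by (subst (2) inv_nu[symmetric]) (simp add: nn_integral_distr)
  \<comment> \<open>Inversion invariance turns \<open>iv y\<close> into \<open>y\<close>, and right
    invariance then absorbs \<open>x\<close>: the inner integral is independent of
    \<open>x\<close>.\<close>
  have fint: "(\<integral>\<^sup>+y. f (m (iv y) x) \<partial>\<nu>) = (\<integral>\<^sup>+y. f y \<partial>\<nu>)" for x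
  proof -
    have "(\<integral>\<^sup>+y. f (m (iv y) x) \<partial>\<nu>) = (\<integral>\<^sup>+y. f (m y x) \<partial>\<nu>)"
      using invn[of "\<lambda>y. f (m y x)"] by simp
    then show ?thesis by (simp add: trn)
  qed
  have "emeasure \<mu> A * emeasure \<nu> B = (\<integral>\<^sup>+x. f x \<partial>\<mu>) * (\<integral>\<^sup>+y. g y \<partial>\<nu>)"
    by (simp add: f_def g_def sets_mu sets_nu)
  also have "\<dots> = (\<integral>\<^sup>+x. (\<integral>\<^sup>+y. f x * g y \<partial>\<nu>) \<partial>\<mu>)"
    by (simp add: nn_integral_cmult nn_integral_multc)
  also have "\<dots> = (\<integral>\<^sup>+x. (\<integral>\<^sup>+y. f x * g (m y x) \<partial>\<nu>) \<partial>\<mu>)"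
  proof (rule nn_integral_cong)
    fix x
    have "(\<lambda>y. g (m y x)) \<in> borel_measurable \<nu>" by measurable
    then show "(\<integral>\<^sup>+y. f x * g y \<partial>\<nu>) = (\<integral>\<^sup>+y. f x * g (m y x) \<partial>\<nu>)"
      by (simp add: nn_integral_cmult trn)
  qed
  also have "\<dots> = (\<integral>\<^sup>+y. (\<integral>\<^sup>+x. f x * g (m y x) \<partial>\<mu>) \<partial>\<nu>)"
    by (rule Fubini'[symmetric]) measurable
  also have "\<dots> = (\<integral>\<^sup>+y. (\<integral>\<^sup>+x. f (m (iv y) x) * g x \<partial>\<mu>) \<partial>\<nu>)"
  proof (rule nn_integral_cong)
    fix y
    show "(\<integral>\<^sup>+x. f x * g (m y x) \<partial>\<mu>) = (\<integral>\<^sup>+x. f (m (iv y) x) * g x \<partial>\<mu>)"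
      using trm[of "\<lambda>x. f (m (iv y) x) * g x" y] by (simp add: cancel)
  qed
  also have "\<dots> = (\<integral>\<^sup>+x. (\<integral>\<^sup>+y. f (m (iv y) x) * g x \<partial>\<nu>) \<partial>\<mu>)"
    by (rule Fubini') measurable
  also have "\<dots> = (\<integral>\<^sup>+x. (\<integral>\<^sup>+y. f y \<partial>\<nu>) * g x \<partial>\<mu>)"
  proof (rule nn_integral_cong)
    fix x
    have "(\<lambda>y. f (m (iv y) x)) \<in> borel_measurable \<nu>" by measurable
    then show "(\<integral>\<^sup>+y. f (m (iv y) x) * g x \<partial>\<nu>) = (\<integral>\<^sup>+y. f y \<partial>\<nu>) * g x"
      by (simp add: nn_integral_multc fint)
  qed
  also have "\<dots> = emeasure \<mu> B * emeasure \<nu> A"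
    by (simp add: nn_integral_cmult nn_integral_multc f_def g_def sets_mu sets_nu mult.commute)
  finally show ?thesis .
qed

lemma real_subgroup_generator:
  fixes A :: "real set"
  assumes add: "\<And>x y. x \<in> A \<Longrightarrow> y \<in> A \<Longrightarrow> x + y \<in> A" and neg: "\<And>x. x \<in> A \<Longrightarrow> - x \<in> A"
    and "\<epsilon> > 0" and gap: "\<And>x. x \<in> A \<Longrightarrow> x \<noteq> 0 \<Longrightarrow> \<epsilon> \<le> \<bar>x\<bar>"
    and "a \<in> A" "a \<noteq> 0"
  obtains a0 where "a0 \<in> A" "a0 > 0" "\<And>x. x \<in> A \<Longrightarrow> \<exists>k::int. x = of_int k * a0"
proof -
  define P where "P = {x \<in> A. x > 0}"
  have P: "\<bar>a\<bar> \<in> P" using assms neg[of a] by (auto simp: P_def abs_if)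
  define i where "i = Inf P"
  have bdd: "bdd_below P" by (auto simp: P_def intro!: bdd_belowI[of _ 0])
  have ilow: "i \<le> x" if "x \<in> P" for x unfolding i_def by (rule cInf_lower[OF that bdd])
  \<comment> \<open>Elements of \<open>P\<close> within \<open>\<epsilon>\<close> of the infimum
    differ by less than \<open>\<epsilon>\<close>, hence coincide, so the infimum is
    attained.\<close>
  have "\<exists>x\<in>P. x < i + \<epsilon>"
    using cInf_less_iff[OF _ bdd, of "i + \<epsilon>"] P \<open>\<epsilon> > 0\<close> by (auto simp: i_def)
  then obtain x0 where x0: "x0 \<in> P" "x0 < i + \<epsilon>" by auto
  have min: "x0 \<le> y" if "y \<in> P" for y
  proof (rule ccontr)
    assume "\<not> x0 \<le> y"
    then have "x0 - y \<in> A" "x0 - y \<noteq> 0"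
      using add[of x0 "- y"] neg[of y] x0 that by (auto simp: P_def)
    then have "\<epsilon> \<le> \<bar>x0 - y\<bar>" by (rule gap)
    then show False using x0 ilow[OF that] \<open>\<not> x0 \<le> y\<close> by auto
  qed
  have mult_nat: "of_nat k * x0 \<in> A" for k
  proof (induction k)
    case 0
    show ?case using add[of x0 "- x0"] neg[of x0] x0 by (auto simp: P_def)
  next
    case (Suc k)
    then show ?case using add[of "of_nat k * x0" x0] x0 by (auto simp: P_def algebra_simps)
  qed
  have mult: "of_int k * x0 \<in> A" for k
  proof (cases "k \<ge> 0")
    case True then show ?thesis using mult_nat[of "nat k"] by simp
  next
    case False then show ?thesis using neg[OF mult_nat[of "nat (- k)"]] by simp
  qed
  show ?thesis
  proof (rule that)
    show "x0 \<in> A" "x0 > 0" using x0 by (auto simp: P_def)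
    fix x assume x: "x \<in> A"
    define k where "k = \<lfloor>x / x0\<rfloor>"
    have r0: "0 \<le> x - of_int k * x0" "x - of_int k * x0 < x0"
      using \<open>x0 > 0\<close> floor_divide_lower[of x0 x] floor_divide_upper[of x0 x] by (auto simp: k_def algebra_simps)
    have "x - of_int k * x0 \<in> A"
      using add[OF x neg[OF mult[of k]]] by simp
    then have "\<not> x - of_int k * x0 > 0" using min[of "x - of_int k * x0"] r0 by (fastforce simp: P_def)
    then have "x = of_int k * x0" using r0 by linarith
    then show "\<exists>k::int. x = of_int k * x0" by blast
  qed
qed

section \<open>Basis, coordinates and the group law\<close>

lemma finite_gens[simp]: "finite (gens n)"
  by (simp add: gens_def)

lemma sum_gens:
  "(\<Sum>s\<in>gens n. f s) = f GenU + f GenV + f GenW + f GenZ + (\<Sum>i=1..n. f (GenX i)) + (\<Sum>i=1..n. f (GenY i))"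
  for f :: "gen \<Rightarrow> 'b::comm_monoid_add"
proof -
  have "(\<Sum>s\<in>gens n. f s) = sum f {GenU, GenV, GenW, GenZ} + sum f (GenX ` {1..n}) + sum f (GenY ` {1..n})"
    unfolding gens_def by (subst sum.union_disjoint, simp, simp, blast)+ (rule refl)
  then show ?thesis by (simp add: sum.reindex inj_on_def add.assoc)
qed

lemma prod_gens:
  "(\<Prod>s\<in>gens n. f s) = f GenU * f GenV * f GenW * f GenZ * (\<Prod>i=1..n. f (GenX i)) * (\<Prod>i=1..n. f (GenY i))"
  for f :: "gen \<Rightarrow> 'b::comm_monoid_mult"
proof -
  have "(\<Prod>s\<in>gens n. f s) = prod f {GenU, GenV, GenW, GenZ} * prod f (GenX ` {1..n}) * prod f (GenY ` {1..n})"
    unfolding gens_def by (subst prod.union_disjoint, simp, simp, blast)+ (rule refl)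
  then show ?thesis by (simp add: prod.reindex inj_on_def mult.assoc)
qed

lemma card_gens: "card (gens n) = 4 + 2 * n"
proof -
  have "card (gens n) = (\<Sum>s\<in>gens n. 1)" by simp
  then show ?thesis unfolding sum_gens by simp
qed

lemma gens_simps[simp]: "GenU \<in> gens n" "GenV \<in> gens n" "GenW \<in> gens n" "GenZ \<in> gens n"
  "GenX i \<in> gens n \<longleftrightarrow> i \<in> {1..n}" "GenY i \<in> gens n \<longleftrightarrow> i \<in> {1..n}"
  by (auto simp: gens_def)

lemma gens_cases[consumes 1, case_names U V W Z X Y]:
  assumes "s \<in> gens n"
  obtains "s = GenU" | "s = GenV" | "s = GenW" | "s = GenZ" | i where "s = GenX i" "i \<in> {1..n}"
    | i where "s = GenY i" "i \<in> {1..n}"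
  using assms by (auto simp: gens_def)

text \<open>All brackets of basis vectors lie in the span of W and Z; \<open>strW\<close> and
  \<open>strZ\<close> are the two families of structure constants.\<close>

definition strW :: "gen \<Rightarrow> gen \<Rightarrow> real" where
  "strW s t = (if s = GenU \<and> t = GenV then 1 else if s = GenV \<and> t = GenU then - 1 else 0)"

fun strZ :: "gen \<Rightarrow> gen \<Rightarrow> real" where
  "strZ GenU GenW = 1"
| "strZ GenW GenU = - 1"
| "strZ (GenX i) (GenY j) = of_bool (i = j)"
| "strZ (GenY i) (GenX j) = - of_bool (i = j)"
| "strZ _ _ = 0"

locale filiform_heisenberg =
  fixes n :: nat and br :: "'g::euclidean_space \<Rightarrow> 'g \<Rightarrow> 'g" and b :: "gen \<Rightarrow> 'g"
  assumes g4: "is_g4_2n n br b"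
begin

text \<open>For \<open>s\<close> outside \<open>gens n\<close> the value has no meaning, but it is
  still linear in the vector, so the linearity rules carry no membership condition.\<close>

definition coord :: "gen \<Rightarrow> 'g \<Rightarrow> real" where
  "coord s x = representation (b ` gens n) x (b s)"

text \<open>The bracket of the Heisenberg factor: the standard symplectic form in the X, Y
  coordinates, extended by 0 to the other directions.\<close>

definition omega :: "'g \<Rightarrow> 'g \<Rightarrow> real" where
  "omega x y = (\<Sum>i=1..n. coord (GenX i) x * coord (GenY i) y - coord (GenY i) x * coord (GenX i) y)"

definition uvdet :: "'g \<Rightarrow> 'g \<Rightarrow> real" where
  "uvdet x y = coord GenU x * coord GenV y - coord GenV x * coord GenU y"

definition mul :: "'g \<Rightarrow> 'g \<Rightarrow> 'g" (infixl "\<odot>" 70) where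
  "x \<odot> y = x + y + (1/2) *\<^sub>R br x y + (1/12) *\<^sub>R (br x (br x y) + br y (br y x))"

lemma indep: "independent (b ` gens n)" and span_UNIV: "span (b ` gens n) = UNIV"
  and inj_b: "inj_on b (gens n)" and bilinear_br: "bilinear br" and br_self: "br x x = 0"
  using g4 by (auto simp: is_g4_2n_def lie_bracket_def)

lemma linear_coord: "linear (coord s)"
  using real_vector.linear_representation[OF indep span_UNIV, of "b s"]
  by (simp add: coord_def[abs_def] linear_iff module_hom_iff Vector_Spaces.linear_iff)

lemmas coord_linear[simp] = linear_add[OF linear_coord] linear_diff[OF linear_coord] linear_neg[OF linear_coord]
  linear_cmul[OF linear_coord] linear_0[OF linear_coord] linear_sum[OF linear_coord]

lemma continuous_on_coord[continuous_intros]: "continuous_on A f \<Longrightarrow> continuous_on A (\<lambda>x. coord s (f x))"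
  using linear_coord linear_conv_bounded_linear bounded_linear.continuous_on by blast

lemma measurable_coord[measurable]: "coord s \<in> borel_measurable borel"
  by (intro borel_measurable_continuous_onI continuous_intros)

lemma coord_basis: "s \<in> gens n \<Longrightarrow> t \<in> gens n \<Longrightarrow> coord s (b t) = (if s = t then 1 else 0)"
  using real_vector.representation_basis[OF indep, of "b t"] inj_b by (auto simp: coord_def inj_on_def)

lemma coord_basis_simps[simp]:
  "coord GenU (b GenU) = 1" "coord GenU (b GenV) = 0" "coord GenU (b GenW) = 0" "coord GenU (b GenZ) = 0"
  "coord GenV (b GenU) = 0" "coord GenV (b GenV) = 1" "coord GenV (b GenW) = 0" "coord GenV (b GenZ) = 0"
  "coord GenW (b GenU) = 0" "coord GenW (b GenV) = 0" "coord GenW (b GenW) = 1" "coord GenW (b GenZ) = 0"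
  "coord GenZ (b GenU) = 0" "coord GenZ (b GenV) = 0" "coord GenZ (b GenW) = 0" "coord GenZ (b GenZ) = 1"
  by (simp_all add: coord_basis)

lemma expand: "(\<Sum>s\<in>gens n. coord s x *\<^sub>R b s) = x"
proof -
  have "(\<Sum>s\<in>gens n. coord s x *\<^sub>R b s) = (\<Sum>v\<in>b ` gens n. representation (b ` gens n) x v *\<^sub>R v)"
    using inj_b by (simp add: sum.reindex coord_def)
  also have "\<dots> = x"
    by (rule real_vector.sum_representation_eq) (auto simp: indep span_UNIV)
  finally show ?thesis .
qed

lemma coord_sum: "s \<in> gens n \<Longrightarrow> coord s (\<Sum>t\<in>gens n. c t *\<^sub>R b t) = c s"
  by (simp add: coord_basis if_distrib cong: if_cong)

lemma coord_eqI: "(\<And>s. s \<in> gens n \<Longrightarrow> coord s x = coord s y) \<Longrightarrow> x = y"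
  by (metis (no_types, lifting) expand sum.cong)

lemma br_antisym: "br x y = - br y x"
proof -
  have "br (x + y) (x + y) = br x x + br x y + (br y x + br y y)"
    using bilinear_br by (simp add: bilinear_ladd bilinear_radd)
  then show ?thesis by (simp add: br_self eq_neg_iff_add_eq_0)
qed

lemma br_gen:
  assumes s: "s \<in> gens n" and t: "t \<in> gens n"
  shows "br (b s) (b t) = strW s t *\<^sub>R b GenW + strZ s t *\<^sub>R b GenZ"
proof -
  have UV: "br (b GenU) (b GenV) = b GenW" and UW: "br (b GenU) (b GenW) = b GenZ"
    and XY: "\<And>i. i \<in> {1..n} \<Longrightarrow> br (b (GenX i)) (b (GenY i)) = b GenZ"
    and z: "\<And>s t. s \<in> gens n \<Longrightarrow> t \<in> gens n \<Longrightarrow> (s, t) \<notin> bracket_pairs n \<Longrightarrow> (t, s) \<notin> bracket_pairs n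
      \<Longrightarrow> br (b s) (b t) = 0"
    using g4 by (auto simp: is_g4_2n_def)
  have VU: "br (b GenV) (b GenU) = - b GenW" and WU: "br (b GenW) (b GenU) = - b GenZ"
    and YX: "\<And>i. i \<in> {1..n} \<Longrightarrow> br (b (GenY i)) (b (GenX i)) = - b GenZ"
    using UV UW XY br_antisym by metis+
  show ?thesis
  proof (cases "(s, t) \<in> bracket_pairs n \<or> (t, s) \<in> bracket_pairs n")
    case True
    then show ?thesis
      by (auto simp: bracket_pairs_def UV UW XY VU WU YX strW_def)
  next
    case False
    then have "strW s t = 0" by (auto simp: strW_def bracket_pairs_def)
    moreover have "strZ s t = 0"
      using False s t by (cases "(s, t)" rule: strZ.cases) (auto simp: bracket_pairs_def)
    ultimately show ?thesis using z[OF s t] False by simp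
  qed
qed

lemma br_eq: "br x y = uvdet x y *\<^sub>R b GenW + (coord GenU x * coord GenW y - coord GenW x * coord GenU y + omega x y) *\<^sub>R b GenZ"
proof -
  have "br x y = br (\<Sum>s\<in>gens n. coord s x *\<^sub>R b s) (\<Sum>t\<in>gens n. coord t y *\<^sub>R b t)"
    by (simp add: expand)
  also have "\<dots> = (\<Sum>s\<in>gens n. \<Sum>t\<in>gens n. br (coord s x *\<^sub>R b s) (coord t y *\<^sub>R b t))"
    by (simp add: bilinear_sum[OF bilinear_br] sum.cartesian_product)
  also have "\<dots> = (\<Sum>s\<in>gens n. \<Sum>t\<in>gens n. (coord s x * coord t y * strW s t) *\<^sub>R b GenW + (coord s x * coord t y * strZ s t) *\<^sub>R b GenZ)"
    by (intro sum.cong refl)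
      (simp add: br_gen bilinear_lmul[OF bilinear_br] bilinear_rmul[OF bilinear_br] algebra_simps)
  also have "\<dots> = (\<Sum>s\<in>gens n. \<Sum>t\<in>gens n. coord s x * coord t y * strW s t) *\<^sub>R b GenW
      + (\<Sum>s\<in>gens n. \<Sum>t\<in>gens n. coord s x * coord t y * strZ s t) *\<^sub>R b GenZ"
    by (simp add: sum.distrib scaleR_left.sum)
  also have "(\<Sum>s\<in>gens n. \<Sum>t\<in>gens n. coord s x * coord t y * strW s t) = uvdet x y"
    by (simp add: sum_gens strW_def uvdet_def)
  also have "(\<Sum>s\<in>gens n. \<Sum>t\<in>gens n. coord s x * coord t y * strZ s t) =
      coord GenU x * coord GenW y - coord GenW x * coord GenU y + omega x y"
    by (simp add: sum_gens omega_def sum_subtractf of_bool_def if_distrib sum_negf cong: if_cong)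
  finally show ?thesis .
qed

lemma coord_W_Z_XY[simp]:
  "i \<in> {1..n} \<Longrightarrow> coord (GenX i) (b GenU) = 0" "i \<in> {1..n} \<Longrightarrow> coord (GenX i) (b GenV) = 0"
  "i \<in> {1..n} \<Longrightarrow> coord (GenX i) (b GenW) = 0" "i \<in> {1..n} \<Longrightarrow> coord (GenX i) (b GenZ) = 0"
  "i \<in> {1..n} \<Longrightarrow> coord (GenY i) (b GenU) = 0" "i \<in> {1..n} \<Longrightarrow> coord (GenY i) (b GenV) = 0"
  "i \<in> {1..n} \<Longrightarrow> coord (GenY i) (b GenW) = 0" "i \<in> {1..n} \<Longrightarrow> coord (GenY i) (b GenZ) = 0"
  by (simp_all add: coord_basis)

lemma coord_XY_basis[simp]:
  "i \<in> {1..n} \<Longrightarrow> j \<in> {1..n} \<Longrightarrow> coord (GenX i) (b (GenX j)) = (if i = j then 1 else 0)"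
  "i \<in> {1..n} \<Longrightarrow> j \<in> {1..n} \<Longrightarrow> coord (GenY i) (b (GenY j)) = (if i = j then 1 else 0)"
  "i \<in> {1..n} \<Longrightarrow> j \<in> {1..n} \<Longrightarrow> coord (GenX i) (b (GenY j)) = 0"
  "i \<in> {1..n} \<Longrightarrow> j \<in> {1..n} \<Longrightarrow> coord (GenY i) (b (GenX j)) = 0"
  "i \<in> {1..n} \<Longrightarrow> coord GenU (b (GenX i)) = 0" "i \<in> {1..n} \<Longrightarrow> coord GenV (b (GenX i)) = 0"
  "i \<in> {1..n} \<Longrightarrow> coord GenW (b (GenX i)) = 0" "i \<in> {1..n} \<Longrightarrow> coord GenZ (b (GenX i)) = 0"
  "i \<in> {1..n} \<Longrightarrow> coord GenU (b (GenY i)) = 0" "i \<in> {1..n} \<Longrightarrow> coord GenV (b (GenY i)) = 0"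
  "i \<in> {1..n} \<Longrightarrow> coord GenW (b (GenY i)) = 0" "i \<in> {1..n} \<Longrightarrow> coord GenZ (b (GenY i)) = 0"
  by (simp_all add: coord_basis)

lemma omega_add_left: "omega (x + y) z = omega x z + omega y z" and omega_add_right: "omega z (x + y) = omega z x + omega z y"
  and omega_scale_left: "omega (c *\<^sub>R x) z = c * omega x z" and omega_scale_right: "omega z (c *\<^sub>R x) = c * omega z x"
  and omega_minus_left: "omega (- x) z = - omega x z" and omega_minus_right: "omega z (- x) = - omega z x"
  and omega_diff_left: "omega (x - y) z = omega x z - omega y z" and omega_diff_right: "omega z (x - y) = omega z x - omega z y"
  by (simp_all add: omega_def algebra_simps sum.distrib sum_subtractf sum_negf sum_distrib_left)

lemma omega_self[simp]: "omega x x = 0" and omega_zero_left[simp]: "omega 0 x = 0" and omega_zero_right[simp]: "omega x 0 = 0"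
  by (simp_all add: omega_def mult.commute)

lemma omega_antisym: "omega x y = - omega y x"
  by (simp add: omega_def sum_negf[symmetric] algebra_simps)

lemma omega_eq_0: "(\<And>i. i \<in> {1..n} \<Longrightarrow> coord (GenX i) x = 0 \<and> coord (GenY i) x = 0) \<Longrightarrow> omega x y = 0 \<and> omega y x = 0"
  by (simp add: omega_def)

lemma omega_central[simp]: "omega (b GenU) x = 0" "omega (b GenV) x = 0" "omega (b GenW) x = 0" "omega (b GenZ) x = 0"
  "omega x (b GenU) = 0" "omega x (b GenV) = 0" "omega x (b GenW) = 0" "omega x (b GenZ) = 0"
  using omega_eq_0[of "b GenU" x] omega_eq_0[of "b GenV" x] omega_eq_0[of "b GenW" x] omega_eq_0[of "b GenZ" x] by simp_all

lemmas omega_linear[simp] = omega_add_left omega_add_right omega_scale_left omega_scale_right omega_minus_left omega_minus_right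
  omega_diff_left omega_diff_right

lemma coord_br[simp]: "coord GenU (br x y) = 0" "coord GenV (br x y) = 0" "coord GenW (br x y) = uvdet x y"
  "coord GenZ (br x y) = coord GenU x * coord GenW y - coord GenW x * coord GenU y + omega x y"
  "i \<in> {1..n} \<Longrightarrow> coord (GenX i) (br x y) = 0" "i \<in> {1..n} \<Longrightarrow> coord (GenY i) (br x y) = 0"
  by (simp_all add: br_eq)

lemma omega_br[simp]: "omega (br x y) z = 0" "omega z (br x y) = 0"
  using omega_eq_0[of "br x y" z] by simp_all

lemma omega_mul[simp]: "omega (x \<odot> y) z = omega x z + omega y z" "omega z (x \<odot> y) = omega z x + omega z y"
  by (simp_all add: mul_def)

lemma coord_mul[simp]: "coord GenU (x \<odot> y) = coord GenU x + coord GenU y" "coord GenV (x \<odot> y) = coord GenV x + coord GenV y"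
  "i \<in> {1..n} \<Longrightarrow> coord (GenX i) (x \<odot> y) = coord (GenX i) x + coord (GenX i) y"
  "i \<in> {1..n} \<Longrightarrow> coord (GenY i) (x \<odot> y) = coord (GenY i) x + coord (GenY i) y"
  by (simp_all add: mul_def)

lemma coord_mul_W: "coord GenW (x \<odot> y) = coord GenW x + coord GenW y + uvdet x y / 2"
  by (simp add: mul_def uvdet_def)

lemma coord_mul_Z: "coord GenZ (x \<odot> y) = coord GenZ x + coord GenZ y
    + (coord GenU x * coord GenW y - coord GenW x * coord GenU y + omega x y) / 2 + (coord GenU x - coord GenU y) * uvdet x y / 12"
  by (simp add: mul_def uvdet_def field_simps)

text \<open>The triple brackets see only U and \<open>uvdet\<close>. Thus W is corrected by a
  function of U and V, and Z by a function of the coordinates other than Z; this is the triangular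
  shape on which invariance of Lebesgue measure rests.\<close>

lemma mul_expand: "x \<odot> y = x + y + (uvdet x y / 2) *\<^sub>R b GenW
    + ((coord GenU x * coord GenW y - coord GenW x * coord GenU y + omega x y) / 2 + (coord GenU x - coord GenU y) * uvdet x y / 12) *\<^sub>R b GenZ"
  by (rule coord_eqI, erule gens_cases) (simp_all add: coord_mul_W coord_mul_Z)

lemma mul_assoc: "(x \<odot> y) \<odot> z = x \<odot> (y \<odot> z)"
  by (rule coord_eqI, erule gens_cases) (simp_all add: coord_mul_W coord_mul_Z uvdet_def field_simps)

lemma mul_zero[simp]: "0 \<odot> x = x" "x \<odot> 0 = x"
  by (simp_all add: mul_expand uvdet_def)

lemma mul_minus[simp]: "(- x) \<odot> x = 0" "x \<odot> (- x) = 0"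
  by (simp_all add: mul_expand uvdet_def)

lemma mul_cancel[simp]: "(- x) \<odot> (x \<odot> y) = y" "x \<odot> ((- x) \<odot> y) = y"
  by (simp_all add: mul_assoc[symmetric])

lemma mul_cancel_right[simp]: "(y \<odot> x) \<odot> (- x) = y" "(y \<odot> (- x)) \<odot> x = y"
  by (simp_all add: mul_assoc)

lemma minus_mul: "- (x \<odot> y) = (- y) \<odot> (- x)"
  by (rule coord_eqI, erule gens_cases) (simp_all add: coord_mul_W coord_mul_Z uvdet_def omega_antisym[of y x] field_simps)

abbreviation "G \<equiv> bch_group br"

lemma G_simps[simp]: "carrier G = UNIV" "one G = 0" "mult G = mul"
  by (auto simp: bch_group_def mul_def fun_eq_iff)

lemma G_group: "group G"
  by (rule groupI) (auto simp: mul_assoc intro: exI[of _ "- x" for x] mul_minus)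

lemma G_inv[simp]: "m_inv G x = - x"
  by (rule group.inv_equality[OF G_group]) auto

definition commut :: "'g \<Rightarrow> 'g \<Rightarrow> 'g" where
  "commut x y = x \<odot> y \<odot> (- x) \<odot> (- y)"

text \<open>If both U-coordinates vanish, only \<open>omega\<close> is left, in Z. If only the
  second one vanishes, the commutator carries V to W and W to Z, each time multiplied by the
  U-coordinate of the first element.\<close>

lemma coord_commut[simp]: "coord GenU (commut x y) = 0" "coord GenV (commut x y) = 0"
  "i \<in> {1..n} \<Longrightarrow> coord (GenX i) (commut x y) = 0" "i \<in> {1..n} \<Longrightarrow> coord (GenY i) (commut x y) = 0"
  "coord GenW (commut x y) = uvdet x y"
  "coord GenZ (commut x y) = coord GenU x * coord GenW y - coord GenW x * coord GenU y + omega x y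
     + (coord GenU x + coord GenU y) * uvdet x y / 2"
  by (simp_all add: commut_def coord_mul_W coord_mul_Z uvdet_def omega_antisym[of y x] field_simps)

lemma commut_eq: "commut x y = uvdet x y *\<^sub>R b GenW + (coord GenU x * coord GenW y - coord GenW x * coord GenU y + omega x y
     + (coord GenU x + coord GenU y) * uvdet x y / 2) *\<^sub>R b GenZ"
  by (rule coord_eqI, erule gens_cases) simp_all

lemma continuous_on_br[continuous_intros]:
  "continuous_on A f \<Longrightarrow> continuous_on A g \<Longrightarrow> continuous_on A (\<lambda>x. br (f x) (g x))"
  using bilinear_br bilinear_conv_bounded_bilinear bounded_bilinear.continuous_on by blast

lemma continuous_on_mul[continuous_intros]:
  "continuous_on A f \<Longrightarrow> continuous_on A g \<Longrightarrow> continuous_on A (\<lambda>x. f x \<odot> g x)"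
  unfolding mul_def by (intro continuous_intros)

lemma measurable_mul[measurable]: "case_prod (\<odot>) \<in> borel_measurable (borel \<Otimes>\<^sub>M borel)"
  unfolding borel_prod case_prod_beta' by (intro borel_measurable_continuous_onI continuous_intros)

lemma measurable_mul_left[measurable]: "(\<odot>) a \<in> borel_measurable borel"
  by (intro borel_measurable_continuous_onI continuous_intros)

lemma measurable_mul_right[measurable]: "(\<lambda>x. x \<odot> a) \<in> borel_measurable borel"
  by (intro borel_measurable_continuous_onI continuous_intros)

subsection \<open>Lebesgue measure in coordinates\<close>

text \<open>The basis \<open>b\<close> need not be orthonormal, so Lebesgue measure is transported
  along a linear map taking the standard basis to \<open>b\<close>. Coordinate boxes then have the
  product of their sides as volume.\<close>

definition coord_iso :: "'g \<Rightarrow> 'g" where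
  "coord_iso = (SOME L. linear L \<and> bij L \<and> (\<exists>\<iota>. bij_betw \<iota> (gens n) Basis \<and> (\<forall>x. \<forall>s\<in>gens n. coord s (L x) = x \<bullet> \<iota> s)))"

lemma dim_eq: "DIM('g) = 4 + 2 * n"
proof -
  have "dim (b ` gens n) = card (b ` gens n)"
    using indep by (rule dim_eq_card_independent)
  then show ?thesis
    using inj_b by (simp add: card_image card_gens flip: dim_span[of "b ` gens n"] add: span_UNIV)
qed

lemma coord_iso: "linear coord_iso \<and> bij coord_iso \<and> (\<exists>\<iota>. bij_betw \<iota> (gens n) Basis \<and> (\<forall>x. \<forall>s\<in>gens n. coord s (coord_iso x) = x \<bullet> \<iota> s))"
proof -
  have "card (gens n) = card (Basis :: 'g set)" by (simp add: dim_eq card_gens)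
  then obtain \<iota> where \<iota>: "bij_betw \<iota> (gens n) (Basis :: 'g set)"
    using finite_same_card_bij finite_gens finite_Basis by blast
  define L where "L = (\<lambda>x. \<Sum>s\<in>gens n. (x \<bullet> \<iota> s) *\<^sub>R b s)"
  have coL: "coord s (L x) = x \<bullet> \<iota> s" if "s \<in> gens n" for s x
    unfolding L_def by (rule coord_sum[OF that])
  have lin: "linear L"
    by (rule linearI) (simp_all add: L_def inner_add_left scaleR_left_distrib sum.distrib scaleR_right.sum)
  have inj: "inj L"
  proof (subst linear_injective_0[OF lin], intro allI impI)
    fix x assume "L x = 0"
    then have "x \<bullet> \<iota> s = 0" if "s \<in> gens n" for s using coL[OF that, of x] by simp
    then have "\<forall>i\<in>Basis. x \<bullet> i = 0" using \<iota> by (metis bij_betw_iff_bijections)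
    then show "x = 0" using euclidean_all_zero_iff by blast
  qed
  have "bij L" using lin inj linear_injective_imp_surjective by (auto simp: bij_def)
  then show ?thesis
    unfolding coord_iso_def using lin \<iota> coL
    by (intro someI[of "\<lambda>L. linear L \<and> bij L \<and> (\<exists>\<iota>. bij_betw \<iota> (gens n) Basis \<and> (\<forall>x. \<forall>s\<in>gens n. coord s (L x) = x \<bullet> \<iota> s))" L]) blast
qed

lemma continuous_on_coord_iso[continuous_intros]: "continuous_on A f \<Longrightarrow> continuous_on A (\<lambda>x. coord_iso (f x))"
  using coord_iso linear_conv_bounded_linear bounded_linear.continuous_on by blast

lemma measurable_coord_iso[measurable]: "coord_iso \<in> borel_measurable borel"
  by (intro borel_measurable_continuous_onI continuous_intros)

definition coord_lebesgue :: "'g measure" where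
  "coord_lebesgue = distr lborel borel coord_iso"

lemma sets_coord_lebesgue[simp, measurable_cong]: "sets coord_lebesgue = sets borel" and space_coord_lebesgue[simp]: "space coord_lebesgue = UNIV"
  by (simp_all add: coord_lebesgue_def)

text \<open>Half open, so that translates by multiples of the sides tile without overlap and each
  coset is met exactly once.\<close>

definition coord_box :: "(gen \<Rightarrow> real) \<Rightarrow> 'g set" where
  "coord_box a = {x. \<forall>s\<in>gens n. 0 \<le> coord s x \<and> coord s x < a s}"

lemma coord_box_sets[measurable]: "coord_box a \<in> sets borel"
  unfolding coord_box_def by measurable

lemma emeasure_coord_lebesgue_coord_box:
  assumes pos: "\<And>s. s \<in> gens n \<Longrightarrow> 0 \<le> a s"
  shows "emeasure coord_lebesgue (coord_box a) = ennreal (\<Prod>s\<in>gens n. a s)"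
proof -
  obtain \<iota> where \<iota>: "bij_betw \<iota> (gens n) Basis" and coord: "\<And>x s. s \<in> gens n \<Longrightarrow> coord s (coord_iso x) = x \<bullet> \<iota> s"
    using coord_iso by blast
  define \<kappa> where "\<kappa> = inv_into (gens n) \<iota>"
  have \<kappa>: "\<kappa> i \<in> gens n" "\<iota> (\<kappa> i) = i" if "i \<in> Basis" for i
    using that \<iota> by (auto simp: \<kappa>_def bij_betw_def inv_into_into f_inv_into_f)
  have \<kappa>': "\<kappa> (\<iota> s) = s" if "s \<in> gens n" for s
    using that \<iota> by (simp add: \<kappa>_def bij_betw_def)
  define c :: 'g where "c = (\<Sum>i\<in>Basis. a (\<kappa> i) *\<^sub>R i)"
  have c: "c \<bullet> i = a (\<kappa> i)" if "i \<in> Basis" for i using that by (simp add: c_def)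
  have pre: "coord_iso -` coord_box a = {x. \<forall>i\<in>Basis. 0 \<le> x \<bullet> i \<and> x \<bullet> i < c \<bullet> i}"
  proof -
    have "(\<forall>s\<in>gens n. 0 \<le> x \<bullet> \<iota> s \<and> x \<bullet> \<iota> s < a s) \<longleftrightarrow> (\<forall>i\<in>Basis. 0 \<le> x \<bullet> i \<and> x \<bullet> i < c \<bullet> i)" for x
    proof -
      have "(\<forall>i\<in>Basis. 0 \<le> x \<bullet> i \<and> x \<bullet> i < c \<bullet> i) \<longleftrightarrow> (\<forall>i\<in>\<iota> ` gens n. 0 \<le> x \<bullet> i \<and> x \<bullet> i < a (\<kappa> i))"
        using \<iota> by (simp add: c bij_betw_def)
      then show ?thesis by (simp add: \<kappa>')
    qed
    then show ?thesis by (auto simp: coord_box_def coord)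
  qed
  have prodeq: "(\<Prod>i\<in>Basis. c \<bullet> i) = (\<Prod>s\<in>gens n. a s)"
    using prod.reindex_bij_betw[OF \<iota>, of "\<lambda>i. c \<bullet> i", symmetric] \<iota>
    by (simp add: c bij_betwE \<kappa>' cong: prod.cong)
  have c0: "0 \<bullet> i \<le> c \<bullet> i" if "i \<in> Basis" for i using pos \<kappa> c that by simp
  have "emeasure coord_lebesgue (coord_box a) = emeasure lborel (coord_iso -` coord_box a)"
    by (simp add: coord_lebesgue_def emeasure_distr)
  also have "\<dots> = ennreal (\<Prod>i\<in>Basis. c \<bullet> i)"
  \<comment> \<open>The half-open box lies between the open and the closed box, whose measures
    agree.\<close>
  proof (rule antisym)
    have "emeasure lborel (coord_iso -` coord_box a) \<le> emeasure lborel (cbox 0 c)"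
      by (rule emeasure_mono) (auto simp: pre mem_box less_imp_le)
    then show "emeasure lborel (coord_iso -` coord_box a) \<le> ennreal (\<Prod>i\<in>Basis. c \<bullet> i)"
      using c0 by (simp add: emeasure_lborel_cbox_eq)
    have "emeasure lborel (box 0 c) \<le> emeasure lborel (coord_iso -` coord_box a)"
      using measurable_sets[OF measurable_coord_iso coord_box_sets, of a]
      by (intro emeasure_mono) (auto simp: pre mem_box less_imp_le)
    then show "ennreal (\<Prod>i\<in>Basis. c \<bullet> i) \<le> emeasure lborel (coord_iso -` coord_box a)"
      using c0 by (simp add: emeasure_lborel_box_eq)
  qed
  finally show ?thesis by (simp add: prodeq)
qed

lemma distr_coord_lebesgue_translation: "distr coord_lebesgue borel (\<lambda>x. x + a) = coord_lebesgue"
proof -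
  obtain a' where a': "a = coord_iso a'" using coord_iso by (meson bij_pointE)
  have "distr coord_lebesgue borel (\<lambda>x. x + a) = distr lborel borel (\<lambda>x. coord_iso x + a)"
    unfolding coord_lebesgue_def by (subst distr_distr) (auto simp: comp_def)
  also have "\<dots> = distr (distr lborel borel (\<lambda>x. a' + x)) borel coord_iso"
    using coord_iso by (subst distr_distr) (auto simp: comp_def a' linear_add add.commute)
  finally show ?thesis by (simp add: coord_lebesgue_def lborel_distr_plus)
qed

lemma distr_coord_lebesgue_uminus: "distr coord_lebesgue borel uminus = coord_lebesgue"
proof -
  have *: "distr lborel borel (uminus :: 'g \<Rightarrow> 'g) = lborel"
    using lborel_affine[of "-1" "0::'g"] by (simp add: density_1 fun_eq_iff[symmetric] cong: distr_cong)
  have "distr coord_lebesgue borel uminus = distr lborel borel (\<lambda>x. - coord_iso x)"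
    unfolding coord_lebesgue_def by (subst distr_distr) (auto simp: comp_def)
  also have "\<dots> = distr (distr lborel borel uminus) borel coord_iso"
    using coord_iso by (subst distr_distr) (auto simp: comp_def linear_neg)
  finally show ?thesis by (simp add: coord_lebesgue_def *)
qed

lemma sigma_finite_coord_lebesgue: "sigma_finite_measure coord_lebesgue"
proof
  define A where "A = (\<lambda>k::nat. {x. \<forall>s\<in>gens n. \<bar>coord s x\<bar> < real k})"
  have *: "A k \<in> sets borel" for k unfolding A_def by measurable
  have fin: "emeasure coord_lebesgue (A k) < \<infinity>" for k
  proof -
    \<comment> \<open>Translation by \<open>c\<close> moves the centred cube into a box with sides
      2k, whose measure is known.\<close>
    define c where "c = (\<Sum>s\<in>gens n. real k *\<^sub>R b s)"
    have "emeasure coord_lebesgue (A k) \<le> emeasure coord_lebesgue ((\<lambda>x. x + c) -` coord_box (\<lambda>_. 2 * real k))"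
      using measurable_sets[of "\<lambda>x. x + c" borel borel "coord_box (\<lambda>_. 2 * real k)"]
      by (intro emeasure_mono) (force simp: A_def coord_box_def c_def coord_sum simp del: coord_linear(6), auto)
    also have "\<dots> = emeasure (distr coord_lebesgue borel (\<lambda>x. x + c)) (coord_box (\<lambda>_. 2 * real k))"
      by (simp add: emeasure_distr)
    also have "\<dots> < \<infinity>"
      by (subst distr_coord_lebesgue_translation, subst emeasure_coord_lebesgue_coord_box) auto
    finally show ?thesis .
  qed
  have "x \<in> (\<Union>k. A k)" for x
  proof -
    obtain k where "(\<Sum>s\<in>gens n. \<bar>coord s x\<bar>) < real k" using reals_Archimedean2 by blast
    moreover have "\<bar>coord s x\<bar> \<le> (\<Sum>s\<in>gens n. \<bar>coord s x\<bar>)" if "s \<in> gens n" for s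
      using that by (intro member_le_sum) auto
    ultimately have "x \<in> A k" unfolding A_def by fastforce
    then show ?thesis by blast
  qed
  then show "\<exists>C. countable C \<and> C \<subseteq> sets coord_lebesgue \<and> \<Union> C = space coord_lebesgue \<and> (\<forall>a\<in>C. emeasure coord_lebesgue a \<noteq> \<infinity>)"
    using * fin by (intro exI[of _ "range A"]) (auto simp: less_top)
qed

lemma distr_coord_lebesgue_shear:
  assumes [measurable]: "f \<in> borel_measurable borel" and "\<And>x t. f (x + t *\<^sub>R v) = f x"
  shows "distr coord_lebesgue borel (\<lambda>x. x + f x *\<^sub>R v) = coord_lebesgue"
  using assms distr_coord_lebesgue_translation sigma_finite_coord_lebesgue by (intro distr_shear) auto

lemma distr_coord_lebesgue_comp:
  assumes "distr coord_lebesgue borel f = coord_lebesgue" "distr coord_lebesgue borel g = coord_lebesgue"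
    and [measurable]: "f \<in> borel_measurable borel" "g \<in> borel_measurable borel"
  shows "distr coord_lebesgue borel (\<lambda>x. f (g x)) = coord_lebesgue"
proof -
  have "distr coord_lebesgue borel (\<lambda>x. f (g x)) = distr (distr coord_lebesgue borel g) borel f"
    by (subst distr_distr) (auto simp: comp_def)
  then show ?thesis using assms by simp
qed

text \<open>Right translations of the group, and the passage to coordinates of the second kind below,
  have this triangular form.\<close>

lemma distr_coord_lebesgue_triangular:
  assumes f[measurable]: "f \<in> borel_measurable borel" and g[measurable]: "g \<in> borel_measurable borel"
    and fW: "\<And>x t. f (x + t *\<^sub>R b GenW) = f x" and fZ: "\<And>x t. f (x + t *\<^sub>R b GenZ) = f x"
    and gZ: "\<And>x t. g (x + t *\<^sub>R b GenZ) = g x"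
  shows "distr coord_lebesgue borel (\<lambda>x. x + a + f x *\<^sub>R b GenW + g x *\<^sub>R b GenZ) = coord_lebesgue"
proof -
  have 1: "distr coord_lebesgue borel (\<lambda>x. x + f x *\<^sub>R b GenW) = coord_lebesgue"
    and 2: "distr coord_lebesgue borel (\<lambda>x. x + g x *\<^sub>R b GenZ) = coord_lebesgue"
    using assms by (auto intro: distr_coord_lebesgue_shear)
  \<comment> \<open>The Z-shear is applied first: \<open>g\<close> may depend on W and has to be
    evaluated at the original point, whereas \<open>f\<close> does not notice a change of Z.\<close>
  have "distr coord_lebesgue borel (\<lambda>x. (x + g x *\<^sub>R b GenZ) + f (x + g x *\<^sub>R b GenZ) *\<^sub>R b GenW) = coord_lebesgue"
    by (rule distr_coord_lebesgue_comp[OF 1 2]) measurable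
  then have 3: "distr coord_lebesgue borel (\<lambda>x. x + g x *\<^sub>R b GenZ + f x *\<^sub>R b GenW) = coord_lebesgue"
    by (simp add: fZ)
  have "distr coord_lebesgue borel (\<lambda>x. (x + g x *\<^sub>R b GenZ + f x *\<^sub>R b GenW) + a) = coord_lebesgue"
    by (rule distr_coord_lebesgue_comp[OF distr_coord_lebesgue_translation 3]) measurable
  then show ?thesis by (simp add: algebra_simps)
qed

lemma measurable_omega[measurable]: "omega a \<in> borel_measurable borel" "(\<lambda>x. omega x a) \<in> borel_measurable borel"
  unfolding omega_def by measurable

lemma measurable_uvdet[measurable]: "uvdet a \<in> borel_measurable borel" "(\<lambda>x. uvdet x a) \<in> borel_measurable borel"
  unfolding uvdet_def by measurable

lemma distr_coord_lebesgue_mul_right: "distr coord_lebesgue borel (\<lambda>x. x \<odot> a) = coord_lebesgue"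
  unfolding mul_expand add.assoc[symmetric]
  by (rule distr_coord_lebesgue_triangular) (measurable; simp add: uvdet_def)+


section \<open>Haar measure, cosets and fundamental domains\<close>

lemma compact_coord_box: "compact {x. \<forall>s\<in>gens n. l s \<le> coord s x \<and> coord s x \<le> a s}"
proof -
  let ?K = "{x. \<forall>s\<in>gens n. l s \<le> coord s x \<and> coord s x \<le> a s}"
  let ?R = "\<Sum>s\<in>gens n. (\<bar>l s\<bar> + \<bar>a s\<bar>) * norm (b s)"
  have "closed ?K"
    unfolding Collect_ball_eq by (intro closed_INT ballI closed_Collect_conj closed_Collect_le continuous_intros)
  moreover have "norm x \<le> ?R" if "x \<in> ?K" for x
  proof -
    have "norm x \<le> (\<Sum>s\<in>gens n. norm (coord s x *\<^sub>R b s))"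
      using norm_sum[of "\<lambda>s. coord s x *\<^sub>R b s" "gens n"] by (simp only: expand)
    also have "\<dots> \<le> ?R"
      using that by (intro sum_mono) (force intro!: mult_right_mono)
    finally show ?thesis .
  qed
  then have "bounded ?K" by (rule boundedI)
  ultimately show ?thesis by (simp add: compact_eq_bounded_closed)
qed

lemma l_coset_eq: "l_coset G g A = (\<odot>) g ` A"
  by (auto simp: l_coset_def)

lemma r_coset_eq: "r_coset G A g = (\<lambda>x. x \<odot> g) ` A"
  by (auto simp: r_coset_def)

lemma mul_vimage: "(\<odot>) g -` A = (\<odot>) (- g) ` A"
proof
  show "(\<odot>) g -` A \<subseteq> (\<odot>) (- g) ` A"
  proof
    fix x assume "x \<in> (\<odot>) g -` A"
    then show "x \<in> (\<odot>) (- g) ` A" by (intro image_eqI[of _ _ "g \<odot> x"]) auto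
  qed
  show "(\<odot>) (- g) ` A \<subseteq> (\<odot>) g -` A" using mul_cancel(2)[of g] by auto
qed

lemma mul_image_sets[measurable]: "A \<in> sets borel \<Longrightarrow> (\<odot>) g ` A \<in> sets borel"
  using measurable_sets[OF measurable_mul_left[of "- g"], of A] by (simp add: mul_vimage)

lemma haar_sets: "left_haar_measure G euclidean \<mu> \<Longrightarrow> sets \<mu> = sets borel"
  by (simp add: left_haar_measure_def sets_borel)

lemma haar_image:
  assumes "left_haar_measure G euclidean \<mu>" "A \<in> sets borel"
  shows "emeasure \<mu> ((\<odot>) g ` A) = emeasure \<mu> A"
  using assms haar_sets[OF assms(1)] by (auto simp: left_haar_measure_def l_coset_eq sets_borel)

text \<open>Coordinate Lebesgue measure is invariant under right translations and inversion, so the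
  exchange identity applies with it as second measure. Inserting the unit box identifies
  \<open>c\<close> as the mass that \<open>\<mu>\<close> gives to this box.\<close>

lemma haar_eq_coord_lebesgue:
  assumes \<mu>: "left_haar_measure G euclidean \<mu>"
  obtains c where "c > 0" "\<And>A. A \<in> sets borel \<Longrightarrow> emeasure \<mu> A = ennreal c * emeasure coord_lebesgue A"
proof -
  have sets_mu[simp, measurable_cong]: "sets \<mu> = sets borel" by (rule haar_sets[OF \<mu>])
  have space_mu[simp]: "space \<mu> = UNIV"
    using sets_eq_imp_space_eq[OF sets_mu] by simp
  have fin: "emeasure \<mu> K < \<infinity>" if "compact K" for K
    using \<mu> that borel_compact[OF that] by (auto simp: left_haar_measure_def)
  have left: "distr \<mu> borel ((\<odot>) a) = \<mu>" for a
    using haar_image[OF \<mu>] by (intro measure_eqI) (auto simp: emeasure_distr mul_vimage)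
  have sf: "sigma_finite_measure \<mu>"
  proof
    have "(\<Union>k::nat. cball (0::'g) (real k)) = UNIV"
      by (auto intro: real_arch_simple)
    then show "\<exists>C. countable C \<and> C \<subseteq> sets \<mu> \<and> \<Union> C = space \<mu> \<and> (\<forall>a\<in>C. emeasure \<mu> a \<noteq> \<infinity>)"
      using fin by (intro exI[of _ "range (\<lambda>k::nat. cball 0 (real k))"]) (auto simp: less_top)
  qed
  have ex: "emeasure \<mu> A * emeasure coord_lebesgue B = emeasure \<mu> B * emeasure coord_lebesgue A"
    if "A \<in> sets borel" "B \<in> sets borel" for A B
  proof (rule haar_exchange[where m="(\<odot>)" and iv=uminus])
    show "distr coord_lebesgue borel uminus = coord_lebesgue" by (rule distr_coord_lebesgue_uminus)
  qed (use that in \<open>auto simp: left distr_coord_lebesgue_mul_right minus_mul sf sigma_finite_coord_lebesgue\<close>)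
  define B where "B = coord_box (\<lambda>_. 1)"
  have B: "B \<in> sets borel" "emeasure coord_lebesgue B = 1"
    by (simp_all add: B_def emeasure_coord_lebesgue_coord_box)
  have eq: "emeasure \<mu> A = emeasure \<mu> B * emeasure coord_lebesgue A" if "A \<in> sets borel" for A
    using ex[OF that B(1)] B(2) by simp
  have "emeasure \<mu> B \<le> emeasure \<mu> {x. \<forall>s\<in>gens n. 0 \<le> coord s x \<and> coord s x \<le> 1}"
    by (intro emeasure_mono) (auto simp: B_def coord_box_def borel_compact compact_coord_box less_imp_le)
  then have "emeasure \<mu> B < \<infinity>" using fin[OF compact_coord_box] by (meson le_less_trans)
  \<comment> \<open>A null unit box would, by the identity, make the whole measure zero.\<close>
  moreover have "emeasure \<mu> B \<noteq> 0"
    using eq[of UNIV] \<mu> by (auto simp: left_haar_measure_def)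
  ultimately obtain c where c: "emeasure \<mu> B = ennreal c" "c > 0"
    by (cases "emeasure \<mu> B") (auto simp: less_le)
  show ?thesis
    by (rule that[OF c(2)]) (simp add: eq flip: c(1))
qed

text \<open>Cut \<open>B\<close> along the translates \<open>\<gamma>F\<close> and move the pieces back into \<open>F\<close>, where they stay disjoint.\<close>

lemma packing_le_fundamental_domain:
  assumes \<mu>: "left_haar_measure G euclidean \<mu>" and "countable \<Gamma>" and \<Gamma>: "subgroup \<Gamma> G"
    and F: "fundamental_domain G \<mu> \<Gamma> F" and B[measurable]: "B \<in> sets borel"
    and pack: "\<And>\<gamma> x. \<gamma> \<in> \<Gamma> \<Longrightarrow> x \<in> B \<Longrightarrow> \<gamma> \<odot> x \<in> B \<Longrightarrow> \<gamma> = 0"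
  shows "emeasure \<mu> B \<le> emeasure \<mu> F"
proof -
  have sets_mu[simp, measurable_cong]: "sets \<mu> = sets borel" by (rule haar_sets[OF \<mu>])
  have F_sets[measurable]: "F \<in> sets borel" and F_ex: "\<And>x. \<exists>!y. y \<in> F \<inter> (\<lambda>\<gamma>. \<gamma> \<odot> x) ` \<Gamma>"
    using F by (auto simp: fundamental_domain_def RCOSETS_def r_coset_eq)
  have inv_\<Gamma>: "- \<gamma> \<in> \<Gamma>" if "\<gamma> \<in> \<Gamma>" for \<gamma> using subgroup.m_inv_closed[OF \<Gamma> that] by simp
  have mul_\<Gamma>: "\<gamma> \<odot> \<delta> \<in> \<Gamma>" if "\<gamma> \<in> \<Gamma>" "\<delta> \<in> \<Gamma>" for \<gamma> \<delta> using subgroup.m_closed[OF \<Gamma> that] by simp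
  define P where "P \<gamma> = B \<inter> (\<odot>) \<gamma> ` F" for \<gamma>
  define Q where "Q \<gamma> = (\<odot>) (- \<gamma>) ` B \<inter> F" for \<gamma>
  have PQ: "P \<gamma> = (\<odot>) \<gamma> ` Q \<gamma>" for \<gamma>
  proof -
    have "(\<odot>) \<gamma> ` (\<odot>) (- \<gamma>) ` B = B" by (auto simp: image_image)
    moreover have "inj ((\<odot>) \<gamma>)" by (metis injI mul_cancel(1))
    ultimately show ?thesis by (simp add: P_def Q_def image_Int)
  qed
  have meas[measurable]: "P \<gamma> \<in> sets borel" "Q \<gamma> \<in> sets borel" for \<gamma>
    unfolding P_def Q_def by measurable
  \<comment> \<open>The \<open>P \<gamma>\<close> are disjoint because \<open>F\<close> meets each
    coset at most once, the \<open>Q \<gamma>\<close> because of the packing property; left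
    translation by \<open>\<gamma>\<close> matches the two families piece by piece.\<close>
  have dP: "disjoint_family_on P \<Gamma>"
  proof (unfold disjoint_family_on_def, intro ballI impI, rule ccontr)
    fix \<gamma> \<delta> assume g: "\<gamma> \<in> \<Gamma>" "\<delta> \<in> \<Gamma>" "\<gamma> \<noteq> \<delta>" and "P \<gamma> \<inter> P \<delta> \<noteq> {}"
    then obtain x where "x \<in> P \<gamma>" "x \<in> P \<delta>" by blast
    then obtain f f' where f: "f \<in> F" "f' \<in> F" "x = \<gamma> \<odot> f" "x = \<delta> \<odot> f'" by (auto simp: P_def)
    then have "f = (- \<gamma>) \<odot> x" "f' = (- \<delta>) \<odot> x" by (metis mul_cancel(1))+
    then have "f \<in> F \<inter> (\<lambda>\<gamma>. \<gamma> \<odot> x) ` \<Gamma>" "f' \<in> F \<inter> (\<lambda>\<gamma>. \<gamma> \<odot> x) ` \<Gamma>"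
      using f(1,2) g inv_\<Gamma> by blast+
    then have "f = f'" using F_ex[of x] by blast
    then show False using f g by (metis mul_cancel_right(1))
  qed
  have dQ: "disjoint_family_on Q \<Gamma>"
  proof (unfold disjoint_family_on_def, intro ballI impI, rule ccontr)
    fix \<gamma> \<delta> assume g: "\<gamma> \<in> \<Gamma>" "\<delta> \<in> \<Gamma>" "\<gamma> \<noteq> \<delta>" and "Q \<gamma> \<inter> Q \<delta> \<noteq> {}"
    then obtain z where "z \<in> Q \<gamma>" "z \<in> Q \<delta>" by blast
    then obtain x y where xy: "x \<in> B" "y \<in> B" "(- \<gamma>) \<odot> x = (- \<delta>) \<odot> y" by (auto simp: Q_def)
    then have "(\<delta> \<odot> (- \<gamma>)) \<odot> x = y" by (simp add: mul_assoc)
    then have "\<delta> \<odot> (- \<gamma>) = 0" using pack[of "\<delta> \<odot> (- \<gamma>)" x] g xy mul_\<Gamma> inv_\<Gamma> by auto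
    then show False using g by (metis mul_cancel_right(2) mul_zero(1))
  qed
  have UP: "(\<Union>\<gamma>\<in>\<Gamma>. P \<gamma>) = B"
  proof (intro equalityI subsetI)
    fix x assume x: "x \<in> B"
    obtain \<gamma> where "\<gamma> \<in> \<Gamma>" "\<gamma> \<odot> x \<in> F" using F_ex[of x] by auto
    then have "- \<gamma> \<in> \<Gamma>" "x \<in> P (- \<gamma>)"
      using x inv_\<Gamma> by (auto simp: P_def intro!: image_eqI[of _ _ "\<gamma> \<odot> x"])
    then show "x \<in> (\<Union>\<gamma>\<in>\<Gamma>. P \<gamma>)" by blast
  qed (auto simp: P_def)
  have "emeasure \<mu> B = (\<integral>\<^sup>+\<gamma>. emeasure \<mu> (P \<gamma>) \<partial>count_space \<Gamma>)"
    using \<open>countable \<Gamma>\<close> dP by (subst UP[symmetric], intro emeasure_UN_countable) auto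
  also have "\<dots> = (\<integral>\<^sup>+\<gamma>. emeasure \<mu> (Q \<gamma>) \<partial>count_space \<Gamma>)"
    by (simp add: PQ haar_image[OF \<mu>])
  also have "\<dots> = emeasure \<mu> (\<Union>\<gamma>\<in>\<Gamma>. Q \<gamma>)"
    using \<open>countable \<Gamma>\<close> dQ by (intro emeasure_UN_countable[symmetric]) auto
  also have "\<dots> \<le> emeasure \<mu> F"
    by (rule emeasure_mono) (auto simp: Q_def)
  finally show ?thesis .
qed

text \<open>A countable basis of a discrete subspace must contain all singletons. Countability is
  what permits summing measures over the translates.\<close>

lemma countable_discrete:
  fixes \<Gamma> :: "'g set"
  assumes "subtopology euclidean \<Gamma> = discrete_topology \<Gamma>"
  shows "countable \<Gamma>"
proof -
  obtain \<B> :: "'g set set" where "countable \<B>" "topological_basis \<B>" using ex_countable_basis by blast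
  have "\<forall>V\<in>\<B>. openin euclidean V" using topological_basis_open[OF \<open>topological_basis \<B>\<close>] by simp
  moreover have "\<forall>U x. openin euclidean U \<and> x \<in> U \<longrightarrow> (\<exists>V\<in>\<B>. x \<in> V \<and> V \<subseteq> U)"
    using topological_basisE[OF \<open>topological_basis \<B>\<close>] by (metis open_openin)
  ultimately have "second_countable (euclidean :: 'g topology)"
    unfolding second_countable_def using \<open>countable \<B>\<close> by blast
  then show ?thesis
    using second_countable_subtopology[of euclidean \<Gamma>] by (simp add: assms second_countable_discrete_topology)
qed

subsection \<open>Homogeneous dimension\<close>

lemma lower_central_1: "lower_central br 1 = span {b GenW, b GenZ}"
proof -
  have "br x y \<in> span {b GenW, b GenZ}" for x y
    unfolding br_eq by (intro span_add span_scale span_base) auto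
  then have "span {br x y |x y. True} \<subseteq> span {b GenW, b GenZ}"
    by (intro span_minimal subspace_span) auto
  moreover have "br (b GenU) (b GenV) = b GenW" "br (b GenU) (b GenW) = b GenZ"
    by (simp_all add: br_eq uvdet_def)
  then have "\<exists>x y. b GenW = br x y" "\<exists>x y. b GenZ = br x y" by metis+
  then have "{b GenW, b GenZ} \<subseteq> span {br x y |x y. True}"
    by (auto intro!: span_base)
  then have "span {b GenW, b GenZ} \<subseteq> span {br x y |x y. True}"
    by (intro span_minimal subspace_span)
  ultimately show ?thesis by simp
qed

lemma lower_central_2: "lower_central br 2 = span {b GenZ}"
proof -
  have *: "coord GenU y = 0 \<and> coord GenV y = 0 \<and> omega x y = 0" if "y \<in> span {b GenW, b GenZ}" for x y
    using that by (induction rule: span_induct_alt) auto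
  have "br x y \<in> span {b GenZ}" if "y \<in> span {b GenW, b GenZ}" for x y
  proof -
    have "br x y = (coord GenU x * coord GenW y) *\<^sub>R b GenZ" using *[OF that, of x] by (simp add: br_eq uvdet_def)
    then show ?thesis by (simp add: span_scale span_base)
  qed
  then have "span {br x y |x y. y \<in> span {b GenW, b GenZ}} \<subseteq> span {b GenZ}"
    by (intro span_minimal subspace_span) auto
  moreover have "b GenZ = br (b GenU) (b GenW)" "b GenW \<in> span {b GenW, b GenZ}"
    by (auto simp: br_eq uvdet_def intro: span_base)
  then have "b GenZ \<in> span {br x y |x y. y \<in> span {b GenW, b GenZ}}"
    by (intro span_base) blast
  then have "span {b GenZ} \<subseteq> span {br x y |x y. y \<in> span {b GenW, b GenZ}}"
    by (intro span_minimal subspace_span) auto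
  moreover have "lower_central br 2 = span {br x y |x y. y \<in> span {b GenW, b GenZ}}"
    using lower_central_1 by (simp add: numeral_2_eq_2)
  ultimately show ?thesis by simp
qed

lemma lower_central_ge_3: "k \<ge> 3 \<Longrightarrow> lower_central br k = {0}"
proof (induction k rule: dec_induct)
  case base
  have "coord GenU y = 0 \<and> coord GenV y = 0 \<and> coord GenW y = 0 \<and> omega x y = 0" if "y \<in> span {b GenZ}" for x y
    using that by (induction rule: span_induct_alt) auto
  then have "{br x y |x y. y \<in> span {b GenZ}} \<subseteq> {0}"
    by (auto simp: br_eq uvdet_def)
  then have "span {br x y |x y. y \<in> span {b GenZ}} = {0}"
    using span_minimal[OF _ subspace_single_0] span_zero by blast
  then show ?case using lower_central_2 by (simp add: numeral_3_eq_3 numeral_2_eq_2)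
next
  case (step k)
  have "{br x y |x y. y \<in> {0}} = {0}" using bilinear_rzero[OF bilinear_br] by auto
  then show ?case using step by simp
qed

lemma homogeneous_dimension_eq: "homogeneous_dimension br = 2 * n + 7"
proof -
  have indepWZ: "independent {b GenW, b GenZ}" "independent {b GenZ}"
    by (rule independent_mono[OF indep]; auto)+
  have "b GenW \<noteq> b GenZ" by (metis coord_basis_simps(11,12) zero_neq_one)
  then have d: "dim (lower_central br 0) = 4 + 2 * n" "dim (lower_central br 1) = 2" "dim (lower_central br 2) = 1"
    using indepWZ by (auto simp: dim_eq lower_central_1 lower_central_2 dim_eq_card_independent
      simp del: lower_central.simps(2) One_nat_def)
  have "homogeneous_dimension br = (\<Sum>i\<in>{0,1,2}. dim (lower_central br i))"
    unfolding homogeneous_dimension_def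
  proof (rule suminf_finite)
    fix i :: nat assume "i \<notin> {0, 1, 2}"
    then have "i \<ge> 3" by auto
    then show "dim (lower_central br i) = 0" by (simp only: lower_central_ge_3) simp
  qed simp
  also have "\<dots> = 2 * n + 7" using d by (simp del: lower_central.simps)
  finally show ?thesis .
qed


subsection \<open>Word length\<close>

text \<open>Products of exactly \<open>k\<close> letters. As \<open>S\<close> may lack the identity,
  these sets need not increase with \<open>k\<close>, so later estimates keep exact letter
  counts.\<close>

primrec words :: "'g set \<Rightarrow> nat \<Rightarrow> 'g set" where
  "words S 0 = {0}"
| "words S (Suc k) = (\<lambda>(s, x). s \<odot> x) ` ((S \<union> uminus ` S) \<times> words S k)"

lemma words_iff: "x \<in> words S k \<longleftrightarrow> (\<exists>ws. length ws = k \<and> set ws \<subseteq> S \<union> uminus ` S \<and> x = foldr (\<odot>) ws 0)"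
proof (induction k arbitrary: x)
  case (Suc k)
  show ?case
  proof
    assume "x \<in> words S (Suc k)"
    then obtain s y where sy: "s \<in> S \<union> uminus ` S" "y \<in> words S k" "x = s \<odot> y" by auto
    with Suc obtain ws where "length ws = k" "set ws \<subseteq> S \<union> uminus ` S" "y = foldr (\<odot>) ws 0" by blast
    with sy show "\<exists>ws. length ws = Suc k \<and> set ws \<subseteq> S \<union> uminus ` S \<and> x = foldr (\<odot>) ws 0"
      by (intro exI[of _ "s # ws"]) simp
  next
    assume "\<exists>ws. length ws = Suc k \<and> set ws \<subseteq> S \<union> uminus ` S \<and> x = foldr (\<odot>) ws 0"
    then obtain w where w: "length w = Suc k" "set w \<subseteq> S \<union> uminus ` S" "x = foldr (\<odot>) w 0" by blast
    then obtain s ws where "w = s # ws" by (cases w) auto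
    with w have *: "length ws = k" "s \<in> S \<union> uminus ` S" "set ws \<subseteq> S \<union> uminus ` S"
      "x = s \<odot> foldr (\<odot>) ws 0"
      by auto
    then have "foldr (\<odot>) ws 0 \<in> words S k" using Suc by blast
    with * show "x \<in> words S (Suc k)" by (auto intro!: image_eqI[of _ _ "(s, foldr (\<odot>) ws 0)"])
  qed
qed auto

lemma words_mul: "x \<in> words S j \<Longrightarrow> y \<in> words S k \<Longrightarrow> x \<odot> y \<in> words S (j + k)"
proof (induction j arbitrary: x)
  case (Suc j)
  then obtain s z where sz: "s \<in> S \<union> uminus ` S" "z \<in> words S j" "x = s \<odot> z" by auto
  then have "z \<odot> y \<in> words S (j + k)" using Suc by blast
  then show ?case using sz by (auto simp: mul_assoc intro!: image_eqI[of _ _ "(s, z \<odot> y)"])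
qed auto

lemma words_minus: "x \<in> words S k \<Longrightarrow> - x \<in> words S k"
proof (induction k arbitrary: x)
  case (Suc k)
  then obtain s z where sz: "s \<in> S \<union> uminus ` S" "z \<in> words S k" "x = s \<odot> z" by auto
  have "- s \<in> S \<union> uminus ` S" using sz(1) by auto
  then have "- s \<in> words S 1" by (auto intro!: image_eqI[of _ _ "(- s, 0)"])
  then have "(- z) \<odot> (- s) \<in> words S (k + 1)" using Suc.IH[OF sz(2)] by (intro words_mul)
  then show ?case using sz by (simp add: minus_mul)
qed auto

lemma words_commut: "x \<in> words S j \<Longrightarrow> y \<in> words S k \<Longrightarrow> commut x y \<in> words S (2 * j + 2 * k)"
proof -
  assume "x \<in> words S j" "y \<in> words S k"
  then have "commut x y \<in> words S (j + k + j + k)"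
    unfolding commut_def by (intro words_mul words_minus)
  also have "j + k + j + k = 2 * j + 2 * k" by simp
  finally show ?thesis .
qed

lemma word_length_eq: "word_length G S x = (LEAST k. x \<in> words S k)"
proof -
  have "m_inv G ` S = uminus ` S" by (intro image_cong) auto
  then show ?thesis unfolding word_length_def words_iff G_simps by simp
qed

lemma word_length_le: "x \<in> words S k \<Longrightarrow> word_length G S x \<le> k"
  unfolding word_length_eq by (rule Least_le)

lemma generate_words: "x \<in> generate G S \<Longrightarrow> \<exists>k. x \<in> words S k"
proof (induction rule: generate.induct)
  case one
  show ?case by (intro exI[of _ 0]) simp
next
  case (incl h)
  then show ?case by (intro exI[of _ 1]) (auto intro!: image_eqI[of _ _ "(h, 0)"])
next
  case (inv h)
  then show ?case by (intro exI[of _ 1]) (auto intro!: image_eqI[of _ _ "(- h, 0)"])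
next
  case (eng h1 h2)
  then show ?case using words_mul by (metis G_simps(3))
qed

lemma words_word_length: "generate G S = UNIV \<Longrightarrow> x \<in> words S (word_length G S x)"
  unfolding word_length_eq by (rule LeastI_ex) (rule generate_words, simp)

lemma systole_ge_iff:
  "ennreal r \<le> systole G S \<Gamma> \<longleftrightarrow> (\<forall>x\<in>\<Gamma>. x \<noteq> 0 \<longrightarrow> r \<le> real (word_length G S x))"
proof -
  have "ennreal r \<le> systole G S \<Gamma> \<longleftrightarrow> (\<forall>x\<in>\<Gamma> - {0}. ennreal r \<le> ennreal (real (word_length G S x)))"
    unfolding systole_def le_INF_iff G_simps ennreal_of_nat_eq_real_of_nat ..
  also have "\<dots> \<longleftrightarrow> (\<forall>x\<in>\<Gamma> - {0}. r \<le> real (word_length G S x))"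
    by (simp only: ennreal_le_iff of_nat_0_le_iff)
  also have "\<dots> \<longleftrightarrow> (\<forall>x\<in>\<Gamma>. x \<noteq> 0 \<longrightarrow> r \<le> real (word_length G S x))"
    by (simp only: Ball_def Diff_iff singleton_iff imp_conjL)
  finally show ?thesis .
qed

lemma abs_omega_le:
  assumes "\<And>i. i \<in> {1..n} \<Longrightarrow> \<bar>coord (GenX i) x\<bar> \<le> A \<and> \<bar>coord (GenY i) x\<bar> \<le> A"
    and "\<And>i. i \<in> {1..n} \<Longrightarrow> \<bar>coord (GenX i) y\<bar> \<le> B \<and> \<bar>coord (GenY i) y\<bar> \<le> B" and "0 \<le> A"
  shows "\<bar>omega x y\<bar> \<le> real n * (2 * A * B)"
proof -
  have "\<bar>omega x y\<bar> \<le> (\<Sum>i=1..n. \<bar>coord (GenX i) x * coord (GenY i) y - coord (GenY i) x * coord (GenX i) y\<bar>)"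
    unfolding omega_def by (rule sum_abs)
  also have "\<dots> \<le> (\<Sum>i=1..n. 2 * A * B)"
  proof (rule sum_mono)
    fix i assume i: "i \<in> {1..n}"
    have "\<bar>coord (GenX i) x * coord (GenY i) y\<bar> \<le> A * B" "\<bar>coord (GenY i) x * coord (GenX i) y\<bar> \<le> A * B"
      unfolding abs_mult using assms(1,2)[OF i] \<open>0 \<le> A\<close> by (auto intro!: mult_mono)
    then show "\<bar>coord (GenX i) x * coord (GenY i) y - coord (GenY i) x * coord (GenX i) y\<bar> \<le> 2 * A * B"
      by linarith
  qed
  finally show ?thesis by simp
qed

text \<open>One more letter changes W by O(k) and Z by O(k^2), which sums to degrees 2 and 3. This
  direction of the length estimate gives the explicit lattices their large systole.\<close>

lemma words_bound:
  assumes "compact S"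
  obtains M where "M \<ge> 1"
    "\<And>k x s. x \<in> words S k \<Longrightarrow> s \<in> gens n - {GenW, GenZ} \<Longrightarrow> \<bar>coord s x\<bar> \<le> M * real k"
    "\<And>k x. x \<in> words S k \<Longrightarrow> \<bar>coord GenW x\<bar> \<le> M * (real k)^2"
    "\<And>k x. x \<in> words S k \<Longrightarrow> \<bar>coord GenZ x\<bar> \<le> M * (real k)^3"
proof -
  have "compact ((\<lambda>x. \<Sum>s\<in>gens n. \<bar>coord s x\<bar>) ` S)"
    using assms by (intro compact_continuous_image continuous_intros)
  then have "bounded ((\<lambda>x. \<Sum>s\<in>gens n. \<bar>coord s x\<bar>) ` S)" by (rule compact_imp_bounded)
  then obtain B0 where B0: "\<And>x. x \<in> S \<Longrightarrow> (\<Sum>s\<in>gens n. \<bar>coord s x\<bar>) \<le> B0"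
    unfolding bounded_iff by fastforce
  define B where "B = max 1 B0"
  have B1: "B \<ge> 1" by (simp add: B_def)
  have BS: "\<bar>coord s x\<bar> \<le> B" if "x \<in> S \<union> uminus ` S" "s \<in> gens n" for s x
  proof -
    have "\<bar>coord s y\<bar> \<le> B" if "y \<in> S" for y
      using member_le_sum[of s "gens n" "\<lambda>s. \<bar>coord s y\<bar>"] B0[OF that] \<open>s \<in> gens n\<close> by (auto simp: B_def)
    then show ?thesis using that by auto
  qed
  \<comment> \<open>The constants collect the coefficients of these increments, so that the latter
    stay below \<open>M2 * (2 * \<kappa> + 1)\<close> and
    \<open>M3 * (3 * \<kappa>^2 + 3 * \<kappa> + 1)\<close>.\<close>
  define M2 where "M2 = B + B^2"
  define M3 where "M3 = B + B * M2 + B^2 * (1 + real n) + B^3"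
  have pos: "0 \<le> B" "0 \<le> M2" "0 \<le> M3" using B1 by (auto simp: M2_def M3_def)
  have bounds: "(\<forall>s\<in>gens n - {GenW, GenZ}. \<bar>coord s x\<bar> \<le> B * real k) \<and> \<bar>coord GenW x\<bar> \<le> M2 * (real k)^2
      \<and> \<bar>coord GenZ x\<bar> \<le> M3 * (real k)^3" if "x \<in> words S k" for k x
    using that
  proof (induction k arbitrary: x)
    case 0
    then show ?case by auto
  next
    case (Suc k)
    then obtain s y where s: "s \<in> S \<union> uminus ` S" and y: "y \<in> words S k" and x: "x = s \<odot> y" by auto
    note IH = Suc.IH[OF y]
    define \<kappa> where "\<kappa> = real k"
    have \<kappa>: "\<kappa> \<ge> 0" by (simp add: \<kappa>_def)
    have \<kappa>2: "\<kappa> \<le> \<kappa>^2" unfolding \<kappa>_def by (simp add: power2_eq_square flip: of_nat_mult)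
    have sU: "\<bar>coord GenU s\<bar> \<le> B" and sV: "\<bar>coord GenV s\<bar> \<le> B" and sW: "\<bar>coord GenW s\<bar> \<le> B" and sZ: "\<bar>coord GenZ s\<bar> \<le> B"
      and sXY: "\<And>i. i \<in> {1..n} \<Longrightarrow> \<bar>coord (GenX i) s\<bar> \<le> B \<and> \<bar>coord (GenY i) s\<bar> \<le> B"
      using BS[OF s] by auto
    have yU: "\<bar>coord GenU y\<bar> \<le> B * \<kappa>" and yV: "\<bar>coord GenV y\<bar> \<le> B * \<kappa>" and yW: "\<bar>coord GenW y\<bar> \<le> M2 * \<kappa>^2"
      and yZ: "\<bar>coord GenZ y\<bar> \<le> M3 * \<kappa>^3"
      and yXY: "\<And>i. i \<in> {1..n} \<Longrightarrow> \<bar>coord (GenX i) y\<bar> \<le> B * \<kappa> \<and> \<bar>coord (GenY i) y\<bar> \<le> B * \<kappa>"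
      using IH by (auto simp: \<kappa>_def)
    have UV: "\<bar>coord GenU s * coord GenV y\<bar> \<le> B * (B * \<kappa>)" "\<bar>coord GenV s * coord GenU y\<bar> \<le> B * (B * \<kappa>)"
      unfolding abs_mult using sU sV yU yV pos by (auto intro!: mult_mono)
    then have uvdet: "\<bar>uvdet s y\<bar> \<le> 2 * B^2 * \<kappa>"
      unfolding uvdet_def power2_eq_square by linarith
    have 1: "\<bar>coord t x\<bar> \<le> B * real (Suc k)" if t: "t \<in> gens n - {GenW, GenZ}" for t
    proof -
      have "coord t x = coord t s + coord t y" using t unfolding x by (auto elim: gens_cases)
      moreover have "\<bar>coord t s\<bar> \<le> B" "\<bar>coord t y\<bar> \<le> B * real k" using BS[OF s] IH t by auto
      ultimately show ?thesis by (simp add: algebra_simps)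
    qed
    have "\<bar>coord GenW x\<bar> \<le> B + M2 * \<kappa>^2 + B^2 * \<kappa>"
      unfolding x coord_mul_W using sW yW uvdet by linarith
    also have "\<dots> \<le> M2 * (\<kappa> + 1)^2"
      using pos \<kappa> by (simp add: M2_def power2_eq_square algebra_simps)
    finally have 2: "\<bar>coord GenW x\<bar> \<le> M2 * (real (Suc k))^2" by (simp add: \<kappa>_def add.commute)
    have UW: "\<bar>coord GenU s * coord GenW y\<bar> \<le> B * (M2 * \<kappa>^2)" "\<bar>coord GenW s * coord GenU y\<bar> \<le> B * (B * \<kappa>)"
      unfolding abs_mult using sU sW yU yW pos by (auto intro!: mult_mono)
    have omega: "\<bar>omega s y\<bar> \<le> real n * (2 * B * (B * \<kappa>))"
      by (rule abs_omega_le[OF sXY yXY pos(1)])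
    have "\<bar>coord GenU s - coord GenU y\<bar> \<le> B + B * \<kappa>" using sU yU by linarith
    then have T: "\<bar>(coord GenU s - coord GenU y) * uvdet s y\<bar> \<le> (B + B * \<kappa>) * (2 * B^2 * \<kappa>)"
      unfolding abs_mult using uvdet pos \<kappa> by (intro mult_mono) auto
    have "\<bar>coord GenZ x\<bar> \<le> B + M3 * \<kappa>^3 + (B * (M2 * \<kappa>^2) + B * (B * \<kappa>) + real n * (2 * B * (B * \<kappa>))) / 2
        + (B + B * \<kappa>) * (2 * B^2 * \<kappa>) / 12"
    proof -
      have "\<bar>a + b + (c - d + e) / 2 + f / 12\<bar> \<le> a' + b' + (c' + d' + e') / 2 + f' / 12"
        if "\<bar>a\<bar> \<le> a'" "\<bar>b\<bar> \<le> b'" "\<bar>c\<bar> \<le> c'" "\<bar>d\<bar> \<le> d'" "\<bar>e\<bar> \<le> e'" "\<bar>f\<bar> \<le> f'" for a b c d e f a' b' c' d' e' f' :: real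
        using that unfolding abs_le_iff by (intro conjI; elim conjE; argo)
      then show ?thesis
        unfolding x coord_mul_Z using sZ yZ UW omega T by blast
    qed
    also have "\<dots> \<le> M3 * (\<kappa> + 1)^3"
    proof -
      have "B + (B * (M2 * \<kappa>^2) + B * (B * \<kappa>) + real n * (2 * B * (B * \<kappa>))) / 2 + (B + B * \<kappa>) * (2 * B^2 * \<kappa>) / 12
          \<le> M3 * (3 * \<kappa>^2 + 3 * \<kappa> + 1)"
      proof -
        \<comment> \<open>\<open>E\<close> equals \<open>(\<kappa> + 1)^3 - \<kappa>^3\<close>, the
          room available in the induction step.\<close>
        define E where "E = 3 * \<kappa>^2 + 3 * \<kappa> + 1"
        have E: "1 \<le> E" "\<kappa> \<le> E" "\<kappa>^2 \<le> E" "\<kappa> + \<kappa>^2 \<le> E"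
          using \<kappa> zero_le_power2[of \<kappa>] unfolding E_def by linarith+
        have "B * 1 \<le> B * E" by (rule mult_left_mono[OF E(1) pos(1)])
        moreover have "B * M2 * \<kappa>^2 \<le> B * M2 * E" "B^2 * (1 + real n) * \<kappa> \<le> B^2 * (1 + real n) * E"
          "B^3 * (\<kappa> + \<kappa>^2) \<le> B^3 * E" "0 \<le> B^2 * \<kappa>" "0 \<le> B * M2 * \<kappa>^2" "0 \<le> B^3 * (\<kappa> + \<kappa>^2)"
          using E pos \<kappa> by (auto intro!: mult_left_mono)
        moreover have "B + (B * (M2 * \<kappa>^2) + B * (B * \<kappa>) + real n * (2 * B * (B * \<kappa>))) / 2 + (B + B * \<kappa>) * (2 * B^2 * \<kappa>) / 12
          = B * 1 + B * M2 * \<kappa>^2 / 2 + (B^2 * (1 + real n) * \<kappa> - B^2 * \<kappa> / 2) + B^3 * (\<kappa> + \<kappa>^2) / 6"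
          by (simp add: field_simps power2_eq_square power3_eq_cube)
        moreover have "M3 * E = B * E + B * M2 * E + B^2 * (1 + real n) * E + B^3 * E"
          by (simp add: M3_def ring_distribs)
        ultimately show ?thesis unfolding E_def[symmetric] by linarith
      qed
      moreover have "M3 * (\<kappa> + 1)^3 = M3 * \<kappa>^3 + M3 * (3 * \<kappa>^2 + 3 * \<kappa> + 1)"
        by (simp add: algebra_simps power3_eq_cube power2_eq_square)
      ultimately show ?thesis by linarith
    qed
    finally have 3: "\<bar>coord GenZ x\<bar> \<le> M3 * (real (Suc k))^3" by (simp add: \<kappa>_def add.commute)
    show ?case using 1 2 3 by blast
  qed
  define M where "M = B + M2 + M3"
  show ?thesis
  proof (rule that[of M])
    show "M \<ge> 1" using B1 pos by (simp add: M_def)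
    fix k x assume x: "x \<in> words S k"
    have le: "B * real k \<le> M * real k" "M2 * (real k)^2 \<le> M * (real k)^2" "M3 * (real k)^3 \<le> M * (real k)^3"
      by (rule mult_right_mono; use pos in \<open>simp add: M_def\<close>)+
    show "\<bar>coord GenW x\<bar> \<le> M * (real k)^2" using bounds[OF x] le(2) by linarith
    show "\<bar>coord GenZ x\<bar> \<le> M * (real k)^3" using bounds[OF x] le(3) by linarith
    fix s assume "s \<in> gens n - {GenW, GenZ}"
    then have "\<bar>coord s x\<bar> \<le> B * real k" using bounds[OF x] by blast
    then show "\<bar>coord s x\<bar> \<le> M * real k" using le(1) by linarith
  qed
qed

lemma compact_words: "compact S \<Longrightarrow> compact (words S k)"
proof (induction k)
  case (Suc k)
  then have "compact ((S \<union> uminus ` S) \<times> words S k)"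
    by (intro compact_Times compact_Un compact_continuous_image continuous_intros) auto
  then show ?case
    unfolding words.simps case_prod_beta' by (intro compact_continuous_image continuous_intros)
qed auto

text \<open>Baire category: the compact sets \<open>words S k\<close> exhaust the group, so one of
  them has an interior point \<open>p\<close>. Multiplying by \<open>- p\<close> costs
  \<open>k\<close> more letters and moves that point to the identity.\<close>

lemma words_contains_ball:
  assumes S: "compact S" and gen: "generate G S = UNIV"
  obtains m \<delta> where "\<delta> > 0" "ball 0 \<delta> \<subseteq> words S m"
proof -
  have "(\<Union>k. words S k) = UNIV" using generate_words gen by auto
  then have ne: "euclidean interior_of \<Union>(range (words S)) \<noteq> {}" by simp
  have "completely_metrizable_space (euclidean :: 'g topology)" by (rule completely_metrizable_space_euclidean)
  then have "\<exists>k. interior (words S k) \<noteq> {}"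
  proof (rule contrapos_pp)
    assume "\<not> (\<exists>k. interior (words S k) \<noteq> {})"
    then have "closedin euclidean T \<and> euclidean interior_of T = {}" if "T \<in> range (words S)" for T
      using that compact_words[OF S] by (auto simp: compact_imp_closed)
    then have "euclidean interior_of \<Union>(range (words S)) = {}"
      using \<open>completely_metrizable_space euclidean\<close> by (intro Baire_category_alt) auto
    then show "\<not> completely_metrizable_space (euclidean :: 'g topology)"
      using ne by simp
  qed
  then obtain k p where p: "p \<in> interior (words S k)" by auto
  define O' where "O' = (\<odot>) p -` interior (words S k)"
  have "open O'" unfolding O'_def
    by (intro open_vimage open_interior continuous_intros)
  moreover have "0 \<in> O'" using p by (simp add: O'_def)
  ultimately obtain \<delta> where \<delta>: "\<delta> > 0" "ball 0 \<delta> \<subseteq> O'" by (meson openE)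
  have "O' \<subseteq> words S (k + k)"
  proof
    fix y assume "y \<in> O'"
    then have "p \<odot> y \<in> words S k" using interior_subset by (auto simp: O'_def)
    moreover have "- p \<in> words S k" using p interior_subset words_minus by blast
    ultimately have "(- p) \<odot> (p \<odot> y) \<in> words S (k + k)" by (intro words_mul)
    then show "y \<in> words S (k + k)" by simp
  qed
  with \<delta> that show ?thesis by blast
qed

lemma mul_collinear: "(s *\<^sub>R x) \<odot> (t *\<^sub>R x) = (s + t) *\<^sub>R x"
proof -
  have "uvdet (s *\<^sub>R x) (t *\<^sub>R x) = 0" by (simp add: uvdet_def)
  then show ?thesis by (simp add: mul_expand scaleR_left_distrib)
qed

lemma words_multiple: "x \<in> words S m \<Longrightarrow> real N *\<^sub>R x \<in> words S (N * m)"
proof (induction N)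
  case (Suc N)
  then have "(1 *\<^sub>R x) \<odot> (real N *\<^sub>R x) \<in> words S (m + N * m)" by (intro words_mul) auto
  then show ?case unfolding mul_collinear by simp
qed auto

text \<open>Multiples of a vector form a one-parameter subgroup, so a long segment consists of
  powers of elements of the small ball. One letter count serves all \<open>t\<close> up to
  \<open>N\<close>.\<close>

lemma words_segment:
  assumes S: "compact S" and gen: "generate G S = UNIV"
  obtains M where "\<And>t N. \<bar>t\<bar> \<le> real N \<Longrightarrow> t *\<^sub>R b GenU \<in> words S (N * M) \<and> t *\<^sub>R b GenV \<in> words S (N * M)"
proof -
  obtain m \<delta> where \<delta>: "\<delta> > 0" "ball 0 \<delta> \<subseteq> words S m" using words_contains_ball[OF S gen] by blast
  define R where "R = norm (b GenU) + norm (b GenV)"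
  \<comment> \<open>Division by \<open>N1\<close> brings every vector of norm at most
    \<open>R\<close> into the ball.\<close>
  obtain N1 :: nat where N1: "R / \<delta> < real N1" using reals_Archimedean2 by blast
  have "R \<ge> 0" by (simp add: R_def)
  then have "N1 > 0" using N1 \<delta>(1) by (cases N1) (auto simp: field_simps)
  have seg: "t *\<^sub>R x \<in> words S (N * (N1 * m))" if t: "\<bar>t\<bar> \<le> real N" and x: "norm x \<le> R" for t N x
  proof (cases "N = 0")
    case True
    then show ?thesis using t by simp
  next
    case False
    define y where "y = (t / (real N * real N1)) *\<^sub>R x"
    have "norm y \<le> (1 / real N1) * R"
      unfolding y_def norm_scaleR using t x False \<open>N1 > 0\<close> \<open>R \<ge> 0\<close>
      by (intro mult_mono) (auto simp: field_simps)
    also have "\<dots> < \<delta>" using N1 \<delta>(1) \<open>N1 > 0\<close> by (simp add: field_simps)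
    finally have "y \<in> words S m" using \<delta> by auto
    then have "real (N * N1) *\<^sub>R y \<in> words S (N * N1 * m)" by (rule words_multiple)
    then show ?thesis using False \<open>N1 > 0\<close> by (simp add: y_def mult.assoc)
  qed
  show ?thesis
    by (rule that[of "N1 * m"]) (auto intro!: seg simp: R_def)
qed

text \<open>W and Z are reached by commutators: r U with t V yields r t in W, and a further
  commutator with r U yields r^2 t in Z. Only elements without U, X, Y part are treated, since the
  lower bound tests no others.\<close>

lemma word_length_upper:
  assumes S: "compact S" and gen: "generate G S = UNIV"
  obtains C where "C > 0"
    "\<And>r v w z. r \<ge> 1 \<Longrightarrow> \<bar>v\<bar> \<le> r \<Longrightarrow> \<bar>w\<bar> \<le> r^2 \<Longrightarrow> \<bar>z\<bar> \<le> r^3 \<Longrightarrow>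
      real (word_length G S (v *\<^sub>R b GenV + w *\<^sub>R b GenW + z *\<^sub>R b GenZ)) < C * r"
proof -
  obtain M where M: "\<And>t N. \<bar>t\<bar> \<le> real N \<Longrightarrow> t *\<^sub>R b GenU \<in> words S (N * M) \<and> t *\<^sub>R b GenV \<in> words S (N * M)"
    using words_segment[OF S gen] by blast
  have "real (word_length G S (v *\<^sub>R b GenV + w *\<^sub>R b GenW + z *\<^sub>R b GenZ)) < (45 * real M + 1) * r"
    if r: "r \<ge> 1" and v: "\<bar>v\<bar> \<le> r" and w: "\<bar>w\<bar> \<le> r^2" and z: "\<bar>z\<bar> \<le> r^3" for r v w z
  proof -
    \<comment> \<open>The parameters \<open>t1\<close> and \<open>t2\<close> below may reach 3r/2,
      so segments of length 2r are prepared; rounding up stays below 3r because r >= 1.\<close>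
    define N where "N = nat \<lceil>2 * r\<rceil>"
    have N: "2 * r \<le> real N" "real N \<le> 3 * r" using r by (auto simp: N_def) linarith+
    define K where "K = N * M"
    note M = M[of _ N, folded K_def]
    have gU: "r *\<^sub>R b GenU \<in> words S K" using M[of r] N r by auto
    define q where "q t = commut (r *\<^sub>R b GenU) (t *\<^sub>R b GenV)" for t
    have q: "q t = (r * t) *\<^sub>R b GenW + (r^2 * t / 2) *\<^sub>R b GenZ" for t
      by (simp add: q_def commut_eq uvdet_def power2_eq_square)
    have qw: "q t \<in> words S (4 * K)" if "\<bar>t\<bar> \<le> 2 * r" for t
      using words_commut[OF gU, of "t *\<^sub>R b GenV" K] M[of t] N that by (simp add: q_def)
    define p where "p t = commut (r *\<^sub>R b GenU) (q t)" for t
    have p: "p t = (r^2 * t) *\<^sub>R b GenZ" for t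
      by (simp add: p_def commut_eq uvdet_def q power2_eq_square)
    have pw: "p t \<in> words S (10 * K)" if "\<bar>t\<bar> \<le> 2 * r" for t
      using words_commut[OF gU qw[OF that]] by (simp add: p_def)
    define t1 where "t1 = w / r"
    \<comment> \<open>\<open>q t1\<close> has the desired W-part but also r w / 2 in Z, which is
      subtracted here.\<close>
    define t2 where "t2 = (z - r * w / 2) / r^2"
    have "\<bar>t1\<bar> \<le> r^2 / r" using w r by (simp add: t1_def divide_right_mono)
    then have t1: "\<bar>t1\<bar> \<le> 2 * r" using r by (simp add: power2_eq_square)
    have "\<bar>r * w\<bar> \<le> r * r^2" unfolding abs_mult using w r by (intro mult_mono) auto
    then have "\<bar>z - r * w / 2\<bar> \<le> 2 * r * r^2" using z r by (simp add: power3_eq_cube power2_eq_square)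
    then have t2: "\<bar>t2\<bar> \<le> 2 * r" using r by (simp add: t2_def pos_divide_le_eq)
    have "v *\<^sub>R b GenV + w *\<^sub>R b GenW + z *\<^sub>R b GenZ = (v *\<^sub>R b GenV) \<odot> (q t1) \<odot> (p t2)"
      using r by (intro coord_eqI, elim gens_cases)
        (simp_all add: q p coord_mul_W coord_mul_Z uvdet_def t1_def t2_def field_simps power2_eq_square)
    also have "\<dots> \<in> words S (K + 4 * K + 10 * K)"
      using M[of v] N v r by (intro words_mul qw pw t1 t2) auto
    finally have "word_length G S (v *\<^sub>R b GenV + w *\<^sub>R b GenW + z *\<^sub>R b GenZ) \<le> 15 * K"
      using word_length_le by (simp add: algebra_simps)
    then have "real (word_length G S (v *\<^sub>R b GenV + w *\<^sub>R b GenW + z *\<^sub>R b GenZ)) \<le> real (15 * K)"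
      by (rule of_nat_mono)
    also have "\<dots> = 15 * real M * real N" by (simp add: K_def)
    also have "\<dots> \<le> 15 * real M * (3 * r)" using N by (intro mult_left_mono) auto
    \<comment> \<open>The extra 1 makes the inequality strict, so that it contradicts a systole of
      at least C r, and keeps the constant positive when \<open>M\<close> is 0.\<close>
    also have "\<dots> < (45 * real M + 1) * r" using r by (simp add: algebra_simps)
    finally show ?thesis .
  qed
  then show ?thesis by (intro that[of "45 * real M + 1"]) auto
qed

end

lemma int_translate_eq_0:
  fixes p a :: real
  assumes "0 \<le> p" "p < a" "0 \<le> of_int k * a + p" "of_int k * a + p < a"
  shows "k = 0"
proof -
  have "a > 0" using assms by linarith
  have "of_int k * a < 1 * a" "- 1 * a < of_int k * a" using assms by linarith+
  then have "of_int k < (1::real)" "(- 1 :: real) < of_int k"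
    using \<open>a > 0\<close> by (simp_all only: mult_less_cancel_right_pos)
  then show ?thesis by linarith
qed

lemma floor_translate:
  fixes p a :: real
  assumes "a > 0"
  shows "0 \<le> of_int (- \<lfloor>p / a\<rfloor>) * a + p \<and> of_int (- \<lfloor>p / a\<rfloor>) * a + p < a"
  using floor_divide_lower[OF assms, of p] floor_divide_upper[OF assms, of p] by (simp add: algebra_simps)

text \<open>The factor 6 is even and its cube is divisible by 12, so the corrections by half the
  bracket and by a twelfth of the triple bracket are integral; the factor 2 for X absorbs the half
  in front of \<open>omega\<close>. The powers of \<open>\<rho>\<close> add up to 1 + 1 + 2 + 3 + n
  + 2n.\<close>

definition side :: "real \<Rightarrow> gen \<Rightarrow> real" where
  "side \<rho> s = (case s of GenU \<Rightarrow> 6 * \<rho> | GenV \<Rightarrow> 6 * \<rho> | GenW \<Rightarrow> \<rho>^2 | GenZ \<Rightarrow> \<rho>^3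
     | GenX _ \<Rightarrow> 2 * \<rho> | GenY _ \<Rightarrow> \<rho>^2)"

lemma side_simps[simp]: "side \<rho> GenU = 6 * \<rho>" "side \<rho> GenV = 6 * \<rho>" "side \<rho> GenW = \<rho>^2" "side \<rho> GenZ = \<rho>^3"
  "side \<rho> (GenX i) = 2 * \<rho>" "side \<rho> (GenY i) = \<rho>^2"
  by (simp_all add: side_def)

lemma side_pos: "\<rho> > 0 \<Longrightarrow> side \<rho> s > 0"
  by (cases s) auto

context filiform_heisenberg
begin

subsection \<open>An explicit family of lattices\<close>

definition std_lattice :: "real \<Rightarrow> 'g set" where
  "std_lattice \<rho> = {x. \<forall>s\<in>gens n. \<exists>k::int. coord s x = of_int k * side \<rho> s}"

lemma latE:
  assumes "x \<in> std_lattice \<rho>"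
  obtains k :: "gen \<Rightarrow> int" where "\<And>s. s \<in> gens n \<Longrightarrow> coord s x = of_int (k s) * side \<rho> s"
proof -
  have "\<forall>s\<in>gens n. \<exists>k::int. coord s x = of_int k * side \<rho> s" using assms by (simp add: std_lattice_def)
  from bchoice[OF this] show ?thesis using that by blast
qed

text \<open>The sides are chosen so that all the correction terms of the product, with their
  denominators 2 and 12, stay in the lattice.\<close>

lemma std_lattice_mul:
  assumes "x \<in> std_lattice \<rho>" "y \<in> std_lattice \<rho>"
  shows "x \<odot> y \<in> std_lattice \<rho>"
proof -
  obtain k l where k: "\<And>s. s \<in> gens n \<Longrightarrow> coord s x = of_int (k s) * side \<rho> s"
    and l: "\<And>s. s \<in> gens n \<Longrightarrow> coord s y = of_int (l s) * side \<rho> s"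
    using assms by (metis latE)
  define d where "d = k GenU * l GenV - k GenV * l GenU"
  define e where "e = (\<Sum>i=1..n. k (GenX i) * l (GenY i) - k (GenY i) * l (GenX i))"
  have uvdet: "uvdet x y = 36 * \<rho>^2 * of_int d"
    by (simp add: uvdet_def k l d_def algebra_simps power2_eq_square)
  have omega: "omega x y = 2 * \<rho>^3 * of_int e"
    by (simp add: omega_def k l e_def sum_distrib_left algebra_simps power2_eq_square power3_eq_cube)
  have "\<exists>m::int. coord s (x \<odot> y) = of_int m * side \<rho> s" if "s \<in> gens n" for s
    using that
  proof (cases rule: gens_cases)
    case W
    have "coord GenW (x \<odot> y) = of_int (k GenW + l GenW + 18 * d) * side \<rho> GenW"
      by (simp add: coord_mul_W uvdet k l algebra_simps)
    then show ?thesis using W by blast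
  next
    case Z
    have "coord GenZ (x \<odot> y) = of_int (k GenZ + l GenZ + 3 * (k GenU * l GenW - k GenW * l GenU) + e + 18 * (k GenU - l GenU) * d) * side \<rho> GenZ"
      by (simp add: coord_mul_Z uvdet omega k l field_simps power2_eq_square power3_eq_cube)
    then show ?thesis using Z by blast
  qed (use k l in \<open>auto intro!: exI[of _ "k s + l s"] simp: algebra_simps\<close>)
  then show ?thesis by (simp add: std_lattice_def)
qed

lemma std_lattice_minus: "x \<in> std_lattice \<rho> \<Longrightarrow> - x \<in> std_lattice \<rho>"
  unfolding std_lattice_def
proof (intro CollectI ballI)
  fix s assume "x \<in> {x. \<forall>s\<in>gens n. \<exists>k::int. coord s x = of_int k * side \<rho> s}" "s \<in> gens n"
  then obtain k :: int where "coord s x = of_int k * side \<rho> s" by blast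
  then show "\<exists>k::int. coord s (- x) = of_int k * side \<rho> s" by (intro exI[of _ "- k"]) simp
qed

lemma std_lattice_subgroup: "subgroup (std_lattice \<rho>) G"
proof
  show "one G \<in> std_lattice \<rho>" by (auto simp: std_lattice_def intro: exI[of _ 0])
qed (auto simp: std_lattice_mul std_lattice_minus)

text \<open>The coordinates of \<open>\<gamma>\<close> vanish in the order U, V, X, Y, then W, then
  Z. Once the earlier ones are 0, so is the correction to the next, which becomes a shift by a
  multiple of the side inside an interval of that length.\<close>

lemma std_lattice_trivial:
  assumes x: "x \<in> coord_box (side \<rho>)" and \<gamma>: "\<gamma> \<in> std_lattice \<rho>" and y: "\<gamma> \<odot> x \<in> coord_box (side \<rho>)"
  shows "\<gamma> = 0"
proof -
  obtain k where k: "\<And>s. s \<in> gens n \<Longrightarrow> coord s \<gamma> = of_int (k s) * side \<rho> s"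
    using latE[OF \<gamma>] by blast
  have z: "k s = 0" if "s \<in> gens n" "coord s (\<gamma> \<odot> x) = coord s \<gamma> + coord s x" for s
    using x y that k[OF that(1)] by (intro int_translate_eq_0[of "coord s x" "side \<rho> s"]) (auto simp: coord_box_def)
  have U: "coord GenU \<gamma> = 0" and V: "coord GenV \<gamma> = 0" using z[of GenU] z[of GenV] k by auto
  have XY: "i \<in> {1..n} \<Longrightarrow> coord (GenX i) \<gamma> = 0 \<and> coord (GenY i) \<gamma> = 0" for i
    using z[of "GenX i"] z[of "GenY i"] k by auto
  have W: "coord GenW \<gamma> = 0" using z[of GenW] k by (auto simp: coord_mul_W uvdet_def U V)
  have omega: "omega \<gamma> x = 0" using omega_eq_0[of \<gamma> x] XY by blast
  have Z: "coord GenZ \<gamma> = 0" using z[of GenZ] k by (auto simp: coord_mul_Z uvdet_def U V W omega)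
  show ?thesis by (rule coord_eqI, erule gens_cases) (auto simp: U V W Z XY)
qed

text \<open>Three passes along the same filtration. The second factor has only a W-coordinate and
  the third only a Z-coordinate, so coordinates already reduced are left alone.\<close>

lemma std_lattice_reduce:
  assumes \<rho>: "\<rho> > 0"
  shows "\<exists>\<gamma>\<in>std_lattice \<rho>. \<gamma> \<odot> x \<in> coord_box (side \<rho>)"
proof -
  define f where "f p s = of_int (- \<lfloor>p / side \<rho> s\<rfloor>) * side \<rho> s" for p s
  have f: "0 \<le> f p s + p \<and> f p s + p < side \<rho> s" for p s
    unfolding f_def by (rule floor_translate[OF side_pos[OF \<rho>]])
  have std_lattice: "(\<Sum>s\<in>gens n. f (c s) s *\<^sub>R b s) \<in> std_lattice \<rho>" for c
    unfolding std_lattice_def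
  proof (intro CollectI ballI)
    fix s assume "s \<in> gens n"
    then show "\<exists>k::int. coord s (\<Sum>s\<in>gens n. f (c s) s *\<^sub>R b s) = of_int k * side \<rho> s"
      unfolding coord_sum[OF \<open>s \<in> gens n\<close>] f_def by blast
  qed
  have f0: "f 0 s = 0" for s by (simp add: f_def)
  define \<gamma>1 where "\<gamma>1 = (\<Sum>s\<in>gens n. f (if s = GenW \<or> s = GenZ then 0 else coord s x) s *\<^sub>R b s)"
  define x1 where "x1 = \<gamma>1 \<odot> x"
  define \<gamma>2 where "\<gamma>2 = (\<Sum>s\<in>gens n. f (if s = GenW then coord GenW x1 else 0) s *\<^sub>R b s)"
  define x2 where "x2 = \<gamma>2 \<odot> x1"
  define \<gamma>3 where "\<gamma>3 = (\<Sum>s\<in>gens n. f (if s = GenZ then coord GenZ x2 else 0) s *\<^sub>R b s)"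
  define x3 where "x3 = \<gamma>3 \<odot> x2"
  have c1: "coord s \<gamma>1 = f (if s = GenW \<or> s = GenZ then 0 else coord s x) s"
    and c2: "coord s \<gamma>2 = f (if s = GenW then coord GenW x1 else 0) s"
    and c3: "coord s \<gamma>3 = f (if s = GenZ then coord GenZ x2 else 0) s" if "s \<in> gens n" for s
    unfolding \<gamma>1_def \<gamma>2_def \<gamma>3_def by (rule coord_sum[OF that])+
  have omega: "omega \<gamma>2 y = 0" "omega \<gamma>3 y = 0" for y
    using omega_eq_0[of \<gamma>2 y] omega_eq_0[of \<gamma>3 y] by (auto simp: c2 c3 f0)
  have "0 \<le> coord s x3 \<and> coord s x3 < side \<rho> s" if s: "s \<in> gens n" for s
    using s
  proof (cases rule: gens_cases)
    case W
    then show ?thesis using f[of "coord GenW x1" GenW]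
      by (simp add: x3_def x2_def coord_mul_W uvdet_def c2 c3 f0 del: side_simps)
  next
    case Z
    then show ?thesis using f[of "coord GenZ x2" GenZ]
      by (simp add: x3_def coord_mul_Z uvdet_def c3 f0 omega del: side_simps)
  qed (use f[of "coord s x" s] in \<open>simp_all add: x3_def x2_def x1_def c1 c2 c3 f0 del: side_simps\<close>)
  then have "x3 \<in> coord_box (side \<rho>)" by (simp add: coord_box_def)
  moreover have "\<gamma>3 \<odot> (\<gamma>2 \<odot> \<gamma>1) \<in> std_lattice \<rho>"
    unfolding \<gamma>1_def \<gamma>2_def \<gamma>3_def by (intro std_lattice_mul std_lattice)
  moreover have "x3 = \<gamma>3 \<odot> (\<gamma>2 \<odot> \<gamma>1) \<odot> x" by (simp add: x3_def x2_def x1_def mul_assoc)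
  ultimately show ?thesis by auto
qed

lemma std_lattice_fundamental_domain:
  assumes \<mu>: "left_haar_measure G euclidean \<mu>" and \<rho>: "\<rho> > 0"
  shows "fundamental_domain G \<mu> (std_lattice \<rho>) (coord_box (side \<rho>))"
  unfolding fundamental_domain_def
proof (intro conjI ballI)
  show "coord_box (side \<rho>) \<in> sets \<mu>" by (simp add: haar_sets[OF \<mu>])
  fix C assume "C \<in> RCOSETS G (std_lattice \<rho>)"
  then obtain x where C: "C = (\<lambda>\<gamma>. \<gamma> \<odot> x) ` std_lattice \<rho>" by (auto simp: RCOSETS_def r_coset_eq)
  show "\<exists>!y. y \<in> coord_box (side \<rho>) \<inter> C"
  proof (rule ex_ex1I)
    show "\<exists>y. y \<in> coord_box (side \<rho>) \<inter> C" using std_lattice_reduce[OF \<rho>, of x] C by auto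
    fix y y' assume "y \<in> coord_box (side \<rho>) \<inter> C" "y' \<in> coord_box (side \<rho>) \<inter> C"
    then obtain \<gamma> \<delta> where *: "\<gamma> \<in> std_lattice \<rho>" "\<delta> \<in> std_lattice \<rho>" "y = \<gamma> \<odot> x" "y' = \<delta> \<odot> x"
      "y \<in> coord_box (side \<rho>)" "y' \<in> coord_box (side \<rho>)" using C by blast
    have "y' = (\<delta> \<odot> (- \<gamma>)) \<odot> y" using * by (simp add: mul_assoc)
    moreover from this have "\<delta> \<odot> (- \<gamma>) = 0"
      using * by (intro std_lattice_trivial[of y \<rho>] std_lattice_mul std_lattice_minus) auto
    ultimately show "y = y'" by simp
  qed
qed

lemma std_lattice_discrete:
  assumes \<rho>: "\<rho> > 0"
  shows "subtopology euclidean (std_lattice \<rho>) = discrete_topology (std_lattice \<rho>)"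
proof -
  have "openin (subtopology euclidean (std_lattice \<rho>)) {x}" if x: "x \<in> std_lattice \<rho>" for x
  proof -
    define A where "A = {y. \<forall>s\<in>gens n. \<bar>coord s y - coord s x\<bar> < side \<rho> s}"
    have "open A"
      unfolding A_def Collect_ball_eq by (intro open_INT ballI open_Collect_less continuous_intros) auto
    moreover have "A \<inter> std_lattice \<rho> = {x}"
    proof (intro equalityI subsetI)
      fix y assume y: "y \<in> A \<inter> std_lattice \<rho>"
      obtain k l where k: "\<And>s. s \<in> gens n \<Longrightarrow> coord s x = of_int (k s) * side \<rho> s"
        and l: "\<And>s. s \<in> gens n \<Longrightarrow> coord s y = of_int (l s) * side \<rho> s"
        using x y by (metis latE IntD2)
      have "coord s y = coord s x" if s: "s \<in> gens n" for s
      proof -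
        have "\<bar>of_int (l s - k s) * side \<rho> s\<bar> < 1 * side \<rho> s"
          using y s by (simp add: A_def k l left_diff_distrib)
        then have "\<bar>of_int (l s - k s) :: real\<bar> < 1"
          using side_pos[OF \<rho>, of s] unfolding abs_mult by (simp only: mult_less_cancel_right_pos abs_of_pos)
        then have "l s = k s" by linarith
        then show ?thesis by (simp add: k l s)
      qed
      then show "y \<in> {x}" using coord_eqI by blast
    qed (use x side_pos[OF \<rho>] in \<open>auto simp: A_def\<close>)
    ultimately show ?thesis unfolding openin_subtopology by (intro exI[of _ A]) auto
  qed
  then have "discrete_topology (std_lattice \<rho>) = subtopology euclidean (std_lattice \<rho>)"
    unfolding discrete_topology_unique by simp
  then show ?thesis by simp
qed

lemma covolume_std_lattice:
  assumes \<mu>: "left_haar_measure G euclidean \<mu>" and \<rho>: "\<rho> > 0"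
  shows "covolume G \<mu> (std_lattice \<rho>) \<le> emeasure \<mu> (coord_box (side \<rho>))"
  unfolding covolume_def using std_lattice_fundamental_domain[OF assms] by (intro INF_lower) simp

lemma emeasure_coord_lebesgue_side:
  assumes "\<rho> > 0"
  shows "emeasure coord_lebesgue (coord_box (side \<rho>)) = ennreal (36 * 2 ^ n * \<rho> ^ (3 * n + 7))"
proof -
  have "(\<Prod>s\<in>gens n. side \<rho> s) = 36 * 2 ^ n * \<rho> ^ (3 * n + 7)"
    by (simp add: prod_gens power_mult_distrib power_add power_mult power2_eq_square eval_nat_numeral mult_ac)
  then show ?thesis
    using side_pos[OF assms] by (subst emeasure_coord_lebesgue_coord_box) (auto intro: less_imp_le)
qed

lemma std_lattice_cocompact_lattice:
  assumes \<mu>: "left_haar_measure G euclidean \<mu>" and \<rho>: "\<rho> > 0"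
  shows "cocompact_lattice G euclidean \<mu> (std_lattice \<rho>)"
  unfolding cocompact_lattice_def
proof (intro conjI std_lattice_subgroup std_lattice_discrete \<rho>)
  obtain c where "\<And>A. A \<in> sets borel \<Longrightarrow> emeasure \<mu> A = ennreal c * emeasure coord_lebesgue A"
    using haar_eq_coord_lebesgue[OF \<mu>] by blast
  then have "emeasure \<mu> (coord_box (side \<rho>)) < \<infinity>"
    by (simp add: emeasure_coord_lebesgue_side[OF \<rho>] ennreal_mult_less_top)
  then show "covolume G \<mu> (std_lattice \<rho>) < \<infinity>"
    using covolume_std_lattice[OF assms] by (rule order.strict_trans1[rotated])
  let ?K = "{x. \<forall>s\<in>gens n. 0 \<le> coord s x \<and> coord s x \<le> side \<rho> s}"
  have "set_mult G (std_lattice \<rho>) ?K = carrier G"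
  proof (intro equalityI subsetI)
    fix x :: 'g
    obtain \<gamma> where \<gamma>: "\<gamma> \<in> std_lattice \<rho>" "\<gamma> \<odot> x \<in> coord_box (side \<rho>)" using std_lattice_reduce[OF \<rho>] by blast
    then have "\<gamma> \<odot> x \<in> ?K" by (auto simp: coord_box_def)
    moreover have "x = (- \<gamma>) \<odot> (\<gamma> \<odot> x)" by simp
    ultimately show "x \<in> set_mult G (std_lattice \<rho>) ?K"
      unfolding set_mult_def G_simps using std_lattice_minus[OF \<gamma>(1)] by blast
  qed simp
  then show "\<exists>K. compactin euclidean K \<and> set_mult G (std_lattice \<rho>) K = carrier G"
    using compact_coord_box[of "\<lambda>_. 0" "side \<rho>"] by (intro exI[of _ ?K]) auto
qed

lemma systolic_growth_upper:
  assumes S: "compact S" and gen: "generate G S = UNIV" and \<mu>: "left_haar_measure G euclidean \<mu>"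
  obtains C where "C > 0" "\<And>r. r > 0 \<Longrightarrow> systolic_growth G euclidean S \<mu> r \<le> ennreal (C * r ^ (3 * n + 7))"
proof -
  obtain c where c: "c > 0" "\<And>A. A \<in> sets borel \<Longrightarrow> emeasure \<mu> A = ennreal c * emeasure coord_lebesgue A"
    using haar_eq_coord_lebesgue[OF \<mu>] by blast
  obtain M where M: "M \<ge> 1"
    and MU: "\<And>k x s. x \<in> words S k \<Longrightarrow> s \<in> gens n - {GenW, GenZ} \<Longrightarrow> \<bar>coord s x\<bar> \<le> M * real k"
    and MW: "\<And>k x. x \<in> words S k \<Longrightarrow> \<bar>coord GenW x\<bar> \<le> M * (real k)^2"
    and MZ: "\<And>k x. x \<in> words S k \<Longrightarrow> \<bar>coord GenZ x\<bar> \<le> M * (real k)^3"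
    using words_bound[OF S] by blast
  define C where "C = c * (36 * 2 ^ n * M ^ (3 * n + 7))"
  have "systolic_growth G euclidean S \<mu> r \<le> ennreal (C * r ^ (3 * n + 7))" if r: "r > 0" for r
  proof -
    \<comment> \<open>Since M >= 1, also M r^2 <= \<open>\<rho>^2\<close> and M r^3 <=
      \<open>\<rho>^3\<close>; hence an element of length below r has every coordinate smaller than
      the side.\<close>
    define \<rho> where "\<rho> = M * r"
    have \<rho>: "\<rho> > 0" using M r by (simp add: \<rho>_def)
    have "r \<le> real (word_length G S x)" if x: "x \<in> std_lattice \<rho>" "x \<noteq> 0" for x
    proof (rule ccontr)
      define k where "k = word_length G S x"
      assume "\<not> r \<le> real (word_length G S x)"
      then have kr: "real k < r" by (simp add: k_def)
      have xk: "x \<in> words S k" unfolding k_def by (rule words_word_length[OF gen])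
      obtain l where l: "\<And>s. s \<in> gens n \<Longrightarrow> coord s x = of_int (l s) * side \<rho> s"
        using latE[OF x(1)] by blast
      have "\<bar>coord s x\<bar> < side \<rho> s" if s: "s \<in> gens n" for s
      proof -
        have k1: "M * real k < \<rho>" using kr M by (simp add: \<rho>_def)
        have "M * real k ^ 2 < M * r ^ 2" "M * real k ^ 3 < M * r ^ 3"
          using kr M by (auto intro!: mult_strict_left_mono power_strict_mono)
        moreover have "M * r ^ 2 \<le> M ^ 2 * r ^ 2" "M * r ^ 3 \<le> M ^ 3 * r ^ 3"
          using M r power_increasing[of 1 2 M] power_increasing[of 1 3 M] by (auto intro!: mult_right_mono)
        ultimately have k2: "M * real k ^ 2 < \<rho> ^ 2" "M * real k ^ 3 < \<rho> ^ 3"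
          unfolding \<rho>_def power_mult_distrib by linarith+
        \<comment> \<open>Needed for Y, whose side is \<open>\<rho>^2\<close> although Y grows
          linearly: for small \<open>\<rho>\<close> this side is the shorter one, and integrality of
          the length saves the bound.\<close>
        have "real k \<le> real k ^ 2" by (simp add: power2_eq_square flip: of_nat_mult)
        then have "M * real k \<le> M * real k ^ 2" using M by (intro mult_left_mono) auto
        then have k2': "M * real k < \<rho> ^ 2" using k2(1) by linarith
        show ?thesis
          using s by (cases rule: gens_cases) (use MU[OF xk, of s] MW[OF xk] MZ[OF xk] s k1 k2 k2' \<rho> in auto)
      qed
      then have "coord s x = 0" if s: "s \<in> gens n" for s
      proof -
        have "\<bar>of_int (l s)\<bar> * side \<rho> s < 1 * side \<rho> s"
          using \<open>\<And>s. s \<in> gens n \<Longrightarrow> \<bar>coord s x\<bar> < side \<rho> s\<close>[OF s] side_pos[OF \<rho>, of s] by (simp add: l[OF s] abs_mult)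
        then have "\<bar>of_int (l s) :: real\<bar> < 1"
          using side_pos[OF \<rho>, of s] by (simp only: mult_less_cancel_right_pos)
        then have "l s = 0" by linarith
        then show ?thesis by (simp add: l s)
      qed
      then have "x = 0" by (intro coord_eqI) simp
      then show False using x by simp
    qed
    then have "ennreal r \<le> systole G S (std_lattice \<rho>)" by (simp only: systole_ge_iff) blast
    then have "systolic_growth G euclidean S \<mu> r \<le> covolume G \<mu> (std_lattice \<rho>)"
      unfolding systolic_growth_def using std_lattice_cocompact_lattice[OF \<mu> \<rho>] by (intro INF_lower) simp
    also have "\<dots> \<le> emeasure \<mu> (coord_box (side \<rho>))" by (rule covolume_std_lattice[OF \<mu> \<rho>])
    also have "\<dots> = ennreal c * ennreal (36 * 2 ^ n * \<rho> ^ (3 * n + 7))"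
      by (simp add: c(2) emeasure_coord_lebesgue_side[OF \<rho>])
    also have "\<dots> = ennreal (c * (36 * 2 ^ n * \<rho> ^ (3 * n + 7)))"
      using c(1) \<rho> by (intro ennreal_mult[symmetric]) auto
    also have "\<dots> = ennreal (C * r ^ (3 * n + 7))"
      by (simp add: C_def \<rho>_def power_mult_distrib mult.assoc)
    finally show ?thesis .
  qed
  moreover have "C > 0" using c(1) M by (simp add: C_def)
  ultimately show ?thesis using that by blast
qed


subsection \<open>Symplectic reduction\<close>

text \<open>\<open>perp k\<close> is spanned by the X_i, Y_i with i > k, the part not yet reduced.
  Maps in \<open>sympl k\<close> act on the whole Lie algebra but move only this part, so
  preservation of \<open>coord_lebesgue\<close> can take the place of a determinant
  condition.\<close>

definition fixed_gens :: "nat \<Rightarrow> gen set" where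
  "fixed_gens k = {GenU, GenV, GenW, GenZ} \<union> {s \<in> gens n. \<exists>i\<le>k. s = GenX i \<or> s = GenY i}"

definition perp :: "nat \<Rightarrow> 'g set" where
  "perp k = {x. \<forall>s\<in>fixed_gens k. coord s x = 0}"

definition sympl :: "nat \<Rightarrow> ('g \<Rightarrow> 'g) \<Rightarrow> bool" where
  "sympl k S \<longleftrightarrow> linear S \<and> inj S \<and> distr coord_lebesgue borel S = coord_lebesgue \<and> (\<forall>x y. omega (S x) (S y) = omega x y) \<and>
     (\<forall>s\<in>fixed_gens k. S (b s) = b s) \<and> (\<forall>s\<in>fixed_gens k. \<forall>x. coord s (S x) = coord s x)"

lemma fixed_gens_gens: "fixed_gens k \<subseteq> gens n"
  by (auto simp: fixed_gens_def)

lemma fixed_gens_mono: "j \<le> k \<Longrightarrow> fixed_gens j \<subseteq> fixed_gens k"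
  by (auto simp: fixed_gens_def)

lemma perp_antimono: "j \<le> k \<Longrightarrow> perp k \<subseteq> perp j"
  using fixed_gens_mono by (auto simp: perp_def)

lemma perpD: "x \<in> perp k \<Longrightarrow> s \<in> fixed_gens k \<Longrightarrow> coord s x = 0"
  by (simp add: perp_def)

lemma perp_add: "x \<in> perp k \<Longrightarrow> y \<in> perp k \<Longrightarrow> x + y \<in> perp k"
  and perp_diff: "x \<in> perp k \<Longrightarrow> y \<in> perp k \<Longrightarrow> x - y \<in> perp k"
  and perp_scale: "x \<in> perp k \<Longrightarrow> c *\<^sub>R x \<in> perp k"
  by (simp_all add: perp_def)

lemma perp_basis: "i \<in> {Suc k..n} \<Longrightarrow> b (GenX i) \<in> perp k" "i \<in> {Suc k..n} \<Longrightarrow> b (GenY i) \<in> perp k"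
  using fixed_gens_gens[of k] by (auto simp: perp_def coord_basis subset_iff fixed_gens_def)

lemma omega_basis: "i \<in> {1..n} \<Longrightarrow> omega (b (GenX i)) x = coord (GenY i) x" "i \<in> {1..n} \<Longrightarrow> omega (b (GenY i)) x = - coord (GenX i) x"
  "i \<in> {1..n} \<Longrightarrow> omega x (b (GenX i)) = - coord (GenY i) x" "i \<in> {1..n} \<Longrightarrow> omega x (b (GenY i)) = coord (GenX i) x"
  by (simp_all add: omega_def sum_negf if_distrib[of "\<lambda>z. z * _"] if_distrib[of "\<lambda>z. _ * z"] cong: if_cong)

lemma omega_fixed_gens_perp: "s \<in> fixed_gens k \<Longrightarrow> x \<in> perp k \<Longrightarrow> omega (b s) x = 0"
  by (auto simp: fixed_gens_def omega_basis perp_def)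

lemma perp_nondegenerate:
  assumes x: "x \<in> perp k" "x \<noteq> 0"
  shows "\<exists>z\<in>perp k. omega x z \<noteq> 0"
proof -
  obtain s where s: "s \<in> gens n" "coord s x \<noteq> 0" using coord_eqI[of x 0] x by auto
  then have "s \<notin> fixed_gens k" using x by (auto simp: perp_def)
  with s(1) show ?thesis
  proof (cases rule: gens_cases)
    case (X i)
    then have "i \<in> {Suc k..n}" using \<open>s \<notin> fixed_gens k\<close> s(1) by (auto simp: fixed_gens_def not_le Suc_le_eq)
    then show ?thesis using s X omega_basis(4)[of i x] perp_basis(2)[of i k] by (intro bexI[of _ "b (GenY i)"]) auto
  next
    case (Y i)
    then have "i \<in> {Suc k..n}" using \<open>s \<notin> fixed_gens k\<close> s(1) by (auto simp: fixed_gens_def not_le Suc_le_eq)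
    then show ?thesis using s Y omega_basis(3)[of i x] perp_basis(1)[of i k] by (intro bexI[of _ "b (GenX i)"]) auto
  qed (auto simp: fixed_gens_def)
qed

lemma symplD:
  assumes "sympl k S"
  shows "linear S" "inj S" "distr coord_lebesgue borel S = coord_lebesgue" "\<And>x y. omega (S x) (S y) = omega x y"
    "\<And>s. s \<in> fixed_gens k \<Longrightarrow> S (b s) = b s" "\<And>s x. s \<in> fixed_gens k \<Longrightarrow> coord s (S x) = coord s x"
  using assms by (auto simp: sympl_def)

lemma sympl_mono: "sympl k S \<Longrightarrow> j \<le> k \<Longrightarrow> sympl j S"
  using fixed_gens_mono[of j k] by (auto simp: sympl_def)

lemma sympl_id: "sympl k (\<lambda>x. x)"
proof -
  have "distr coord_lebesgue borel (\<lambda>x. x) = coord_lebesgue" by (rule distr_id2) simp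
  then show ?thesis by (simp add: sympl_def linear_id[unfolded id_def])
qed

lemma measurable_linear_map: "linear S \<Longrightarrow> S \<in> borel_measurable borel" for S :: "'g \<Rightarrow> 'g"
  by (intro borel_measurable_continuous_onI linear_continuous_on) (simp add: linear_conv_bounded_linear)

lemma sympl_comp:
  assumes S: "sympl k S" and T: "sympl k T"
  shows "sympl k (\<lambda>x. S (T x))"
proof -
  have "distr coord_lebesgue borel (\<lambda>x. S (T x)) = coord_lebesgue"
    by (rule distr_coord_lebesgue_comp[OF symplD(3)[OF S] symplD(3)[OF T]])
      (rule measurable_linear_map, rule symplD(1)[OF S], rule measurable_linear_map, rule symplD(1)[OF T])
  moreover have "inj (\<lambda>x. S (T x))"
    using inj_compose[OF symplD(2)[OF S] symplD(2)[OF T]] by (simp add: comp_def)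
  moreover have "linear (\<lambda>x. S (T x))"
    using linear_compose[OF symplD(1)[OF T] symplD(1)[OF S]] by (simp add: comp_def)
  ultimately show ?thesis
    using symplD(4-6)[OF S] symplD(4-6)[OF T] by (simp add: sympl_def)
qed

lemma sympl_perp: "sympl k S \<Longrightarrow> x \<in> perp k \<Longrightarrow> S x \<in> perp k"
  by (simp add: perp_def symplD(6))

text \<open>The coefficient \<open>a * omega x v\<close> is constant along \<open>v\<close>, so the
  transvection is a shear and preserves volume. In \<open>omega\<close> the two cross terms cancel
  by antisymmetry.\<close>

lemma sympl_transvection:
  assumes v: "v \<in> perp k"
  shows "sympl k (\<lambda>x. x + (a * omega x v) *\<^sub>R v)"
  unfolding sympl_def
proof (intro conjI allI ballI)
  show "linear (\<lambda>x. x + (a * omega x v) *\<^sub>R v)"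
    by (rule linearI) (simp_all add: algebra_simps)
  show "inj (\<lambda>x. x + (a * omega x v) *\<^sub>R v)"
  proof (rule injI)
    fix x y assume eq: "x + (a * omega x v) *\<^sub>R v = y + (a * omega y v) *\<^sub>R v"
    then have "omega (x + (a * omega x v) *\<^sub>R v) v = omega (y + (a * omega y v) *\<^sub>R v) v" by simp
    then have "omega x v = omega y v" by simp
    with eq show "x = y" by simp
  qed
  show "distr coord_lebesgue borel (\<lambda>x. x + (a * omega x v) *\<^sub>R v) = coord_lebesgue"
    by (rule distr_coord_lebesgue_shear) (measurable; simp)+
  show "omega (x + (a * omega x v) *\<^sub>R v) (y + (a * omega y v) *\<^sub>R v) = omega x y" for x y
    using omega_antisym[of v y] by (simp add: algebra_simps)
  show "b s + (a * omega (b s) v) *\<^sub>R v = b s" if "s \<in> fixed_gens k" for s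
    using omega_fixed_gens_perp[OF that v] by simp
  show "coord s (x + (a * omega x v) *\<^sub>R v) = coord s x" if "s \<in> fixed_gens k" for s x
    using perpD[OF v that] by simp
qed

text \<open>The transvection along \<open>y - x\<close>, scaled by the inverse of
  \<open>omega x y\<close>. Its fixing every \<open>z\<close> that pairs equally with
  \<open>x\<close> and \<open>y\<close> lets a second vector be corrected without disturbing a
  first.\<close>

lemma transvection_move:
  assumes "x \<in> perp k" "y \<in> perp k" "omega x y \<noteq> 0"
  shows "\<exists>S. sympl k S \<and> S x = y \<and> (\<forall>z. omega z x = omega z y \<longrightarrow> S z = z)"
proof -
  define S where "S z = z + (1 / omega x y * omega z (y - x)) *\<^sub>R (y - x)" for z
  have "sympl k S"
    unfolding S_def[abs_def] using assms by (intro sympl_transvection perp_diff)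
  moreover have "S x = y" using assms(3) by (simp add: S_def)
  moreover have "S z = z" if "omega z x = omega z y" for z using that by (simp add: S_def)
  ultimately show ?thesis by blast
qed

text \<open>As \<open>x\<close> and \<open>y\<close> may be orthogonal, the move passes through some
  \<open>z\<close> orthogonal to neither; one of two witnesses or their sum will do.\<close>

lemma sympl_transitive:
  assumes x: "x \<in> perp k" "x \<noteq> 0" and y: "y \<in> perp k" "y \<noteq> 0"
  shows "\<exists>S. sympl k S \<and> S x = y"
proof -
  obtain z1 where z1: "z1 \<in> perp k" "omega x z1 \<noteq> 0" using perp_nondegenerate[OF x] by blast
  obtain z2 where z2: "z2 \<in> perp k" "omega y z2 \<noteq> 0" using perp_nondegenerate[OF y] by blast
  have "\<exists>z\<in>perp k. omega x z \<noteq> 0 \<and> omega y z \<noteq> 0"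
  proof (cases "omega y z1 = 0 \<and> omega x z2 = 0")
    case True
    then show ?thesis using z1 z2 by (intro bexI[of _ "z1 + z2"] perp_add) auto
  next
    case False
    then show ?thesis using z1 z2 by blast
  qed
  then obtain z where z: "z \<in> perp k" "omega x z \<noteq> 0" "omega z y \<noteq> 0"
    using omega_antisym by (metis neg_equal_0_iff_equal)
  obtain S where S: "sympl k S" "S x = z" using transvection_move[OF x(1) z(1,2)] by blast
  obtain T where T: "sympl k T" "T z = y" using transvection_move[OF z(1) y(1) z(3)] by blast
  show ?thesis using sympl_comp[OF T(1) S(1)] S(2) T(2) by (intro exI[of _ "\<lambda>x. T (S x)"]) simp
qed

text \<open>Once \<open>e\<close> sits at X, only transvections fixing X are admissible. The image
  of \<open>f\<close> and the target Y both pair to 1 with X, so the direct move qualifies unless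
  they are orthogonal; then a detour through \<open>f1 + ?X\<close> keeps the pairing 1.\<close>

lemma sympl_hyperbolic_pair:
  assumes k: "k < n" and e: "e \<in> perp k" and f: "f \<in> perp k" and ef: "omega e f = 1"
  shows "\<exists>S. sympl k S \<and> S e = b (GenX (Suc k)) \<and> S f = b (GenY (Suc k))"
proof -
  let ?X = "b (GenX (Suc k))" and ?Y = "b (GenY (Suc k))"
  have XY: "?X \<in> perp k" "?Y \<in> perp k" using perp_basis[of "Suc k" k] k by auto
  have omXY: "omega ?X ?Y = 1" using omega_basis(1)[of "Suc k" ?Y] k by simp
  have "e \<noteq> 0" "?X \<noteq> 0" using ef omXY by auto
  then obtain S where S: "sympl k S" "S e = ?X" using sympl_transitive[OF e _ XY(1)] by blast
  define f1 where "f1 = S f"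
  have f1: "f1 \<in> perp k" unfolding f1_def by (rule sympl_perp[OF S(1) f])
  have Xf1: "omega ?X f1 = 1" using symplD(4)[OF S(1), of e f] S(2) ef by (simp add: f1_def)
  have "\<exists>T. sympl k T \<and> T ?X = ?X \<and> T f1 = ?Y"
  proof (cases "omega f1 ?Y = 0")
    case False
    then obtain T where "sympl k T" "T f1 = ?Y" "\<forall>z. omega z f1 = omega z ?Y \<longrightarrow> T z = z"
      using transvection_move[OF f1 XY(2)] by blast
    then show ?thesis using Xf1 omXY by auto
  next
    case True
    define g where "g = f1 + ?X"
    have g: "g \<in> perp k" using f1 XY by (simp add: g_def perp_add)
    have 1: "omega f1 g \<noteq> 0" using Xf1 omega_antisym[of f1 ?X] by (simp add: g_def)
    have 2: "omega g ?Y \<noteq> 0" using True omXY by (simp add: g_def)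
    have Xg: "omega ?X g = 1" using Xf1 by (simp add: g_def)
    obtain T1 where T1: "sympl k T1" "T1 f1 = g" "\<forall>z. omega z f1 = omega z g \<longrightarrow> T1 z = z"
      using transvection_move[OF f1 g 1] by blast
    obtain T2 where T2: "sympl k T2" "T2 g = ?Y" "\<forall>z. omega z g = omega z ?Y \<longrightarrow> T2 z = z"
      using transvection_move[OF g XY(2) 2] by blast
    have "T1 ?X = ?X" "T2 ?X = ?X" using T1(3) T2(3) Xf1 Xg omXY by simp_all
    then show ?thesis using sympl_comp[OF T2(1) T1(1)] T1(2) T2(2)
      by (intro exI[of _ "\<lambda>x. T2 (T1 x)"]) simp
  qed
  then obtain T where T: "sympl k T" "T ?X = ?X" "T f1 = ?Y" by blast
  show ?thesis using sympl_comp[OF T(1) S(1)] S(2) T(2,3)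
    by (intro exI[of _ "\<lambda>x. T (S x)"]) (simp add: f1_def)
qed

text \<open>The last clause encodes full rank: a subgroup inside a proper subspace of
  \<open>perp 0\<close> would be orthogonal to some nonzero vector. Together with integrality it
  forces discreteness.\<close>

definition sympl_lattice :: "real \<Rightarrow> 'g set \<Rightarrow> bool" where
  "sympl_lattice \<zeta> \<Lambda> \<longleftrightarrow> \<Lambda> \<subseteq> perp 0 \<and> 0 \<in> \<Lambda> \<and> (\<forall>x\<in>\<Lambda>. \<forall>y\<in>\<Lambda>. x + y \<in> \<Lambda>) \<and> (\<forall>x\<in>\<Lambda>. - x \<in> \<Lambda>) \<and>
     (\<forall>x\<in>\<Lambda>. \<forall>y\<in>\<Lambda>. \<exists>m::int. omega x y = of_int m * \<zeta>) \<and>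
     (\<forall>x\<in>perp 0. x \<noteq> 0 \<longrightarrow> (\<exists>y\<in>\<Lambda>. omega x y \<noteq> 0))"

text \<open>The first k planes split off with lattice basis X_i, d_i Y_i. Of the elementary divisors
  only the lower bound \<open>\<zeta>\<close> is recorded, not the divisibility chain.\<close>

definition adapted :: "real \<Rightarrow> nat \<Rightarrow> (nat \<Rightarrow> real) \<Rightarrow> 'g set \<Rightarrow> bool" where
  "adapted \<zeta> k d \<Lambda> \<longleftrightarrow> (\<forall>i\<in>{1..k}. \<zeta> \<le> d i \<and> b (GenX i) \<in> \<Lambda> \<and> d i *\<^sub>R b (GenY i) \<in> \<Lambda> \<and>
     (\<forall>x\<in>\<Lambda>. (\<exists>m::int. coord (GenX i) x = of_int m) \<and> (\<exists>m::int. coord (GenY i) x = of_int m * d i)))"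

lemma sympl_lattice_image:
  assumes \<Lambda>: "sympl_lattice \<zeta> \<Lambda>" and S: "sympl 0 S"
  shows "sympl_lattice \<zeta> (S ` \<Lambda>)"
  unfolding sympl_lattice_def
proof (intro conjI ballI impI)
  note lin = symplD(1)[OF S]
  show "S ` \<Lambda> \<subseteq> perp 0" using \<Lambda> sympl_perp[OF S] by (auto simp: sympl_lattice_def)
  show "0 \<in> S ` \<Lambda>" using \<Lambda> by (intro image_eqI[of _ _ 0]) (simp_all add: sympl_lattice_def linear_0[OF lin])
  show "x + y \<in> S ` \<Lambda>" if xy: "x \<in> S ` \<Lambda>" "y \<in> S ` \<Lambda>" for x y
  proof -
    obtain x' y' where "x' \<in> \<Lambda>" "y' \<in> \<Lambda>" "x = S x'" "y = S y'" using xy by blast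
    then show ?thesis
      using \<Lambda> by (intro image_eqI[of _ _ "x' + y'"]) (simp_all add: sympl_lattice_def linear_add[OF lin])
  qed
  show "- x \<in> S ` \<Lambda>" if "x \<in> S ` \<Lambda>" for x
  proof -
    obtain x' where "x' \<in> \<Lambda>" "x = S x'" using \<open>x \<in> S ` \<Lambda>\<close> by blast
    then show ?thesis
      using \<Lambda> by (intro image_eqI[of _ _ "- x'"]) (simp_all add: sympl_lattice_def linear_neg[OF lin])
  qed
  show "\<exists>m::int. omega x y = of_int m * \<zeta>" if xy: "x \<in> S ` \<Lambda>" "y \<in> S ` \<Lambda>" for x y
    using xy \<Lambda> by (auto simp: sympl_lattice_def symplD(4)[OF S])
  show "\<exists>y\<in>S ` \<Lambda>. omega x y \<noteq> 0" if x: "x \<in> perp 0" "x \<noteq> 0" for x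
  proof -
    have "surj S" using linear_injective_imp_surjective[OF lin symplD(2)[OF S] refl] .
    then obtain x' where x': "x = S x'" by (meson surjE)
    have "x' \<in> perp 0" using x(1) by (simp add: perp_def x' symplD(6)[OF S])
    moreover have "x' \<noteq> 0" using x(2) x' linear_0[OF lin] by auto
    ultimately obtain y where "y \<in> \<Lambda>" "omega x' y \<noteq> 0" using \<Lambda> by (auto simp: sympl_lattice_def)
    then show ?thesis by (auto simp: x' symplD(4)[OF S])
  qed
qed

lemma sympl_lattice_int_multiple:
  assumes \<Lambda>: "sympl_lattice \<zeta> \<Lambda>" and x: "x \<in> \<Lambda>"
  shows "of_int m *\<^sub>R x \<in> \<Lambda>"
proof -
  have nat: "real j *\<^sub>R x \<in> \<Lambda>" for j
  proof (induction j)
    case 0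
    show ?case using \<Lambda> by (simp add: sympl_lattice_def)
  next
    case (Suc j)
    then show ?case using \<Lambda> x by (simp add: sympl_lattice_def scaleR_left_distrib)
  qed
  show ?thesis
  proof (cases "m \<ge> 0")
    case True
    then show ?thesis using nat[of "nat m"] by simp
  next
    case False
    then have "of_int m *\<^sub>R x = - (real (nat (- m)) *\<^sub>R x)" by simp
    then show ?thesis using nat[of "nat (- m)"] \<Lambda> unfolding sympl_lattice_def by metis
  qed
qed

lemma sympl_lattice_sum:
  assumes \<Lambda>: "sympl_lattice \<zeta> \<Lambda>" and "finite I" "\<And>i. i \<in> I \<Longrightarrow> f i \<in> \<Lambda>"
  shows "sum f I \<in> \<Lambda>"
proof -
  have 0: "0 \<in> \<Lambda>" and add: "\<And>x y. x \<in> \<Lambda> \<Longrightarrow> y \<in> \<Lambda> \<Longrightarrow> x + y \<in> \<Lambda>"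
    using \<Lambda> unfolding sympl_lattice_def by blast+
  from assms(2,3) show ?thesis
  proof (induction I rule: finite_induct)
    case empty
    show ?case using 0 by simp
  next
    case (insert i I)
    then show ?case using add[of "f i" "sum f I"] by simp
  qed
qed

text \<open>The component of \<open>x\<close> in the first k planes is an integer combination of
  lattice vectors and can be subtracted. Pairings with \<open>perp k\<close> can therefore be tested
  on the lattice inside \<open>perp k\<close>.\<close>

lemma adapted_split:
  assumes \<Lambda>: "sympl_lattice \<zeta> \<Lambda>" and ad: "adapted \<zeta> k d \<Lambda>" and k: "k \<le> n" and x: "x \<in> \<Lambda>"
  shows "\<exists>x'\<in>\<Lambda> \<inter> perp k. \<forall>y\<in>perp k. omega x y = omega x' y"
proof -
  define p where "p = (\<Sum>i=1..k. coord (GenX i) x *\<^sub>R b (GenX i) + coord (GenY i) x *\<^sub>R b (GenY i))"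
  have "p \<in> \<Lambda>" unfolding p_def
  proof (rule sympl_lattice_sum[OF \<Lambda>])
    fix i assume i: "i \<in> {1..k}"
    obtain m l :: int where ml: "coord (GenX i) x = of_int m" "coord (GenY i) x = of_int l * d i"
      using bspec[OF ad[unfolded adapted_def] i] x by blast
    have "of_int m *\<^sub>R b (GenX i) \<in> \<Lambda>" "of_int l *\<^sub>R (d i *\<^sub>R b (GenY i)) \<in> \<Lambda>"
      using bspec[OF ad[unfolded adapted_def] i] sympl_lattice_int_multiple[OF \<Lambda>] by blast+
    then show "coord (GenX i) x *\<^sub>R b (GenX i) + coord (GenY i) x *\<^sub>R b (GenY i) \<in> \<Lambda>"
      using \<Lambda> by (simp add: ml sympl_lattice_def)
  qed simp
  then have "x + - p \<in> \<Lambda>" using \<Lambda> x by (auto simp: sympl_lattice_def simp del: add_uminus_conv_diff)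
  then have 1: "x - p \<in> \<Lambda>" by simp
  have coX: "coord (GenX j) p = coord (GenX j) x" "coord (GenY j) p = coord (GenY j) x" if j: "j \<in> {1..k}" for j
  proof -
    have "coord (GenX j) p = (\<Sum>i=1..k. if i = j then coord (GenX i) x else 0)"
      unfolding p_def coord_linear by (rule sum.cong) (use j k in auto)
    then show "coord (GenX j) p = coord (GenX j) x" using j by simp
    have "coord (GenY j) p = (\<Sum>i=1..k. if i = j then coord (GenY i) x else 0)"
      unfolding p_def coord_linear by (rule sum.cong) (use j k in auto)
    then show "coord (GenY j) p = coord (GenY j) x" using j by simp
  qed
  have x0: "coord s x = 0" if "s \<in> {GenU, GenV, GenW, GenZ}" for s
    using \<Lambda> x that by (auto simp: sympl_lattice_def perp_def fixed_gens_def)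
  have p0: "coord s p = 0" if "s \<in> {GenU, GenV, GenW, GenZ}" for s
    unfolding p_def coord_linear by (rule sum.neutral) (use that k in auto)
  have "x - p \<in> perp k" unfolding perp_def
  proof (intro CollectI ballI)
    fix s assume "s \<in> fixed_gens k"
    then show "coord s (x - p) = 0"
      using coX x0 p0 by (auto simp: fixed_gens_def)
  qed
  moreover have "omega x y = omega (x - p) y" if y: "y \<in> perp k" for y
  proof -
    have "omega p y = (\<Sum>i=1..k. omega (coord (GenX i) x *\<^sub>R b (GenX i) + coord (GenY i) x *\<^sub>R b (GenY i)) y)"
      unfolding p_def by (rule linear_sum[OF linearI]) (simp_all)
    also have "\<dots> = 0"
      using omega_fixed_gens_perp[OF _ y] k by (intro sum.neutral) (auto simp: fixed_gens_def)
    finally show ?thesis by simp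
  qed
  ultimately show ?thesis using 1 by blast
qed

text \<open>The elementary divisor step: take \<open>e\<close>, \<open>f\<close> in the unreduced
  part whose pairing is the least positive value \<open>\<delta>\<close> that occurs. All pairings
  with \<open>e\<close> or \<open>f\<close> are then multiples of \<open>\<delta>\<close>, so their
  plane splits off integrally, and a symplectic map sends \<open>e\<close> and
  \<open>f / \<delta>\<close> to the next standard pair.\<close>

lemma adapted_step:
  assumes \<Lambda>: "sympl_lattice \<zeta> \<Lambda>" and \<zeta>: "\<zeta> > 0" and ad: "adapted \<zeta> k d \<Lambda>" and k: "k < n"
  shows "\<exists>R d'. sympl k R \<and> adapted \<zeta> (Suc k) d' (R ` \<Lambda>)"
proof -
  note split = adapted_split[OF \<Lambda> ad less_imp_le[OF k]]
  let ?L = "\<Lambda> \<inter> perp k"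
  have perp0: "perp k \<subseteq> perp 0" by (rule perp_antimono) simp
  have nondeg: "\<And>x. x \<in> perp 0 \<Longrightarrow> x \<noteq> 0 \<Longrightarrow> \<exists>y\<in>\<Lambda>. omega x y \<noteq> 0"
    and int: "\<And>x y. x \<in> \<Lambda> \<Longrightarrow> y \<in> \<Lambda> \<Longrightarrow> \<exists>m::int. omega x y = of_int m * \<zeta>"
    and add: "\<And>x y. x \<in> \<Lambda> \<Longrightarrow> y \<in> \<Lambda> \<Longrightarrow> x + y \<in> \<Lambda>"
    using \<Lambda> by (auto simp: sympl_lattice_def)
  have pair: "\<exists>y\<in>?L. omega x y \<noteq> 0" if x: "x \<in> perp k" "x \<noteq> 0" for x
  proof -
    obtain y where y: "y \<in> \<Lambda>" "omega x y \<noteq> 0" using nondeg x perp0 by blast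
    obtain y' where "y' \<in> ?L" "omega y x = omega y' x" using split[OF y(1)] x(1) by blast
    moreover from this have "omega x y' \<noteq> 0" using y(2) omega_antisym[of x y] omega_antisym[of x y'] by simp
    ultimately show ?thesis by blast
  qed
  let ?X = "b (GenX (Suc k))" and ?Y = "b (GenY (Suc k))"
  have "?X \<in> perp k" using perp_basis(1)[of "Suc k" k] k by simp
  moreover have "?X \<noteq> 0" using omega_basis(1)[of "Suc k" ?Y] k by auto
  ultimately obtain e0 where e0: "e0 \<in> ?L" "omega ?X e0 \<noteq> 0" using pair by blast
  then have "e0 \<noteq> 0" by auto
  then obtain f0 where f0: "f0 \<in> ?L" "omega e0 f0 \<noteq> 0" using pair[of e0] e0(1) by blast
  define P where "P m \<longleftrightarrow> 0 < m \<and> (\<exists>x\<in>?L. \<exists>y\<in>?L. omega x y = real m * \<zeta>)" for m :: nat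
  obtain m0 :: int where m0: "omega e0 f0 = of_int m0 * \<zeta>" using int e0 f0 by blast
  have "\<exists>m. P m"
  proof (cases "m0 > 0")
    case True
    then show ?thesis using e0 f0 m0 by (intro exI[of _ "nat m0"]) (auto simp: P_def)
  next
    case False
    have "m0 \<noteq> 0" using m0 f0 by auto
    then have "omega f0 e0 = real (nat (- m0)) * \<zeta>" "0 < nat (- m0)"
      using False m0 omega_antisym[of f0 e0] by simp_all
    then show ?thesis using e0(1) f0(1) unfolding P_def by blast
  qed
  define m where "m = (LEAST m. P m)"
  have Pm: "P m" unfolding m_def by (rule LeastI_ex) fact
  have least: "m \<le> j" if "P j" for j unfolding m_def using that by (rule Least_le)
  obtain e f where ef: "e \<in> ?L" "f \<in> ?L" "omega e f = real m * \<zeta>" and m: "m > 0" using Pm by (auto simp: P_def)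
  define \<delta> where "\<delta> = real m * \<zeta>"
  have \<delta>: "\<delta> > 0" "\<zeta> \<le> \<delta>" using m \<zeta> by (simp_all add: \<delta>_def)
  have L_mult: "x - of_int q *\<^sub>R y \<in> ?L" if "x \<in> ?L" "y \<in> ?L" for x y q
  proof -
    have "x + of_int (- q) *\<^sub>R y \<in> \<Lambda>" using that by (intro add sympl_lattice_int_multiple[OF \<Lambda>]) auto
    then show ?thesis using that by (auto intro: perp_diff perp_scale)
  qed
  have no_small: False if "x \<in> ?L" "y \<in> ?L" "omega x y = of_int (q mod int m) * \<zeta>" "q mod int m \<noteq> 0" for x y q
  proof -
    have q: "0 < q mod int m" "q mod int m < int m" 
      using pos_mod_sign[of "int m" q] pos_mod_bound[of "int m" q] that(4) m by linarith+
    then have "omega x y = real (nat (q mod int m)) * \<zeta>" "0 < nat (q mod int m)" using that(3) by simp_all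
    then have "P (nat (q mod int m))" using that(1,2) unfolding P_def by blast
    then have "m \<le> nat (q mod int m)" by (rule least)
    then show False using q by linarith
  qed
  \<comment> \<open>Euclidean division: subtracting the quotient times \<open>f\<close> (or
    \<open>e\<close>) leaves the remainder as pairing, which minimality of \<open>m\<close> excludes
    unless it is 0.\<close>
  have multiple: "\<exists>j::int. omega e x = of_int j * \<delta>" "\<exists>j::int. omega x f = of_int j * \<delta>" if x: "x \<in> ?L" for x
  proof -
    obtain q where q: "omega e x = of_int q * \<zeta>" using int ef x by blast
    have "omega e (x - of_int (q div int m) *\<^sub>R f) = of_int (q mod int m) * \<zeta>"
      by (simp add: q ef(3) minus_div_mult_eq_mod[symmetric] algebra_simps)
    then have "q mod int m = 0" using no_small ef x L_mult by metis
    then have "q = (q div int m) * int m" by (metis minus_mod_eq_div_mult diff_zero)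
    then have "omega e x = of_int (q div int m) * \<delta>" using q by (metis \<delta>_def mult.assoc of_int_mult of_int_of_nat_eq)
    then show "\<exists>j::int. omega e x = of_int j * \<delta>" by blast
    obtain q where q: "omega x f = of_int q * \<zeta>" using int ef x by blast
    have "omega (x - of_int (q div int m) *\<^sub>R e) f = of_int (q mod int m) * \<zeta>"
      by (simp add: q ef(3) minus_div_mult_eq_mod[symmetric] algebra_simps)
    then have "q mod int m = 0" using no_small ef x L_mult by metis
    then have "q = (q div int m) * int m" by (metis minus_mod_eq_div_mult diff_zero)
    then have "omega x f = of_int (q div int m) * \<delta>" using q by (metis \<delta>_def mult.assoc of_int_mult of_int_of_nat_eq)
    then show "\<exists>j::int. omega x f = of_int j * \<delta>" by blast
  qed
  \<comment> \<open>Splitting extends this from \<open>perp k\<close> to all of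
    \<open>\<Lambda>\<close>, since \<open>adapted\<close> restricts the coordinates of every
    lattice vector.\<close>
  have multiple': "\<exists>j::int. omega e x = of_int j * \<delta>" "\<exists>j::int. omega x f = of_int j * \<delta>" if x: "x \<in> \<Lambda>" for x
  proof -
    obtain x' where x': "x' \<in> ?L" "\<And>y. y \<in> perp k \<Longrightarrow> omega x y = omega x' y" using split[OF x] by blast
    have "omega x f = omega x' f" "omega x e = omega x' e" using x'(2) ef by auto
    moreover from this have "omega e x = omega e x'" using omega_antisym[of e x] omega_antisym[of e x'] by simp
    ultimately show "\<exists>j::int. omega e x = of_int j * \<delta>" "\<exists>j::int. omega x f = of_int j * \<delta>"
      using multiple[OF x'(1)] by simp_all
  qed
  have "omega e ((1 / \<delta>) *\<^sub>R f) = 1" using \<delta>(1) by (simp add: ef(3)[folded \<delta>_def])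
  then obtain R where R: "sympl k R" "R e = ?X" "R ((1 / \<delta>) *\<^sub>R f) = ?Y"
    using sympl_hyperbolic_pair[OF k, of e "(1 / \<delta>) *\<^sub>R f"] ef perp_scale by blast
  note linR = symplD(1)[OF R(1)]
  have Rf: "R f = \<delta> *\<^sub>R ?Y"
    using R(3) \<delta>(1) by (simp add: linear_cmul[OF linR] flip: R(3))
  have "adapted \<zeta> (Suc k) (d(Suc k := \<delta>)) (R ` \<Lambda>)"
    unfolding adapted_def
  proof
    fix i assume i: "i \<in> {1..Suc k}"
    show "\<zeta> \<le> (d(Suc k := \<delta>)) i \<and> b (GenX i) \<in> R ` \<Lambda> \<and> (d(Suc k := \<delta>)) i *\<^sub>R b (GenY i) \<in> R ` \<Lambda> \<and>
      (\<forall>x\<in>R ` \<Lambda>. (\<exists>m::int. coord (GenX i) x = of_int m) \<and> (\<exists>m::int. coord (GenY i) x = of_int m * (d(Suc k := \<delta>)) i))"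
    proof (cases "i = Suc k")
      case True
      \<comment> \<open>The new coordinates of \<open>R x\<close> are pairings of \<open>x\<close>:
        X comes from \<open>f / \<delta>\<close> and is an integer, Y comes from \<open>e\<close>
        and is a multiple of \<open>\<delta>\<close>.\<close>
      have "coord (GenX (Suc k)) (R x) = omega x f / \<delta>" for x
        using omega_basis(4)[of "Suc k" "R x"] k R(3) symplD(4)[OF R(1), of x "(1 / \<delta>) *\<^sub>R f"] by simp
      then have "\<exists>m::int. coord (GenX (Suc k)) (R x) = of_int m" if "x \<in> \<Lambda>" for x
        using multiple'(2)[OF that] \<delta>(1) by auto
      moreover have "coord (GenY (Suc k)) (R x) = omega e x" for x
        using omega_basis(1)[of "Suc k" "R x"] k R(2) symplD(4)[OF R(1), of e x] by simp
      ultimately show ?thesis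
        using True \<delta>(2) multiple'(1) ef(1,2) R(2) Rf by (auto intro: image_eqI[of _ _ e] image_eqI[of _ _ f])
    next
      case False
      then have i': "i \<in> {1..k}" using i by auto
      then have fx: "GenX i \<in> fixed_gens k" "GenY i \<in> fixed_gens k" using k by (auto simp: fixed_gens_def)
      have "R (d i *\<^sub>R b (GenY i)) = d i *\<^sub>R b (GenY i)" "R (b (GenX i)) = b (GenX i)"
        using symplD(5)[OF R(1)] fx by (simp_all add: linear_cmul[OF linR])
      then have "b (GenX i) \<in> R ` \<Lambda>" "d i *\<^sub>R b (GenY i) \<in> R ` \<Lambda>"
        using ad i' unfolding adapted_def by (metis image_eqI)+
      then show ?thesis using False ad i' fx by (auto simp: adapted_def symplD(6)[OF R(1)])
    qed
  qed
  then show ?thesis using R(1) by blast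
qed

text \<open>The bound \<open>\<zeta> \<le> d i\<close> is where the excess \<open>n\<close> over the homogeneous dimension comes from.\<close>

lemma symplectic_reduction:
  assumes \<Lambda>: "sympl_lattice \<zeta> \<Lambda>" and \<zeta>: "\<zeta> > 0"
  obtains S d where "sympl 0 S" "\<And>i. i \<in> {1..n} \<Longrightarrow> \<zeta> \<le> d i"
    "\<And>i x. i \<in> {1..n} \<Longrightarrow> x \<in> \<Lambda> \<Longrightarrow> \<exists>m::int. coord (GenX i) (S x) = of_int m"
    "\<And>i x. i \<in> {1..n} \<Longrightarrow> x \<in> \<Lambda> \<Longrightarrow> \<exists>m::int. coord (GenY i) (S x) = of_int m * d i"
proof -
  have "\<exists>S d. sympl 0 S \<and> adapted \<zeta> k d (S ` \<Lambda>)" if "k \<le> n" for k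
    using that
  proof (induction k)
    case 0
    show ?case using sympl_id[of 0] by (intro exI[of _ "\<lambda>x. x"] exI[of _ "\<lambda>_. 0"]) (simp add: adapted_def)
  next
    case (Suc k)
    then obtain S d where S: "sympl 0 S" "adapted \<zeta> k d (S ` \<Lambda>)" by auto
    obtain R d' where R: "sympl k R" "adapted \<zeta> (Suc k) d' (R ` (S ` \<Lambda>))"
      using adapted_step[OF sympl_lattice_image[OF \<Lambda> S(1)] \<zeta> S(2)] Suc.prems by auto
    have "sympl 0 (\<lambda>x. R (S x))" using sympl_comp[OF sympl_mono[OF R(1)] S(1)] by simp
    then show ?case using R(2) by (intro exI[of _ "\<lambda>x. R (S x)"] exI[of _ d']) (simp add: image_image)
  qed
  from this[of n] obtain S d where "sympl 0 S" "adapted \<zeta> n d (S ` \<Lambda>)" by auto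
  then show ?thesis by (intro that[of S d]) (auto simp: adapted_def)
qed


subsection \<open>Structure of cocompact subgroups\<close>

text \<open>Only elements of the abelian ideal spanned by V, W, Z are tested. The three bounds are
  separate parameters because two kinds of spacing occur: r, r^2, r^3 from the systole, and those
  produced by commutators from the spacing of the centre.\<close>

definition gap :: "'g set \<Rightarrow> real \<Rightarrow> real \<Rightarrow> real \<Rightarrow> bool" where
  "gap \<Gamma> p q r \<longleftrightarrow> (\<forall>v w z. v *\<^sub>R b GenV + w *\<^sub>R b GenW + z *\<^sub>R b GenZ \<in> \<Gamma> \<longrightarrow> \<bar>v\<bar> < p \<longrightarrow> \<bar>w\<bar> < q \<longrightarrow> \<bar>z\<bar> < r \<longrightarrow>
     v = 0 \<and> w = 0 \<and> z = 0)"

text \<open>The linear projection to the symplectic space is also a homomorphism from the group to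
  the additive group, so it maps subgroups to additive subgroups.\<close>

definition XY :: "'g \<Rightarrow> 'g" where
  "XY x = (\<Sum>i=1..n. coord (GenX i) x *\<^sub>R b (GenX i) + coord (GenY i) x *\<^sub>R b (GenY i))"

lemma XY_expand: "x = coord GenU x *\<^sub>R b GenU + coord GenV x *\<^sub>R b GenV + coord GenW x *\<^sub>R b GenW + coord GenZ x *\<^sub>R b GenZ + XY x"
proof -
  have "x = (\<Sum>s\<in>gens n. coord s x *\<^sub>R b s)" by (simp only: expand)
  then show ?thesis unfolding sum_gens XY_def by (simp only: sum.distrib add.assoc)
qed

lemma coord_XY: "i \<in> {1..n} \<Longrightarrow> coord (GenX i) (XY x) = coord (GenX i) x" "i \<in> {1..n} \<Longrightarrow> coord (GenY i) (XY x) = coord (GenY i) x"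
proof -
  assume i: "i \<in> {1..n}"
  show "coord (GenX i) (XY x) = coord (GenX i) x"
    using arg_cong[OF XY_expand[of x], of "coord (GenX i)"] i by simp
  show "coord (GenY i) (XY x) = coord (GenY i) x"
    using arg_cong[OF XY_expand[of x], of "coord (GenY i)"] i by simp
qed

lemma XY_perp: "XY x \<in> perp 0"
proof -
  have "coord s (XY x) = 0" if "s \<in> {GenU, GenV, GenW, GenZ}" for s
    unfolding XY_def coord_linear by (rule sum.neutral) (use that in auto)
  then show ?thesis by (auto simp: perp_def fixed_gens_def)
qed

lemma XY_minus: "XY (- x) = - XY x" and XY_mul: "XY (x \<odot> y) = XY x + XY y"
  by (simp_all add: XY_def scaleR_left_distrib sum.distrib sum_subtractf sum_negf)

lemma omega_XY: "omega (XY x) (XY y) = omega x y"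
  unfolding omega_def by (rule sum.cong) (simp_all only: coord_XY)

lemma XY_eq_0: "XY x = 0 \<Longrightarrow> i \<in> {1..n} \<Longrightarrow> coord (GenX i) x = 0 \<and> coord (GenY i) x = 0"
  using coord_XY[of i x] by simp

lemma commut_H: "coord GenU x = 0 \<Longrightarrow> coord GenU y = 0 \<Longrightarrow> commut x y = omega x y *\<^sub>R b GenZ"
  by (simp add: commut_eq uvdet_def)

lemma commut_WZ:
  assumes "\<And>s. s \<in> gens n - {GenW, GenZ} \<Longrightarrow> coord s y = 0"
  shows "commut x y = (coord GenU x * coord GenW y) *\<^sub>R b GenZ"
proof -
  have "omega x y = 0" using omega_eq_0[of y x] assms by simp
  then show ?thesis using assms[of GenU] assms[of GenV] by (simp add: commut_eq uvdet_def)
qed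

text \<open>Such a homomorphism is bounded, by cocompactness.\<close>

lemma hom_vanish:
  assumes K: "compact K" and cover: "\<And>x. \<exists>\<gamma>\<in>\<Gamma>. \<exists>k\<in>K. x = \<gamma> \<odot> k"
    and lin: "linear m" and hom: "\<And>x y. m (x \<odot> y) = m x + m y" and van: "\<And>\<gamma>. \<gamma> \<in> \<Gamma> \<Longrightarrow> m \<gamma> = 0"
  shows "m x = (0::real)"
proof (rule ccontr)
  assume nz: "m x \<noteq> 0"
  have "continuous_on K m" using lin by (simp add: linear_continuous_on linear_conv_bounded_linear)
  then have "bounded (m ` K)" using K compact_continuous_image compact_imp_bounded by blast
  then obtain B where B: "\<And>k. k \<in> K \<Longrightarrow> \<bar>m k\<bar> \<le> B" by (auto simp: bounded_iff)
  have bd: "\<bar>m y\<bar> \<le> B" for y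
  proof -
    obtain \<gamma> k where "\<gamma> \<in> \<Gamma>" "k \<in> K" "y = \<gamma> \<odot> k" using cover by blast
    then show ?thesis using B hom van by simp
  qed
  have "B \<ge> 0" using bd[of 0] by linarith
  have "m (((B + 1) / m x) *\<^sub>R x) = B + 1" using nz by (simp add: linear_cmul[OF lin])
  then show False using bd[of "((B + 1) / m x) *\<^sub>R x"] by linarith
qed

context
  fixes \<Gamma> K :: "'g set"
  assumes zero_\<Gamma>: "0 \<in> \<Gamma>" and mul_\<Gamma>: "\<And>x y. x \<in> \<Gamma> \<Longrightarrow> y \<in> \<Gamma> \<Longrightarrow> x \<odot> y \<in> \<Gamma>" and minus_\<Gamma>: "\<And>x. x \<in> \<Gamma> \<Longrightarrow> - x \<in> \<Gamma>"
    and K: "compact K" and cover: "\<And>x. \<exists>\<gamma>\<in>\<Gamma>. \<exists>k\<in>K. x = \<gamma> \<odot> k"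
begin

lemma commut_\<Gamma>: "x \<in> \<Gamma> \<Longrightarrow> y \<in> \<Gamma> \<Longrightarrow> commut x y \<in> \<Gamma>"
  by (simp add: commut_def mul_\<Gamma> minus_\<Gamma>)

lemma multiple_\<Gamma>:
  assumes x: "x \<in> \<Gamma>"
  shows "of_int k *\<^sub>R x \<in> \<Gamma>"
proof -
  have nat: "real j *\<^sub>R x \<in> \<Gamma>" for j
  proof (induction j)
    case 0
    show ?case using zero_\<Gamma> by simp
  next
    case (Suc j)
    then have "(1 *\<^sub>R x) \<odot> (real j *\<^sub>R x) \<in> \<Gamma>" using mul_\<Gamma>[OF x] by simp
    then show ?case unfolding mul_collinear by simp
  qed
  show ?thesis
  proof (cases "k \<ge> 0")
    case True
    then show ?thesis using nat[of "nat k"] by simp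
  next
    case False
    then show ?thesis using minus_\<Gamma>[OF nat[of "nat (- k)"]] by simp
  qed
qed

text \<open>\<open>hom_vanish\<close> is used twice, for the U-coordinate and then for
  \<open>uvdet \<gamma>\<close>; the commutator of the two elements found has W-coordinate
  \<open>uvdet \<gamma> \<gamma>'\<close>.\<close>

lemma lattice_WZ_element:
  obtains \<delta> where "\<delta> \<in> \<Gamma>" "\<And>s. s \<in> gens n - {GenW, GenZ} \<Longrightarrow> coord s \<delta> = 0" "coord GenW \<delta> \<noteq> 0"
    "\<exists>\<gamma>\<in>\<Gamma>. coord GenU \<gamma> \<noteq> 0"
proof -
  have "\<exists>\<gamma>\<in>\<Gamma>. coord GenU \<gamma> \<noteq> 0"
    using hom_vanish[OF K cover linear_coord[of GenU], of "b GenU"] by fastforce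
  then obtain \<gamma> where \<gamma>: "\<gamma> \<in> \<Gamma>" "coord GenU \<gamma> \<noteq> 0" by blast
  have lin: "linear (uvdet \<gamma>)"
    by (rule linearI) (simp_all add: uvdet_def algebra_simps)
  have "\<exists>\<gamma>'\<in>\<Gamma>. uvdet \<gamma> \<gamma>' \<noteq> 0"
  proof (rule ccontr)
    assume "\<not> (\<exists>\<gamma>'\<in>\<Gamma>. uvdet \<gamma> \<gamma>' \<noteq> 0)"
    then have van: "uvdet \<gamma> \<gamma>' = 0" if "\<gamma>' \<in> \<Gamma>" for \<gamma>' using that by blast
    have "uvdet \<gamma> (b GenV) = 0"
      by (rule hom_vanish[OF K cover lin _ van]) (simp_all add: uvdet_def algebra_simps)
    then show False using \<gamma> by (simp add: uvdet_def)
  qed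
  then obtain \<gamma>' where \<gamma>': "\<gamma>' \<in> \<Gamma>" "uvdet \<gamma> \<gamma>' \<noteq> 0" by blast
  show ?thesis
  proof (rule that[of "commut \<gamma> \<gamma>'"])
    show "commut \<gamma> \<gamma>' \<in> \<Gamma>" by (rule commut_\<Gamma>[OF \<gamma>(1) \<gamma>'(1)])
    show "coord s (commut \<gamma> \<gamma>') = 0" if "s \<in> gens n - {GenW, GenZ}" for s
    proof -
      have "s \<in> gens n" using that by simp
      then show ?thesis using that by (cases rule: gens_cases) simp_all
    qed
  qed (use \<gamma> \<gamma>' in auto)
qed

text \<open>Commutators with \<open>\<delta>\<close> show that the centre meets
  \<open>\<Gamma>\<close> nontrivially, and the gap makes this intersection discrete. Discreteness
  then passes to the U-image: each of its values times the W-coordinate of \<open>\<delta>\<close>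
  is a multiple of \<open>\<zeta>\<close>.\<close>

lemma lattice_generators:
  assumes gap: "gap \<Gamma> r (r^2) (r^3)" and r: "r > 0"
  obtains \<zeta> \<gamma>0 where "r^3 \<le> \<zeta>" "\<And>z. z *\<^sub>R b GenZ \<in> \<Gamma> \<Longrightarrow> \<exists>k::int. z = of_int k * \<zeta>"
    "\<gamma>0 \<in> \<Gamma>" "coord GenU \<gamma>0 > 0" "\<And>\<gamma>. \<gamma> \<in> \<Gamma> \<Longrightarrow> \<exists>k::int. coord GenU \<gamma> = of_int k * coord GenU \<gamma>0"
proof -
  obtain \<delta> \<gamma> where \<delta>: "\<delta> \<in> \<Gamma>" "\<And>s. s \<in> gens n - {GenW, GenZ} \<Longrightarrow> coord s \<delta> = 0" "coord GenW \<delta> \<noteq> 0"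
    and \<gamma>: "\<gamma> \<in> \<Gamma>" "coord GenU \<gamma> \<noteq> 0"
    using lattice_WZ_element by metis
  have cz: "(coord GenU x * coord GenW \<delta>) *\<^sub>R b GenZ \<in> \<Gamma>" if "x \<in> \<Gamma>" for x
    using commut_\<Gamma>[OF that \<delta>(1)] commut_WZ[OF \<delta>(2), of x] by simp
  define A where "A = {z. z *\<^sub>R b GenZ \<in> \<Gamma>}"
  have A_gap: "r^3 \<le> \<bar>z\<bar>" if "z \<in> A" "z \<noteq> 0" for z
  proof (rule ccontr)
    assume "\<not> r^3 \<le> \<bar>z\<bar>"
    then show False using gap[unfolded gap_def, rule_format, of 0 0 z] that r by (auto simp: A_def)
  qed
  obtain \<zeta> where \<zeta>: "\<zeta> \<in> A" "\<zeta> > 0" "\<And>z. z \<in> A \<Longrightarrow> \<exists>k::int. z = of_int k * \<zeta>"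
  proof (rule real_subgroup_generator[of A "r^3" "coord GenU \<gamma> * coord GenW \<delta>"])
    show "x + y \<in> A" if "x \<in> A" "y \<in> A" for x y
      using mul_\<Gamma>[of "x *\<^sub>R b GenZ" "y *\<^sub>R b GenZ"] that by (simp add: A_def mul_collinear)
    show "- x \<in> A" if "x \<in> A" for x
      using minus_\<Gamma>[of "x *\<^sub>R b GenZ"] that by (simp add: A_def)
    show "coord GenU \<gamma> * coord GenW \<delta> \<in> A" using cz[OF \<gamma>(1)] by (simp add: A_def)
  qed (use A_gap r \<gamma> \<delta> in auto)
  have "\<exists>\<gamma>0\<in>\<Gamma>. coord GenU \<gamma>0 > 0 \<and> (\<forall>\<gamma>\<in>\<Gamma>. \<exists>k::int. coord GenU \<gamma> = of_int k * coord GenU \<gamma>0)"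
  proof (rule real_subgroup_generator[of "coord GenU ` \<Gamma>" "\<zeta> / \<bar>coord GenW \<delta>\<bar>" "coord GenU \<gamma>"])
    show "x + y \<in> coord GenU ` \<Gamma>" if xy: "x \<in> coord GenU ` \<Gamma>" "y \<in> coord GenU ` \<Gamma>" for x y
    proof -
      obtain x' y' where "x' \<in> \<Gamma>" "y' \<in> \<Gamma>" "x = coord GenU x'" "y = coord GenU y'" using xy by blast
      then show ?thesis by (intro image_eqI[of _ _ "x' \<odot> y'"]) (simp_all add: mul_\<Gamma>)
    qed
    show "- x \<in> coord GenU ` \<Gamma>" if x: "x \<in> coord GenU ` \<Gamma>" for x
    proof -
      obtain x' where "x' \<in> \<Gamma>" "x = coord GenU x'" using x by blast
      then show ?thesis by (intro image_eqI[of _ _ "- x'"]) (simp_all add: minus_\<Gamma>)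
    qed
    show "0 < \<zeta> / \<bar>coord GenW \<delta>\<bar>" using \<zeta> \<delta> by simp
    show "\<zeta> / \<bar>coord GenW \<delta>\<bar> \<le> \<bar>x\<bar>" if x: "x \<in> coord GenU ` \<Gamma>" "x \<noteq> 0" for x
    proof -
      obtain k :: int where k: "x * coord GenW \<delta> = of_int k * \<zeta>" using \<zeta>(3) cz x by (auto simp: A_def)
      then have "k \<noteq> 0" using x \<delta>(3) by auto
      then have "1 * \<zeta> \<le> \<bar>of_int k\<bar> * \<zeta>" using \<zeta>(2) by (intro mult_right_mono) auto
      also have "\<dots> = \<bar>x\<bar> * \<bar>coord GenW \<delta>\<bar>" using k \<zeta>(2) by (simp add: abs_mult[symmetric]) (simp add: abs_mult)
      finally show ?thesis using \<delta>(3) by (simp add: pos_divide_le_eq)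
    qed
    show "coord GenU \<gamma> \<in> coord GenU ` \<Gamma>" using \<gamma> by simp
    show "coord GenU \<gamma> \<noteq> 0" by (rule \<gamma>)
    fix a0 assume "a0 \<in> coord GenU ` \<Gamma>" "0 < a0" "\<And>x. x \<in> coord GenU ` \<Gamma> \<Longrightarrow> \<exists>k::int. x = of_int k * a0"
    then show "\<exists>\<gamma>0\<in>\<Gamma>. coord GenU \<gamma>0 > 0 \<and> (\<forall>\<gamma>\<in>\<Gamma>. \<exists>k::int. coord GenU \<gamma> = of_int k * coord GenU \<gamma>0)" by blast
  qed
  then obtain \<gamma>0 where "\<gamma>0 \<in> \<Gamma>" "coord GenU \<gamma>0 > 0" "\<And>\<gamma>. \<gamma> \<in> \<Gamma> \<Longrightarrow> \<exists>k::int. coord GenU \<gamma> = of_int k * coord GenU \<gamma>0"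
    by blast
  moreover have "r^3 \<le> \<zeta>" using A_gap[OF \<zeta>(1)] \<zeta>(2) by simp
  ultimately show ?thesis using that[of \<zeta> \<gamma>0] \<zeta>(3) by (simp add: A_def)
qed

text \<open>Commutators of elements with u = 0 are \<open>omega x y *\<^sub>R b GenZ\<close>, whence
  integrality. Full rank is where cocompactness acts: a functional \<open>omega x\<close> vanishing
  on these elements extends to one vanishing on \<open>\<Gamma>\<close>.\<close>

lemma lattice_sympl_lattice:
  assumes \<zeta>: "\<And>z. z *\<^sub>R b GenZ \<in> \<Gamma> \<Longrightarrow> \<exists>k::int. z = of_int k * \<zeta>"
    and \<gamma>0: "\<gamma>0 \<in> \<Gamma>" "coord GenU \<gamma>0 > 0" and U: "\<And>\<gamma>. \<gamma> \<in> \<Gamma> \<Longrightarrow> \<exists>k::int. coord GenU \<gamma> = of_int k * coord GenU \<gamma>0"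
  shows "sympl_lattice \<zeta> (XY ` {\<gamma> \<in> \<Gamma>. coord GenU \<gamma> = 0})"
  unfolding sympl_lattice_def
proof (intro conjI ballI impI)
  let ?H = "{\<gamma> \<in> \<Gamma>. coord GenU \<gamma> = 0}"
  show "XY ` ?H \<subseteq> perp 0" using XY_perp by blast
  show "0 \<in> XY ` ?H" by (intro image_eqI[of _ _ 0]) (simp_all add: zero_\<Gamma> XY_def)
  show "x + y \<in> XY ` ?H" if xy: "x \<in> XY ` ?H" "y \<in> XY ` ?H" for x y
  proof -
    obtain x' y' where "x' \<in> ?H" "y' \<in> ?H" "x = XY x'" "y = XY y'" using xy by blast
    then show ?thesis by (intro image_eqI[of _ _ "x' \<odot> y'"]) (simp_all add: XY_mul mul_\<Gamma>)
  qed
  show "- x \<in> XY ` ?H" if x: "x \<in> XY ` ?H" for x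
  proof -
    obtain x' where "x' \<in> ?H" "x = XY x'" using x by blast
    then show ?thesis by (intro image_eqI[of _ _ "- x'"]) (simp_all add: XY_minus minus_\<Gamma>)
  qed
  show "\<exists>m::int. omega x y = of_int m * \<zeta>" if xy: "x \<in> XY ` ?H" "y \<in> XY ` ?H" for x y
  proof -
    obtain x' y' where *: "x' \<in> ?H" "y' \<in> ?H" "x = XY x'" "y = XY y'" using xy by blast
    then have "omega x' y' *\<^sub>R b GenZ \<in> \<Gamma>" using commut_\<Gamma>[of x' y'] commut_H[of x' y'] by simp
    then show ?thesis using \<zeta> * omega_XY by simp
  qed
  show "\<exists>y\<in>XY ` ?H. omega x y \<noteq> 0" if x: "x \<in> perp 0" "x \<noteq> 0" for x
  proof (rule ccontr)
    assume contra: "\<not> (\<exists>y\<in>XY ` ?H. omega x y \<noteq> 0)"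
    have omega_x_XY: "omega x (XY y) = omega x y" for y
      unfolding omega_def by (rule sum.cong) (simp_all only: coord_XY)
    have van: "omega x \<gamma> = 0" if "\<gamma> \<in> \<Gamma>" "coord GenU \<gamma> = 0" for \<gamma>
      using contra that omega_x_XY[of \<gamma>] by auto
    \<comment> \<open>This \<open>a\<close> makes \<open>m\<close> vanish at
      \<open>\<gamma>0\<close>. Every element of \<open>\<Gamma>\<close> is a power of
      \<open>\<gamma>0\<close> times one with u = 0, so \<open>m\<close> vanishes on
      \<open>\<Gamma>\<close>.\<close>
    define a where "a = omega x \<gamma>0 / coord GenU \<gamma>0"
    define m where "m y = omega x y - a * coord GenU y" for y
    have "m y = 0" for y
    proof (rule hom_vanish[OF K cover])
      show "linear m" by (rule linearI) (simp_all add: m_def algebra_simps)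
      show "m (y \<odot> y') = m y + m y'" for y y' by (simp add: m_def algebra_simps)
      fix \<gamma> assume \<gamma>: "\<gamma> \<in> \<Gamma>"
      obtain k :: int where k: "coord GenU \<gamma> = of_int k * coord GenU \<gamma>0" using U[OF \<gamma>] by blast
      have "(of_int (- k) *\<^sub>R \<gamma>0) \<odot> \<gamma> \<in> \<Gamma>" by (intro mul_\<Gamma> multiple_\<Gamma> \<gamma>0 \<gamma>)
      then have "omega x ((of_int (- k) *\<^sub>R \<gamma>0) \<odot> \<gamma>) = 0" using k by (intro van) simp_all
      then have "omega x \<gamma> = of_int k * omega x \<gamma>0" by simp
      then show "m \<gamma> = 0" using \<gamma>0(2) by (simp add: m_def a_def k)
    qed
    moreover obtain z where z: "z \<in> perp 0" "omega x z \<noteq> 0" using perp_nondegenerate[OF x] by blast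
    moreover have "coord GenU z = 0" using perpD[OF z(1), of GenU] by (simp add: fixed_gens_def)
    ultimately show False using z(2) by (simp add: m_def)
  qed
qed

subsection \<open>Packing\<close>

text \<open>Coordinates of the second kind: if \<open>g = h * exp (u U)\<close> with \<open>h\<close> in the ideal \<open>U = 0\<close>, then
  \<open>second_kind g = h + u U\<close>. In these coordinates the left action of that ideal has no \<open>u\<close> in it.\<close>

definition second_kind :: "'g \<Rightarrow> 'g" where
  "second_kind g = g \<odot> (- coord GenU g *\<^sub>R b GenU) + coord GenU g *\<^sub>R b GenU"

lemma distr_coord_lebesgue_second_kind: "distr coord_lebesgue borel second_kind = coord_lebesgue"
proof -
  have "second_kind = (\<lambda>x. x + 0 + (coord GenU x * coord GenV x / 2) *\<^sub>R b GenW
      + (coord GenU x * coord GenW x / 2 + (coord GenU x)^2 * coord GenV x / 6) *\<^sub>R b GenZ)"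
    by (rule ext, rule coord_eqI, erule gens_cases)
      (simp_all add: second_kind_def coord_mul_W coord_mul_Z uvdet_def power2_eq_square field_simps)
  then show ?thesis by (simp only:) (rule distr_coord_lebesgue_triangular; (measurable | simp))
qed

lemma measurable_second_kind[measurable]: "second_kind \<in> borel_measurable borel"
  unfolding second_kind_def[abs_def] by (intro borel_measurable_continuous_onI continuous_intros)

text \<open>Left multiplication by \<open>\<gamma>\<close> does not touch the right factor in
  direction U, and inside the ideal u = 0 the only bracket is \<open>omega\<close>; besides the
  translation only its half remains, in Z.\<close>

lemma second_kind_mul_H:
  assumes "coord GenU \<gamma> = 0"
  shows "second_kind (\<gamma> \<odot> g) = second_kind g + \<gamma> + (omega \<gamma> g / 2) *\<^sub>R b GenZ"
  by (rule coord_eqI, erule gens_cases)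
    (simp_all add: second_kind_def assms coord_mul_W coord_mul_Z uvdet_def field_simps)

text \<open>\<open>B\<close> is the preimage of a coordinate box under a measure-preserving map,
  second-kind coordinates followed by symplectic reduction. The sides are the U-spacing, the three
  gap bounds, and 1 and d_i for X_i and Y_i.\<close>

lemma packing_box:
  assumes \<zeta>: "\<zeta> > 0" and Z: "\<And>z. z *\<^sub>R b GenZ \<in> \<Gamma> \<Longrightarrow> \<exists>k::int. z = of_int k * \<zeta>"
    and \<gamma>0: "\<gamma>0 \<in> \<Gamma>" "coord GenU \<gamma>0 > 0" and U: "\<And>\<gamma>. \<gamma> \<in> \<Gamma> \<Longrightarrow> \<exists>k::int. coord GenU \<gamma> = of_int k * coord GenU \<gamma>0"
    and gap: "gap \<Gamma> qv qw qz" and q: "qv > 0" "qw > 0" "qz > 0"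
  shows "\<exists>B\<in>sets borel. (\<forall>\<gamma>\<in>\<Gamma>. \<forall>x\<in>B. \<gamma> \<odot> x \<in> B \<longrightarrow> \<gamma> = 0) \<and>
    ennreal (coord GenU \<gamma>0 * qv * qw * qz * \<zeta> ^ n) \<le> emeasure coord_lebesgue B"
proof -
  define \<Lambda> where "\<Lambda> = XY ` {\<gamma> \<in> \<Gamma>. coord GenU \<gamma> = 0}"
  have \<Lambda>: "sympl_lattice \<zeta> \<Lambda>" unfolding \<Lambda>_def by (rule lattice_sympl_lattice[OF Z \<gamma>0 U])
  obtain S d where S: "sympl 0 S" and d: "\<And>i. i \<in> {1..n} \<Longrightarrow> \<zeta> \<le> d i"
    and SX: "\<And>i x. i \<in> {1..n} \<Longrightarrow> x \<in> \<Lambda> \<Longrightarrow> \<exists>m::int. coord (GenX i) (S x) = of_int m"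
    and SY: "\<And>i x. i \<in> {1..n} \<Longrightarrow> x \<in> \<Lambda> \<Longrightarrow> \<exists>m::int. coord (GenY i) (S x) = of_int m * d i"
    using symplectic_reduction[OF \<Lambda> \<zeta>] by blast
  note lin = symplD(1)[OF S]
  have fix0: "GenU \<in> fixed_gens 0" "GenV \<in> fixed_gens 0" "GenW \<in> fixed_gens 0" "GenZ \<in> fixed_gens 0" by (auto simp: fixed_gens_def)
  note Sfix = symplD(5)[OF S fix0(1)] symplD(5)[OF S fix0(2)] symplD(5)[OF S fix0(3)] symplD(5)[OF S fix0(4)]
  note Sco = symplD(6)[OF S fix0(1)] symplD(6)[OF S fix0(2)] symplD(6)[OF S fix0(3)] symplD(6)[OF S fix0(4)]
  define a where "a s = (case s of GenU \<Rightarrow> coord GenU \<gamma>0 | GenV \<Rightarrow> qv | GenW \<Rightarrow> qw | GenZ \<Rightarrow> qz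
    | GenX _ \<Rightarrow> 1 | GenY i \<Rightarrow> d i)" for s
  have a: "a GenU = coord GenU \<gamma>0" "a GenV = qv" "a GenW = qw" "a GenZ = qz" "a (GenX i) = 1" "a (GenY i) = d i" for i
    by (simp_all add: a_def)
  define f where "f g = S (second_kind g)" for g
  have fm[measurable]: "f \<in> borel_measurable borel"
    unfolding f_def[abs_def] using measurable_compose[OF measurable_second_kind measurable_linear_map[OF lin]] by simp
  have fd: "distr coord_lebesgue borel f = coord_lebesgue"
    unfolding f_def[abs_def]
    by (rule distr_coord_lebesgue_comp[OF symplD(3)[OF S] distr_coord_lebesgue_second_kind measurable_linear_map[OF lin] measurable_second_kind])
  define B where "B = f -` coord_box a"
  have B_sets: "B \<in> sets borel" using measurable_sets[OF fm coord_box_sets] by (simp add: B_def)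
  have dpos: "0 \<le> d i" if "i \<in> {1..n}" for i using d[OF that] \<zeta> by linarith
  have "emeasure coord_lebesgue B = emeasure (distr coord_lebesgue borel f) (coord_box a)"
    by (simp add: B_def emeasure_distr)
  also have "\<dots> = ennreal (\<Prod>s\<in>gens n. a s)"
    unfolding fd using \<gamma>0 q dpos by (intro emeasure_coord_lebesgue_coord_box) (auto elim!: gens_cases simp: a)
  also have "(\<Prod>s\<in>gens n. a s) = coord GenU \<gamma>0 * qv * qw * qz * (\<Prod>i=1..n. d i)"
    by (simp add: prod_gens a)
  finally have vol: "emeasure coord_lebesgue B = ennreal (coord GenU \<gamma>0 * qv * qw * qz * (\<Prod>i=1..n. d i))" .
  have "(\<Prod>i=1..n. \<zeta>) \<le> (\<Prod>i=1..n. d i)"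
    using d \<zeta> by (intro prod_mono) auto
  then have "coord GenU \<gamma>0 * qv * qw * qz * \<zeta> ^ n \<le> coord GenU \<gamma>0 * qv * qw * qz * (\<Prod>i=1..n. d i)"
    using \<gamma>0 q by (intro mult_left_mono) auto
  then have vol': "ennreal (coord GenU \<gamma>0 * qv * qw * qz * \<zeta> ^ n) \<le> emeasure coord_lebesgue B"
    unfolding vol by (rule ennreal_leI)
  have "\<gamma> = 0" if \<gamma>: "\<gamma> \<in> \<Gamma>" and x: "x \<in> B" and y: "\<gamma> \<odot> x \<in> B" for \<gamma> x
  proof -
    have box: "0 \<le> coord s (f x) \<and> coord s (f x) < a s" "0 \<le> coord s (f (\<gamma> \<odot> x)) \<and> coord s (f (\<gamma> \<odot> x)) < a s"
      if "s \<in> gens n" for s using x y that by (auto simp: B_def coord_box_def)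
    have U_second_kind: "coord GenU (second_kind g) = coord GenU g" for g by (simp add: second_kind_def)
    \<comment> \<open>The order matters: U first, to land in the ideal that acts nearly by
      translations; then X and Y; only then does the twist in Z disappear, so that the gap condition
      applies to V, W, Z.\<close>
    obtain k :: int where k: "coord GenU \<gamma> = of_int k * coord GenU \<gamma>0" using U[OF \<gamma>] by blast
    have "coord GenU (f (\<gamma> \<odot> x)) = of_int k * coord GenU \<gamma>0 + coord GenU (f x)"
      by (simp add: f_def Sco U_second_kind k)
    then have "k = 0"
      using box[of GenU] by (intro int_translate_eq_0[of "coord GenU (f x)" "coord GenU \<gamma>0" k]) (auto simp: a)
    then have U0: "coord GenU \<gamma> = 0" using k by simp
    define t where "t = omega \<gamma> x / 2"
    have fy: "f (\<gamma> \<odot> x) = f x + S \<gamma> + t *\<^sub>R b GenZ"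
      unfolding f_def second_kind_mul_H[OF U0]
      by (simp add: linear_add[OF lin] linear_cmul[OF lin] Sfix t_def)
    have S\<gamma>: "S \<gamma> = coord GenV \<gamma> *\<^sub>R b GenV + coord GenW \<gamma> *\<^sub>R b GenW + coord GenZ \<gamma> *\<^sub>R b GenZ + S (XY \<gamma>)"
      by (subst XY_expand) (simp add: linear_add[OF lin] linear_cmul[OF lin] Sfix U0)
    have mem: "XY \<gamma> \<in> \<Lambda>" using \<gamma> U0 by (auto simp: \<Lambda>_def)
    have "coord s (S (XY \<gamma>)) = 0" if s: "s \<in> gens n" for s
      using s
    proof (cases rule: gens_cases)
      case (X i)
      obtain m :: int where m: "coord (GenX i) (S (XY \<gamma>)) = of_int m" using SX[OF X(2) mem] by blast
      have "coord (GenX i) (f (\<gamma> \<odot> x)) = of_int m * 1 + coord (GenX i) (f x)"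
        using X(2) by (simp add: fy S\<gamma> m)
      then have "m = 0"
        using box[of "GenX i"] X(2) by (intro int_translate_eq_0[of "coord (GenX i) (f x)" 1 m]) (auto simp: a)
      then show ?thesis using X m by simp
    next
      case (Y i)
      obtain m :: int where m: "coord (GenY i) (S (XY \<gamma>)) = of_int m * d i" using SY[OF Y(2) mem] by blast
      have "coord (GenY i) (f (\<gamma> \<odot> x)) = of_int m * d i + coord (GenY i) (f x)"
        using Y(2) by (simp add: fy S\<gamma> m)
      then have "m = 0"
        using box[of "GenY i"] Y(2) by (intro int_translate_eq_0[of "coord (GenY i) (f x)" "d i" m]) (auto simp: a)
      then show ?thesis using Y m by simp
    qed (use perpD[OF sympl_perp[OF S XY_perp]] fix0 in auto)
    then have S0: "S (XY \<gamma>) = 0" by (intro coord_eqI) simp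
    then have XY0: "XY \<gamma> = 0" using symplD(2)[OF S] linear_0[OF lin] by (metis injD)
    then have "omega \<gamma> x = 0" using omega_eq_0[of \<gamma> x] XY_eq_0 by blast
    then have fy': "f (\<gamma> \<odot> x) = f x + S \<gamma>" using fy by (simp add: t_def)
    have \<gamma>_eq: "\<gamma> = coord GenV \<gamma> *\<^sub>R b GenV + coord GenW \<gamma> *\<^sub>R b GenW + coord GenZ \<gamma> *\<^sub>R b GenZ"
      using XY_expand[of \<gamma>] XY0 U0 by simp
    have "coord s (f (\<gamma> \<odot> x)) = coord s (f x) + coord s \<gamma>" if "s \<in> {GenV, GenW, GenZ}" for s
      using that Sco by (auto simp: fy')
    then have "\<bar>coord s \<gamma>\<bar> < a s" if "s \<in> {GenV, GenW, GenZ}" for s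
      using box[of s] that by (force simp: abs_less_iff)
    from this[of GenV] this[of GenW] this[of GenZ]
    have "\<bar>coord GenV \<gamma>\<bar> < qv" "\<bar>coord GenW \<gamma>\<bar> < qw" "\<bar>coord GenZ \<gamma>\<bar> < qz" by (simp_all add: a)
    moreover have "coord GenV \<gamma> *\<^sub>R b GenV + coord GenW \<gamma> *\<^sub>R b GenW + coord GenZ \<gamma> *\<^sub>R b GenZ \<in> \<Gamma>"
      using \<gamma> \<gamma>_eq by simp
    ultimately have "coord GenV \<gamma> = 0 \<and> coord GenW \<gamma> = 0 \<and> coord GenZ \<gamma> = 0"
      using gap unfolding gap_def by blast
    then show ?thesis using \<gamma>_eq by simp
  qed
  then show ?thesis using B_sets vol' by blast
qed

lemma int_multiple_small:
  fixes x y :: real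
  assumes "x = of_int k * y" "\<bar>x\<bar> < y"
  shows "x = 0"
proof -
  have "y > 0" using assms(2) by linarith
  then have "\<bar>of_int k :: real\<bar> * y < 1 * y" using assms by (simp add: abs_mult)
  then have "\<bar>of_int k :: real\<bar> < 1" using \<open>y > 0\<close> by (simp only: mult_less_cancel_right_pos)
  then have "k = 0" by linarith
  then show ?thesis using assms by simp
qed

text \<open>When \<open>u\<^sub>0 = coord GenU \<gamma>0\<close> is small, iterated commutators with \<open>\<gamma>0\<close> push the discreteness of
  the centre up to the other two coordinates.\<close>

lemma gap_by_commutators:
  assumes \<zeta>: "\<zeta> > 0" and Z: "\<And>z. z *\<^sub>R b GenZ \<in> \<Gamma> \<Longrightarrow> \<exists>k::int. z = of_int k * \<zeta>"
    and \<gamma>0: "\<gamma>0 \<in> \<Gamma>" "coord GenU \<gamma>0 > 0"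
  shows "gap \<Gamma> (\<zeta> / (coord GenU \<gamma>0)^2) (\<zeta> / coord GenU \<gamma>0) \<zeta>"
  unfolding gap_def
proof (intro allI impI)
  fix v w z
  define u where "u = coord GenU \<gamma>0"
  have u: "u > 0" using \<gamma>0 by (simp add: u_def)
  assume g: "v *\<^sub>R b GenV + w *\<^sub>R b GenW + z *\<^sub>R b GenZ \<in> \<Gamma>" (is "?g \<in> \<Gamma>")
    and "\<bar>v\<bar> < \<zeta> / (coord GenU \<gamma>0)^2" "\<bar>w\<bar> < \<zeta> / coord GenU \<gamma>0" and z: "\<bar>z\<bar> < \<zeta>"
  then have v: "\<bar>u^2 * v\<bar> < \<zeta>" and w: "\<bar>u * w\<bar> < \<zeta>"
    using u by (simp_all add: abs_mult pos_less_divide_eq mult.commute flip: u_def)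
  define c where "c = commut \<gamma>0 ?g"
  have c: "c \<in> \<Gamma>" unfolding c_def by (rule commut_\<Gamma>[OF \<gamma>0(1) g])
  have c_eq: "c = (u * v) *\<^sub>R b GenW + (u * w + u * (u * v) / 2) *\<^sub>R b GenZ"
    by (simp add: c_def commut_eq uvdet_def u_def)
  \<comment> \<open>Two commutators carry v to the centre as u^2 v; once v = 0, one carries w there
    as u w. Each value is a multiple of \<open>\<zeta>\<close> smaller than \<open>\<zeta>\<close>,
    hence 0.\<close>
  have "commut \<gamma>0 c = (u^2 * v) *\<^sub>R b GenZ"
    by (simp add: commut_eq uvdet_def c_eq u_def[symmetric] power2_eq_square)
  then have "(u^2 * v) *\<^sub>R b GenZ \<in> \<Gamma>" using commut_\<Gamma>[OF \<gamma>0(1) c] by simp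
  then obtain k :: int where "u^2 * v = of_int k * \<zeta>" using Z by blast
  then have "u^2 * v = 0" using v by (rule int_multiple_small)
  then have v0: "v = 0" using u by simp
  then have "(u * w) *\<^sub>R b GenZ \<in> \<Gamma>" using c c_eq by simp
  then obtain l :: int where "u * w = of_int l * \<zeta>" using Z by blast
  then have "u * w = 0" using w by (rule int_multiple_small)
  then have w0: "w = 0" using u by simp
  have "z *\<^sub>R b GenZ \<in> \<Gamma>" using g v0 w0 by simp
  then obtain j :: int where "z = of_int j * \<zeta>" using Z by blast
  then have "z = 0" using z by (rule int_multiple_small)
  then show "v = 0 \<and> w = 0 \<and> z = 0" using v0 w0 by simp
qed

text \<open>For u0 >= r the systolic gap already gives u0 r r^2 r^3 >= r^7. For u0 < r the
  commutator spacings multiply with u0 to \<open>\<zeta>^3 / u^2\<close>, at least r^9 / r^2. The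
  factor \<open>\<zeta>^n\<close> supplies the remaining r^(3n).\<close>

lemma packing_lower:
  assumes gap: "gap \<Gamma> r (r^2) (r^3)" and r: "r > 0"
  shows "\<exists>B\<in>sets borel. (\<forall>\<gamma>\<in>\<Gamma>. \<forall>x\<in>B. \<gamma> \<odot> x \<in> B \<longrightarrow> \<gamma> = 0) \<and> ennreal (r ^ (3 * n + 7)) \<le> emeasure coord_lebesgue B"
proof -
  obtain \<zeta> \<gamma>0 where \<zeta>: "r^3 \<le> \<zeta>" and Z: "\<And>z. z *\<^sub>R b GenZ \<in> \<Gamma> \<Longrightarrow> \<exists>k::int. z = of_int k * \<zeta>"
    and \<gamma>0: "\<gamma>0 \<in> \<Gamma>" "coord GenU \<gamma>0 > 0" and U: "\<And>\<gamma>. \<gamma> \<in> \<Gamma> \<Longrightarrow> \<exists>k::int. coord GenU \<gamma> = of_int k * coord GenU \<gamma>0"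
    using lattice_generators[OF gap r] by blast
  define u where "u = coord GenU \<gamma>0"
  have u: "u > 0" using \<gamma>0 by (simp add: u_def)
  have r3: "r^3 > 0" using r by simp
  then have \<zeta>0: "\<zeta> > 0" using \<zeta> by linarith
  have "(r^3)^n \<le> \<zeta>^n" using \<zeta> r3 by (intro power_mono) auto
  then have pn: "r^(3*n) \<le> \<zeta>^n" by (simp add: power_mult)
  have "\<exists>qv qw qz. gap \<Gamma> qv qw qz \<and> qv > 0 \<and> qw > 0 \<and> qz > 0 \<and> r^7 \<le> u * qv * qw * qz"
  proof (cases "r \<le> u")
    case True
    have "r^7 = r * r * r^2 * r^3" by (simp add: eval_nat_numeral)
    also have "\<dots> \<le> u * r * r^2 * r^3" using True r by (intro mult_right_mono) auto
    finally show ?thesis using gap r by (intro exI[of _ r] exI[of _ "r^2"] exI[of _ "r^3"]) auto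
  next
    case False
    have "r^7 * u^2 \<le> r^7 * r^2" using False u r by (intro mult_left_mono power_mono) auto
    also have "\<dots> = (r^3)^3" by (simp add: eval_nat_numeral)
    also have "\<dots> \<le> \<zeta>^3" using \<zeta> r3 by (intro power_mono) auto
    finally have "r^7 \<le> \<zeta>^3 / u^2" using u by (simp add: pos_le_divide_eq)
    also have "\<dots> = u * (\<zeta> / u^2) * (\<zeta> / u) * \<zeta>" using u by (simp add: field_simps eval_nat_numeral)
    finally show ?thesis
      using gap_by_commutators[OF \<zeta>0 Z \<gamma>0] u \<zeta>0
      by (intro exI[of _ "\<zeta> / u^2"] exI[of _ "\<zeta> / u"] exI[of _ \<zeta>]) (auto simp: u_def)
  qed
  then obtain qv qw qz where q: "gap \<Gamma> qv qw qz" "qv > 0" "qw > 0" "qz > 0" "r^7 \<le> u * qv * qw * qz" by blast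
  obtain B where B: "B \<in> sets borel" "\<forall>\<gamma>\<in>\<Gamma>. \<forall>x\<in>B. \<gamma> \<odot> x \<in> B \<longrightarrow> \<gamma> = 0"
    and vol: "ennreal (u * qv * qw * qz * \<zeta> ^ n) \<le> emeasure coord_lebesgue B"
    using packing_box[OF \<zeta>0 Z \<gamma>0 U q(1-4)] unfolding u_def by blast
  have "r ^ (3 * n + 7) = r^7 * r^(3*n)" by (simp add: power_add mult.commute)
  also have "\<dots> \<le> u * qv * qw * qz * \<zeta> ^ n"
    using q u r pn by (intro mult_mono) auto
  finally have "ennreal (r ^ (3 * n + 7)) \<le> ennreal (u * qv * qw * qz * \<zeta> ^ n)" by (rule ennreal_leI)
  then show ?thesis using B vol order_trans by blast
qed

end

section \<open>Lower bound for covolumes and comparison of growth\<close>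

text \<open>The packing set bounds every fundamental domain from below, hence also the infimum that
  defines the covolume; discreteness enters through countability.\<close>

lemma covolume_lower:
  assumes \<mu>: "left_haar_measure G euclidean \<mu>"
    and c: "\<And>A. A \<in> sets borel \<Longrightarrow> emeasure \<mu> A = ennreal c * emeasure coord_lebesgue A"
    and \<Gamma>: "cocompact_lattice G euclidean \<mu> \<Gamma>" and gap: "gap \<Gamma> r (r^2) (r^3)" and r: "r > 0"
  shows "ennreal c * ennreal (r ^ (3 * n + 7)) \<le> covolume G \<mu> \<Gamma>"
proof -
  have sub: "subgroup \<Gamma> G" and disc: "subtopology euclidean \<Gamma> = discrete_topology \<Gamma>"
    using \<Gamma> by (simp_all add: cocompact_lattice_def)
  obtain K where K: "compact K" "set_mult G \<Gamma> K = carrier G" using \<Gamma> by (auto simp: cocompact_lattice_def)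
  have cover: "\<exists>\<gamma>\<in>\<Gamma>. \<exists>k\<in>K. x = \<gamma> \<odot> k" for x
  proof -
    have "x \<in> set_mult G \<Gamma> K" using K(2) by simp
    then show ?thesis by (simp add: set_mult_def)
  qed
  obtain B where B: "B \<in> sets borel" "\<forall>\<gamma>\<in>\<Gamma>. \<forall>x\<in>B. \<gamma> \<odot> x \<in> B \<longrightarrow> \<gamma> = 0"
    and vol: "ennreal (r ^ (3 * n + 7)) \<le> emeasure coord_lebesgue B"
    using packing_lower[OF _ _ _ K(1) cover gap r] subgroup.one_closed[OF sub] subgroup.m_closed[OF sub]
      subgroup.m_inv_closed[OF sub] unfolding G_simps G_inv by blast
  have "ennreal c * ennreal (r ^ (3 * n + 7)) \<le> emeasure \<mu> B"
    unfolding c[OF B(1)] using vol by (rule mult_left_mono) simp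
  also have "\<dots> \<le> covolume G \<mu> \<Gamma>"
    unfolding covolume_def
  proof (rule INF_greatest)
    fix F assume "F \<in> {F. fundamental_domain G \<mu> \<Gamma> F}"
    then show "emeasure \<mu> B \<le> emeasure \<mu> F"
      using packing_le_fundamental_domain[OF \<mu> countable_discrete[OF disc] sub _ B(1)] B(2) by simp
  qed
  finally show ?thesis .
qed

text \<open>Restricted to r >= 1 because a nontrivial element has length at least 1, so no linear
  bound on word lengths holds as r tends to 0.\<close>

lemma systolic_growth_lower:
  assumes S: "compact S" and gen: "generate G S = UNIV" and \<mu>: "left_haar_measure G euclidean \<mu>"
  obtains c C where "c > 0" "C > 0"
    "\<And>r. r \<ge> 1 \<Longrightarrow> ennreal c * ennreal (r ^ (3 * n + 7)) \<le> systolic_growth G euclidean S \<mu> (C * r)"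
proof -
  obtain c where c: "c > 0" "\<And>A. A \<in> sets borel \<Longrightarrow> emeasure \<mu> A = ennreal c * emeasure coord_lebesgue A"
    using haar_eq_coord_lebesgue[OF \<mu>] by blast
  obtain C where C: "C > 0"
    and wl: "\<And>r v w z. r \<ge> 1 \<Longrightarrow> \<bar>v\<bar> \<le> r \<Longrightarrow> \<bar>w\<bar> \<le> r^2 \<Longrightarrow> \<bar>z\<bar> \<le> r^3 \<Longrightarrow>
      real (word_length G S (v *\<^sub>R b GenV + w *\<^sub>R b GenW + z *\<^sub>R b GenZ)) < C * r"
    using word_length_upper[OF S gen] by blast
  have "ennreal c * ennreal (r ^ (3 * n + 7)) \<le> systolic_growth G euclidean S \<mu> (C * r)" if r: "r \<ge> 1" for r
    unfolding systolic_growth_def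
  proof (rule INF_greatest)
    fix \<Gamma> assume "\<Gamma> \<in> {\<Gamma>. cocompact_lattice G euclidean \<mu> \<Gamma> \<and> ennreal (C * r) \<le> systole G S \<Gamma>}"
    then have \<Gamma>: "cocompact_lattice G euclidean \<mu> \<Gamma>"
      and sys: "\<And>x. x \<in> \<Gamma> \<Longrightarrow> x \<noteq> 0 \<Longrightarrow> C * r \<le> real (word_length G S x)"
      by (simp_all add: systole_ge_iff)
    have "gap \<Gamma> r (r^2) (r^3)"
      unfolding gap_def
    proof (intro allI impI)
      fix v w z assume g: "v *\<^sub>R b GenV + w *\<^sub>R b GenW + z *\<^sub>R b GenZ \<in> \<Gamma>" (is "?g \<in> \<Gamma>")
        and "\<bar>v\<bar> < r" "\<bar>w\<bar> < r^2" "\<bar>z\<bar> < r^3"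
      then have "real (word_length G S ?g) < C * r" using wl[OF r] by simp
      then have "?g = 0" using sys[OF g] by linarith
      then have "coord GenV ?g = 0" "coord GenW ?g = 0" "coord GenZ ?g = 0" by simp_all
      then show "v = 0 \<and> w = 0 \<and> z = 0" by simp
    qed
    then show "ennreal c * ennreal (r ^ (3 * n + 7)) \<le> covolume G \<mu> \<Gamma>"
      using r by (intro covolume_lower[OF \<mu> c(2) \<Gamma>]) auto
  qed
  with c(1) C that show ?thesis by blast
qed

end

lemma growth_leI:
  assumes "C > 0" "C' > 0" "C'' > 0" "\<And>r. r > 0 \<Longrightarrow> f r \<le> ennreal C * g (C' * r) + ennreal C''"
  shows "growth_le f g"
  unfolding growth_le_def using assms by blast

theorem theorem1p7:
  fixes n :: nat
    and br :: "'g::euclidean_space \<Rightarrow> 'g \<Rightarrow> 'g"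
    and b :: "gen \<Rightarrow> 'g"
    and S :: "'g set"
    and \<mu> :: "'g measure"
  assumes "is_g4_2n n br b"
    and "compact_generating (bch_group br) euclidean S"
    and "left_haar_measure (bch_group br) euclidean \<mu>"
  shows "homogeneous_dimension br = 2 * n + 7 \<and>
    growth_equiv (systolic_growth (bch_group br) euclidean S \<mu>)
      (\<lambda>r. ennreal (r ^ (homogeneous_dimension br + n)))"
proof -
  interpret filiform_heisenberg n br b by unfold_locales fact
  have S: "compact S" and gen: "generate G S = UNIV"
    using assms(2) by (simp_all add: compact_generating_def)
  let ?\<sigma> = "systolic_growth G euclidean S \<mu>" and ?p = "3 * n + 7"
  have p: "homogeneous_dimension br + n = ?p" by (simp add: homogeneous_dimension_eq)
  obtain C where C: "C > 0" "\<And>r. r > 0 \<Longrightarrow> ?\<sigma> r \<le> ennreal (C * r ^ ?p)"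
    using systolic_growth_upper[OF S gen assms(3)] by blast
  have "growth_le ?\<sigma> (\<lambda>r. ennreal (r ^ ?p))"
  proof (rule growth_leI[of C 1 1])
    fix r :: real assume r: "r > 0"
    have "?\<sigma> r \<le> ennreal C * ennreal ((1 * r) ^ ?p)"
      using C(2)[OF r] C(1) r by (simp add: ennreal_mult)
    also have "\<dots> \<le> \<dots> + ennreal 1" by simp
    finally show "?\<sigma> r \<le> ennreal C * ennreal ((1 * r) ^ ?p) + ennreal 1" .
  qed (use C in auto)
  moreover
  obtain c C' where c: "c > 0" and C': "C' > 0"
    and low: "\<And>r. r \<ge> 1 \<Longrightarrow> ennreal c * ennreal (r ^ ?p) \<le> ?\<sigma> (C' * r)"
    using systolic_growth_lower[OF S gen assms(3)] by blast
  have "growth_le (\<lambda>r. ennreal (r ^ ?p)) ?\<sigma>"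
  \<comment> \<open>\<open>1 / c\<close> undoes the normalisation of the Haar measure; the additive
    1 absorbs r < 1, where the lower bound says nothing.\<close>
  proof (rule growth_leI[of "1 / c" C' 1])
    fix r :: real assume r: "r > 0"
    show "ennreal (r ^ ?p) \<le> ennreal (1 / c) * ?\<sigma> (C' * r) + ennreal 1"
    proof (cases "r \<ge> 1")
      case True
      have "ennreal (r ^ ?p) = ennreal (1 / c) * (ennreal c * ennreal (r ^ ?p))"
        using c r by (simp add: ennreal_mult[symmetric] del: ennreal_power)
      also have "\<dots> \<le> ennreal (1 / c) * ?\<sigma> (C' * r)"
        using low[OF True] by (rule mult_left_mono) simp
      also have "\<dots> \<le> \<dots> + ennreal 1" by simp
      finally show ?thesis .
    next
      case False
      then have "ennreal (r ^ ?p) \<le> ennreal 1" using r by (intro ennreal_leI power_le_one) auto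
      also have "\<dots> \<le> ennreal (1 / c) * ?\<sigma> (C' * r) + ennreal 1" by simp
      finally show ?thesis .
    qed
  qed (use c C' in auto)
  ultimately show ?thesis
    unfolding growth_equiv_def p by (simp add: homogeneous_dimension_eq)
qed

end
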